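(* Let $P=(P(i,j))_{(i,j)\in\mathbb{N}^2}$ be an irreducible and aperiodic Markov kernel on $\mathbb{N}$ with a unique invariant probability measure $\pi=(\pi(i))_{i\in\mathbb{N}}$, and assume that there exist $i_0\in\mathbb{N}$ and an integer $N\ge 1$ such that for all $i\ge i_0$ and all $j\in\mathbb{N}$, $|i-j|>N$ implies $P(i,j)=0$. Assume moreover: (i) for every $m=-N,\dots,N$, $P(i,i+m)\to a_m\in[0,1]$ as $i\to+\infty$; (ii) $\pi(i+1)/\pi(i)\to\tau\in[0,1)$ as $i\to+\infty$; (iii) $\sum_{k=-N}^N k\,a_k<0$. Let $$\alpha_0 := \sum_{m=-N}^N \limsup_{i\to+\infty} \sqrt{P(i,i+m)\, P^*(i+m,i)} = \begin{cases}\displaystyle\sum_{m=-N}^{N} a_m\,\tau^{-m/2} & \text{if }\tau\in(0,1),\\ a_0 & \text{if }\tau=0,\end{cases}$$ let $V:=(\pi(n)^{-1/2})_{n\in\mathbb{N}}$, and let $\rho_k:=\max\{|\lambda|:\lambda\in\sigma(P_k),\ |\lambda|<1\}$, where $P_k$ is the $k$-th truncated and augmented matrix of $P$. Then: (a) $\varrho_2\le\alpha_0\Longleftrightarrow\varrho_V\le\alpha_0$, and in this case $\limsup_{k}\rho_k\le\alpha_0$; (b) $\varrho_2>\alpha_0\Longleftrightarrow\varrho_V>\alpha_0$, and in this case $\varrho_2=\varrho_V=\lim_k\rho_k$.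
   Context: $\mathbb{N}=\{0,1,2,\dots\}$. By irreducibility $\pi(i)>0$ for all $i$. The $k$-th truncated (and augmented) matrix $P_k=(P_k(i,j))_{0\le i,j\le k-1}$ is defined by $P_k(i,j):=P(i,j)$ for $0\le i\le k-1$, $0\le j\le k-2$, and $P_k(i,k-1):=\sum_{\ell\ge k-1}P(i,\ell)$ for $0\le i\le k-1$. $\sigma(P_k)$ is its set of (complex) eigenvalues. $\ell^2(\pi)$ is the Hilbert space of sequences $f\in\mathbb{C}^{\mathbb{N}}$ with $\|f\|_2:=[\sum_{i\ge0}|f(i)|^2\pi(i)]^{1/2}<\infty$. $P$ acts by $(Pf)(i)=\sum_jP(i,j)f(j)$; its adjoint on $\ell^2(\pi)$ is given by the kernel $P^*(i,j):=\pi(j)P(j,i)/\pi(i)$. Put $\pi(f):=\sum_{i\ge0}f(i)\pi(i)$ and $\Pi f:=\pi(f)1_{\mathbb{N}}$, with $1_{\mathbb{N}}$ the constant sequence $1$. $\mathcal{B}_V$ is the Banach space of sequences $g\in\mathbb{C}^{\mathbb{N}}$ with $\|g\|_V:=\sup_{n}V(n)^{-1}|g(n)|<\infty$. $\varrho_2$ is the infimum of the $\rho\in(0,1)$ for which there is $C\in(0,+\infty)$ with $\|P^nf-\Pi f\|_2\le C\rho^n\|f\|_2$ for all $n\ge1$, $f\in\ell^2(\pi)$. $\varrho_V$ is the infimum of the $\rho\in(0,1)$ for which there is $C\in(0,+\infty)$ with $\|P^nf-\Pi f\|_V\le C\rho^n\|f\|_V$ for all $n\ge1$, $f\in\mathcal{B}_V$.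 (Under the stated assumptions both sets of $\rho$ are nonempty.) *)

theory Defs
  imports
    "HOL-Library.Extended_Real"
    "HOL-Library.Liminf_Limsup"
    "Jordan_Normal_Form.Spectral_Radius"
begin

type_synonym kernel = "nat \<Rightarrow> nat \<Rightarrow> real"
type_synonym cseq = "nat \<Rightarrow> complex"

definition markov_kernel :: "kernel \<Rightarrow> bool" where
  "markov_kernel P \<longleftrightarrow> (\<forall>i j. 0 \<le> P i j) \<and> (\<forall>i. (\<lambda>j. P i j) sums 1)"

primrec kernel_pow :: "kernel \<Rightarrow> nat \<Rightarrow> kernel" where
  "kernel_pow P 0 = (\<lambda>i j. if i = j then 1 else 0)"
| "kernel_pow P (Suc n) = (\<lambda>i j. \<Sum>l. P i l * kernel_pow P n l j)"

definition irreducible_kernel :: "kernel \<Rightarrow> bool" where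
  "irreducible_kernel P \<longleftrightarrow> (\<forall>i j. \<exists>n\<ge>1. kernel_pow P n i j > 0)"

definition aperiodic_kernel :: "kernel \<Rightarrow> bool" where
  "aperiodic_kernel P \<longleftrightarrow> (\<forall>i. Gcd {n. n \<ge> 1 \<and> kernel_pow P n i i > 0} = 1)"

definition invariant_prob :: "kernel \<Rightarrow> (nat \<Rightarrow> real) \<Rightarrow> bool" where
  "invariant_prob P \<pi> \<longleftrightarrow>
     (\<forall>i. 0 \<le> \<pi> i) \<and> \<pi> sums 1 \<and> (\<forall>j. (\<lambda>i. \<pi> i * P i j) sums \<pi> j)"

definition adj_kernel :: "kernel \<Rightarrow> (nat \<Rightarrow> real) \<Rightarrow> kernel" where
  "adj_kernel P \<pi> = (\<lambda>i j. \<pi> j * P j i / \<pi> i)"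

definition kernel_op :: "kernel \<Rightarrow> cseq \<Rightarrow> cseq" where
  "kernel_op P f = (\<lambda>i. \<Sum>j. of_real (P i j) * f j)"

definition mean_op :: "(nat \<Rightarrow> real) \<Rightarrow> cseq \<Rightarrow> cseq" where
  "mean_op \<pi> f = (\<lambda>_. \<Sum>i. f i * of_real (\<pi> i))"

definition ell2 :: "(nat \<Rightarrow> real) \<Rightarrow> cseq set" where
  "ell2 \<pi> = {f. summable (\<lambda>i. (cmod (f i))\<^sup>2 * \<pi> i)}"

definition ell2_norm :: "(nat \<Rightarrow> real) \<Rightarrow> cseq \<Rightarrow> real" where
  "ell2_norm \<pi> f = sqrt (\<Sum>i. (cmod (f i))\<^sup>2 * \<pi> i)"

definition wsup :: "(nat \<Rightarrow> real) \<Rightarrow> cseq set" where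
  "wsup V = {g. bdd_above (range (\<lambda>n. cmod (g n) / V n))}"

definition wsup_norm :: "(nat \<Rightarrow> real) \<Rightarrow> cseq \<Rightarrow> real" where
  "wsup_norm V g = (SUP n. cmod (g n) / V n)"

(* The norms above are real-valued and meaningful only on their spaces; the membership
   conjunct expresses that the left-hand norm in the estimate is finite. *)
definition conv_rates ::
  "cseq set \<Rightarrow> (cseq \<Rightarrow> real) \<Rightarrow> kernel \<Rightarrow> (nat \<Rightarrow> real) \<Rightarrow> real set" where
  "conv_rates X nrm P \<pi> = {\<rho>. 0 < \<rho> \<and> \<rho> < 1 \<and>
     (\<exists>C>0. \<forall>n\<ge>1. \<forall>f\<in>X.
        (\<lambda>i. (kernel_op P ^^ n) f i - mean_op \<pi> f i) \<in> X \<and>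
        nrm (\<lambda>i. (kernel_op P ^^ n) f i - mean_op \<pi> f i) \<le> C * \<rho> ^ n * nrm f)}"

definition rate2 :: "kernel \<Rightarrow> (nat \<Rightarrow> real) \<Rightarrow> real" where
  "rate2 P \<pi> = Inf (conv_rates (ell2 \<pi>) (ell2_norm \<pi>) P \<pi>)"

definition rateV :: "(nat \<Rightarrow> real) \<Rightarrow> kernel \<Rightarrow> (nat \<Rightarrow> real) \<Rightarrow> real" where
  "rateV V P \<pi> = Inf (conv_rates (wsup V) (wsup_norm V) P \<pi>)"

(* The last column of the k x k matrix collects the mass P(i,l), l >= k-1. *)
definition trunc :: "kernel \<Rightarrow> nat \<Rightarrow> complex mat" where
  "trunc P k = mat k k (\<lambda>(i, j).
     of_real (if j = k - 1 then (\<Sum>l. P i (k - 1 + l)) else P i j))"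

(* Unspecified when there is no eigenvalue of modulus < 1, i.e. when trunc P k is a
   permutation matrix (e.g. k = 1).  For an irreducible kernel on the naturals with an
   invariant probability this happens for finitely many k only. *)
definition rho_trunc :: "kernel \<Rightarrow> nat \<Rightarrow> real" where
  "rho_trunc P k = Max (cmod ` {z \<in> spectrum (trunc P k). cmod z < 1})"

(* The index i + m is a natural number as soon as i >= N, so the truncation by nat does not
   affect the limsup. *)
definition alpha0 :: "nat \<Rightarrow> kernel \<Rightarrow> (nat \<Rightarrow> real) \<Rightarrow> ereal" where
  "alpha0 N P \<pi> = (\<Sum>m = - int N..int N. limsup (\<lambda>i.
     ereal (sqrt (P i (nat (int i + m)) * adj_kernel P \<pi> (nat (int i + m)) i))))"

end

theory Submission
  imports "HOL-Complex_Analysis.Great_Picard" Defs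
begin

text \<open>
  Outside the disc of radius \<open>\<alpha>\<^sub>0\<close>, both convergence rates and the eigenvalues of the
  truncated matrices are described by the zeros of one and the same holomorphic function, the
  determinant of a matrix of fixed finite size.

  Put \<open>T f = P f - f(0) 1\<close>. Since \<open>P 1 = 1\<close>, passing from \<open>P\<close> to \<open>T\<close> only replaces one
  eigenvalue 1 by 0, and \<open>T\<^sup>n f = P\<^sup>n f - (P\<^sup>n\<^sup>-\<^sup>1 f)(0) 1\<close>; hence \<open>P\<^sup>n - \<Pi>\<close> decays at a given
  rate as soon as \<open>T\<^sup>n\<close> does. The functional \<open>f(0)\<close> is used instead of \<open>\<pi>(f)\<close> because it makes
  sense for the truncated matrices as well, so that the eigenvalue 1 is removed from \<open>P\<close> and from
  every truncation in the same way.

  The scaled entries \<open>P(i,i+m) (\<pi>(i)/\<pi>(i+m))\<^bsup>1/2\<^esup>\<close> converge to the summands of \<open>\<alpha>\<^sub>0\<close>. For every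
  \<open>\<delta> > \<alpha>\<^sub>0\<close> there is therefore an \<open>n0\<close> such that the rows of \<open>T\<close> from \<open>n0\<close> on form an operator
  \<open>B\<close> whose scaled row sums and scaled column sums are at most \<open>\<delta>\<close>. The row sums bound its norm
  in \<open>\<B>\<^sub>V\<close>, and by the Schur test the row and column sums bound its norm in
  \<open>\<ell>\<^sup>2(\<pi>)\<close> (\<open>eventually_contracting\<close>). The bound \<open>\<pi>(i) P(i,j) \<le> \<pi>(j)\<close> covers the case
  \<open>\<tau> = 0\<close> and the finitely many rows that need not have bounded support.

  The first \<open>n0\<close> coordinates of \<open>T\<^sup>n f\<close> then satisfy a renewal equation with the matrices
  \<open>A\<^sub>k(i,j) = (T B\<^sup>k e\<^sub>j)(i) = O(\<delta>\<^sup>k)\<close>. Its characteristic function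
  \<open>d(z) = det (1 - \<Sum>\<^sub>k A\<^sub>k z\<^sup>k\<^sup>+\<^sup>1)\<close> is holomorphic for \<open>|z| < 1/\<delta>\<close> and does not depend on the
  norm. If \<open>d\<close> has no zero with \<open>|z| < R\<close>, Cramer's rule gives \<open>\<parallel>T\<^sup>n\<parallel> = O(r\<^sup>n)\<close> for every
  \<open>r > 1/R\<close> (\<open>T_pow_bound\<close>). A zero \<open>z\<close> gives the eigenvector \<open>\<Sum>\<^sub>k z\<^sup>k B\<^sup>k u\<close> of \<open>T\<close> with
  eigenvalue \<open>1/z\<close>; it lies in both spaces, so \<open>1/|z|\<close> is a lower bound for both rates
  (\<open>rate_ge_of_zero\<close>), and irreducibility and aperiodicity force \<open>1/|z| < 1\<close>
  (\<open>eigenvalue_modulus\<close>). Thus either both rates equal the reciprocal of the least modulus of a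
  zero, or both are at most \<open>\<delta>\<close>.

  The \<open>k\<close>-th truncated matrix acts as \<open>f \<mapsto> P (f(min \<cdot> (k-1)))\<close> on the first \<open>k\<close>
  coordinates. As \<open>V\<close> is eventually increasing, freezing \<open>f\<close> beyond \<open>k-1\<close> does not increase its
  norm, so the same \<open>n0\<close> and \<open>\<delta>\<close> serve for all large \<open>k\<close>, and the characteristic functions
  \<open>d\<^sub>k\<close> converge to \<open>d\<close> uniformly on compact sets (\<open>char_fps_uniform_limit\<close>). By Hurwitz's
  theorem the zeros of \<open>d\<^sub>k\<close> accumulate exactly at those of \<open>d\<close>, which gives the statements on
  \<open>\<rho>\<^sub>k\<close>. Letting \<open>\<delta>\<close> decrease to \<open>\<alpha>\<^sub>0\<close> yields a dichotomy from which the proposition is read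
  off (\<open>dichotomy\<close>).
\<close>

section \<open>Power series with geometrically bounded coefficients\<close>

lemma fps_conv_radius_sum:
  fixes F :: "'b \<Rightarrow> complex fps"
  assumes "\<And>j. j \<in> S \<Longrightarrow> R \<le> fps_conv_radius (F j)"
  shows "R \<le> fps_conv_radius (\<Sum>j\<in>S. F j)"
  using assms
proof (induction S rule: infinite_finite_induct)
  case (insert x S)
  have "min (fps_conv_radius (F x)) (fps_conv_radius (sum F S)) \<le> fps_conv_radius (F x + sum F S)"
    by (rule fps_conv_radius_add)
  moreover have "R \<le> min (fps_conv_radius (F x)) (fps_conv_radius (sum F S))"
    using insert by auto
  ultimately have "R \<le> fps_conv_radius (F x + sum F S)" by (rule order_trans[rotated])
  then show ?case using insert by simp
qed auto

lemma fps_conv_radius_prod: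
  fixes F :: "'b \<Rightarrow> complex fps"
  assumes "\<And>j. j \<in> S \<Longrightarrow> R \<le> fps_conv_radius (F j)"
  shows "R \<le> fps_conv_radius (\<Prod>j\<in>S. F j)"
  using assms
proof (induction S rule: infinite_finite_induct)
  case (insert x S)
  have "min (fps_conv_radius (F x)) (fps_conv_radius (prod F S)) \<le> fps_conv_radius (F x * prod F S)"
    by (rule fps_conv_radius_mult)
  moreover have "R \<le> min (fps_conv_radius (F x)) (fps_conv_radius (prod F S))"
    using insert by auto
  ultimately have "R \<le> fps_conv_radius (F x * prod F S)" by (rule order_trans[rotated])
  then show ?case using insert by simp
qed auto

lemma eval_fps_sum':
  fixes F :: "'b \<Rightarrow> complex fps"
  assumes "\<And>j. j \<in> S \<Longrightarrow> R \<le> fps_conv_radius (F j)" "ereal (norm z) < R"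
  shows "eval_fps (\<Sum>j\<in>S. F j) z = (\<Sum>j\<in>S. eval_fps (F j) z)"
  using assms
proof (induction S rule: infinite_finite_induct)
  case (insert x S)
  have "R \<le> fps_conv_radius (F x)" "R \<le> fps_conv_radius (sum F S)"
    using insert by (auto intro: fps_conv_radius_sum)
  then have "eval_fps (F x + sum F S) z = eval_fps (F x) z + eval_fps (sum F S) z"
    using insert.prems(2) by (intro eval_fps_add) (auto intro: less_le_trans)
  then show ?case using insert by auto
qed auto

lemma eval_fps_prod':
  fixes F :: "'b \<Rightarrow> complex fps"
  assumes "\<And>j. j \<in> S \<Longrightarrow> R \<le> fps_conv_radius (F j)" "ereal (norm z) < R"
  shows "eval_fps (\<Prod>j\<in>S. F j) z = (\<Prod>j\<in>S. eval_fps (F j) z)"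
  using assms
proof (induction S rule: infinite_finite_induct)
  case (insert x S)
  have "R \<le> fps_conv_radius (F x)" "R \<le> fps_conv_radius (prod F S)"
    using insert by (auto intro: fps_conv_radius_prod)
  then have "eval_fps (F x * prod F S) z = eval_fps (F x) z * eval_fps (prod F S) z"
    using insert.prems(2) by (intro eval_fps_mult) (auto intro: less_le_trans)
  then show ?case using insert by auto
qed auto

lemma fps_conv_radius_signof: "R \<le> fps_conv_radius (signof p * f)" if "R \<le> fps_conv_radius (f :: complex fps)"
  using that by (auto simp: sign_def)

lemma fps_conv_radius_det:
  fixes A :: "complex fps mat"
  assumes A: "A \<in> carrier_mat n n"
    and R: "\<And>i j. i < n \<Longrightarrow> j < n \<Longrightarrow> R \<le> fps_conv_radius (A $$ (i, j))"
  shows "R \<le> fps_conv_radius (det A)"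
  unfolding det_def'[OF A]
  by (intro fps_conv_radius_sum fps_conv_radius_signof fps_conv_radius_prod R)
     (auto dest: permutes_in_image)

lemma eval_fps_det:
  fixes A :: "complex fps mat"
  assumes A: "A \<in> carrier_mat n n"
    and R: "\<And>i j. i < n \<Longrightarrow> j < n \<Longrightarrow> R \<le> fps_conv_radius (A $$ (i, j))"
    and z: "ereal (norm z) < R"
  shows "eval_fps (det A) z = det (mat n n (\<lambda>(i, j). eval_fps (A $$ (i, j)) z))"
proof -
  let ?B = "mat n n (\<lambda>(i, j). eval_fps (A $$ (i, j)) z)"
  have p: "eval_fps (signof p * (\<Prod>i = 0..<n. A $$ (i, p i))) z
      = signof p * (\<Prod>i = 0..<n. ?B $$ (i, p i))" if "p permutes {0..<n}" for p
  proof -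
    have pi: "p i < n" if "i < n" for i
      using permutes_in_image[OF \<open>p permutes {0..<n}\<close>, of i] that by auto
    have r: "R \<le> fps_conv_radius (\<Prod>i = 0..<n. A $$ (i, p i))"
      by (intro fps_conv_radius_prod R) (auto simp: pi)
    have "eval_fps (\<Prod>i = 0..<n. A $$ (i, p i)) z = (\<Prod>i = 0..<n. eval_fps (A $$ (i, p i)) z)"
      by (rule eval_fps_prod'[OF _ z]) (auto intro!: R simp: pi)
    also have "\<dots> = (\<Prod>i = 0..<n. ?B $$ (i, p i))"
      by (rule prod.cong) (auto simp: pi)
    finally show ?thesis
      using z r by (auto simp: sign_def eval_fps_minus less_le_trans)
  qed
  have "eval_fps (det A) z
      = (\<Sum>p\<in>{p. p permutes {0..<n}}. eval_fps (signof p * (\<Prod>i = 0..<n. A $$ (i, p i))) z)"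
    unfolding det_def'[OF A]
    by (rule eval_fps_sum'[OF _ z])
       (intro fps_conv_radius_signof fps_conv_radius_prod R; auto dest: permutes_in_image)
  also have "\<dots> = det ?B"
    unfolding det_def'[of ?B n, simplified] using p by (intro sum.cong) auto
  finally show ?thesis .
qed

lemma fps_conv_radius_geI_bound:
  fixes f :: "complex fps"
  assumes b: "\<And>n. norm (fps_nth f n) \<le> C * \<delta> ^ n" and d: "0 < \<delta>"
  shows "ereal (1 / \<delta>) \<le> fps_conv_radius f"
  unfolding fps_conv_radius_def
proof (rule conv_radius_geI_ex')
  fix r :: real assume r: "0 < r" "ereal r < ereal (1 / \<delta>)"
  have q: "\<delta> * r < 1" using r d by (simp add: field_simps)
  show "summable (\<lambda>n. fps_nth f n * of_real r ^ n)"
  proof (rule summable_comparison_test')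
    show "summable (\<lambda>n. C * (\<delta> * r) ^ n)"
      using q r d by (intro summable_mult summable_geometric) auto
    show "norm (fps_nth f n * of_real r ^ n) \<le> C * (\<delta> * r) ^ n" if "n \<ge> 0" for n
    proof -
      have "norm (fps_nth f n * of_real r ^ n) = norm (fps_nth f n) * r ^ n"
        using r by (simp add: norm_mult norm_power)
      also have "\<dots> \<le> C * \<delta> ^ n * r ^ n" using b[of n] r by (intro mult_right_mono) auto
      finally show ?thesis by (simp add: power_mult_distrib mult.assoc)
    qed
  qed
qed

lemma fps_nth_bound_of_conv_radius:
  fixes f :: "complex fps"
  assumes "ereal (1 / r) < fps_conv_radius f" and r: "0 < r"
  obtains C where "0 < C" "\<And>n. norm (fps_nth f n) \<le> C * r ^ n"
proof -
  have "summable (\<lambda>n. fps_nth f n * of_real (1 / r) ^ n)"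
    by (rule summable_in_conv_radius) (use assms in \<open>auto simp: fps_conv_radius_def norm_divide\<close>)
  then have "Bseq (\<lambda>n. fps_nth f n * of_real (1 / r) ^ n)"
    by (intro convergent_imp_Bseq) (auto dest: summable_LIMSEQ_zero simp: convergent_def)
  then obtain C where C: "0 < C" "\<And>n. norm (fps_nth f n * of_real (1 / r) ^ n) \<le> C"
    by (auto simp: Bseq_def)
  have "norm (fps_nth f n) \<le> C * r ^ n" for n
  proof -
    have "norm (fps_nth f n) / r ^ n \<le> C"
      using C(2)[of n] r by (simp add: norm_mult norm_power norm_divide power_divide)
    then show ?thesis using r by (simp add: field_simps)
  qed
  with C(1) show ?thesis by (rule that)
qed

section \<open>Operators that contract outside finitely many coordinates\<close>

definition unit_seq :: "nat \<Rightarrow> cseq" where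
  "unit_seq j = (\<lambda>i. if i = j then 1 else 0)"

text \<open>
  The operator \<open>T\<close> with its first \<open>n0\<close> rows deleted; in the applications it is a contraction
  with a factor close to the essential spectral radius.
\<close>

definition tail_part :: "nat \<Rightarrow> (cseq \<Rightarrow> cseq) \<Rightarrow> cseq \<Rightarrow> cseq" where
  "tail_part n0 T f = (\<lambda>i. if i < n0 then 0 else T f i)"

definition head_vec :: "nat \<Rightarrow> complex vec \<Rightarrow> cseq" where
  "head_vec n0 u = (\<lambda>i. \<Sum>j<n0. u $ j * unit_seq j i)"

text \<open>
  If \<open>T\<close> is given by a matrix, this is the total weight of the paths from \<open>i\<close> to \<open>j\<close> in
  \<open>n + 1\<close> steps whose intermediate states are all at least \<open>n0\<close>. For \<open>i, j < n0\<close> these are the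
  first-return weights to \<open>{0..<n0}\<close>.
\<close>

definition ret_coeff :: "nat \<Rightarrow> (cseq \<Rightarrow> cseq) \<Rightarrow> nat \<Rightarrow> nat \<Rightarrow> nat \<Rightarrow> complex" where
  "ret_coeff n0 T n i j = T ((tail_part n0 T ^^ n) (unit_seq j)) i"

text \<open>
  The factor \<open>X\<close> is there because a return with \<open>n\<close> intermediate states takes \<open>n + 1\<close> steps.
\<close>

definition ret_fps :: "nat \<Rightarrow> (cseq \<Rightarrow> cseq) \<Rightarrow> nat \<Rightarrow> nat \<Rightarrow> complex fps" where
  "ret_fps n0 T i j = fps_X * Abs_fps (\<lambda>n. ret_coeff n0 T n i j)"

definition ret_mat :: "nat \<Rightarrow> (cseq \<Rightarrow> cseq) \<Rightarrow> complex fps mat" where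
  "ret_mat n0 T = mat n0 n0 (\<lambda>(i, j). (if i = j then 1 else 0) - ret_fps n0 T i j)"

text \<open>
  The counterpart of \<open>det (1 - z T)\<close>, which itself makes no sense for an infinite matrix: the
  tail is eliminated first, and what remains has size \<open>n0\<close>.
\<close>

definition char_fps :: "nat \<Rightarrow> (cseq \<Rightarrow> cseq) \<Rightarrow> complex fps" where
  "char_fps n0 T = det (ret_mat n0 T)"

lemma head_vec_apply: "head_vec n0 u i = (if i < n0 then u $ i else 0)"
proof -
  have "head_vec n0 u i = (\<Sum>j<n0. if i = j then u $ j else 0)"
    unfolding head_vec_def unit_seq_def by (intro sum.cong) auto
  then show ?thesis by simp
qed

lemma ret_mat_carrier [simp]: "ret_mat n0 T \<in> carrier_mat n0 n0"
  by (simp add: ret_mat_def)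

lemma ret_mat_index: "i < n0 \<Longrightarrow> j < n0 \<Longrightarrow>
    ret_mat n0 T $$ (i, j) = (if i = j then 1 else 0) - ret_fps n0 T i j"
  by (simp add: ret_mat_def)

lemma tail_part_pow_head: "k > 0 \<Longrightarrow> i < n0 \<Longrightarrow> (tail_part n0 T ^^ k) f i = 0"
  by (cases k) (auto simp: tail_part_def)

lemma tail_part_pow_tail: "n0 \<le> i \<Longrightarrow> (tail_part n0 T ^^ Suc k) f i = T ((tail_part n0 T ^^ k) f) i"
  by (auto simp: tail_part_def)

text \<open>
  Only what the renewal argument uses is required of the space: a norm under which the coordinates
  are continuous and for which pointwise limits of bounded sequences stay in the space. This last
  condition replaces completeness; it holds for weighted suprema and, as a form of Fatou's lemma, for
  weighted square sums. In this way the two norms are treated at once, with the same matrices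
  \<open>ret_coeff\<close>.
\<close>

locale tail_contraction =
  fixes X :: "cseq set" and nrm :: "cseq \<Rightarrow> real" and T :: "cseq \<Rightarrow> cseq"
    and n0 :: nat and \<delta> L :: real
  assumes X_add: "\<And>f g. f \<in> X \<Longrightarrow> g \<in> X \<Longrightarrow> (\<lambda>i. f i + g i) \<in> X"
    and X_scale: "\<And>f c. f \<in> X \<Longrightarrow> (\<lambda>i. c * f i) \<in> X"
    and X_unit: "\<And>j. unit_seq j \<in> X"
    and nrm_nonneg: "\<And>f. f \<in> X \<Longrightarrow> 0 \<le> nrm f"
    and nrm_add: "\<And>f g. f \<in> X \<Longrightarrow> g \<in> X \<Longrightarrow> nrm (\<lambda>i. f i + g i) \<le> nrm f + nrm g"
    and nrm_scale: "\<And>f c. f \<in> X \<Longrightarrow> nrm (\<lambda>i. c * f i) = cmod c * nrm f"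
    and coord_bound: "\<And>i. \<exists>c. \<forall>f\<in>X. cmod (f i) \<le> c * nrm f"
    and X_closed: "\<And>F f C. (\<And>k. F k \<in> X) \<Longrightarrow> (\<And>k. nrm (F k) \<le> C) \<Longrightarrow>
            (\<And>i. (\<lambda>k. F k i) \<longlonglongrightarrow> f i) \<Longrightarrow> f \<in> X"
    and T_X: "\<And>f. f \<in> X \<Longrightarrow> T f \<in> X"
    and T_add: "\<And>f g. f \<in> X \<Longrightarrow> g \<in> X \<Longrightarrow> T (\<lambda>i. f i + g i) = (\<lambda>i. T f i + T g i)"
    and T_scale: "\<And>f c. f \<in> X \<Longrightarrow> T (\<lambda>i. c * f i) = (\<lambda>i. c * T f i)"
    and T_head: "\<And>f i. f \<in> X \<Longrightarrow> i < n0 \<Longrightarrow> cmod (T f i) \<le> L * nrm f"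
    and T_tail: "\<And>f. f \<in> X \<Longrightarrow> nrm (tail_part n0 T f) \<le> \<delta> * nrm f"
    and delta_pos: "0 < \<delta>"
    and L_nonneg: "0 \<le> L"
begin

abbreviation B :: "cseq \<Rightarrow> cseq" where "B \<equiv> tail_part n0 T"

lemma X_zero: "(\<lambda>i. 0) \<in> X" and nrm_zero: "nrm (\<lambda>i. 0) = 0" and T_zero: "T (\<lambda>i. 0) = (\<lambda>i. 0)"
  using X_scale[OF X_unit, of 0] nrm_scale[OF X_unit, of 0] T_scale[OF X_unit, of 0] by simp_all

lemma
  assumes "finite S" "\<And>j. j \<in> S \<Longrightarrow> F j \<in> X"
  shows lincomb_X: "(\<lambda>i. \<Sum>j\<in>S. c j * F j i) \<in> X"
    and nrm_lincomb: "nrm (\<lambda>i. \<Sum>j\<in>S. c j * F j i) \<le> (\<Sum>j\<in>S. cmod (c j) * nrm (F j))"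
    and T_lincomb: "T (\<lambda>i. \<Sum>j\<in>S. c j * F j i) = (\<lambda>i. \<Sum>j\<in>S. c j * T (F j) i)"
proof -
  have "(\<lambda>i. \<Sum>j\<in>S. c j * F j i) \<in> X
    \<and> nrm (\<lambda>i. \<Sum>j\<in>S. c j * F j i) \<le> (\<Sum>j\<in>S. cmod (c j) * nrm (F j))
    \<and> T (\<lambda>i. \<Sum>j\<in>S. c j * F j i) = (\<lambda>i. \<Sum>j\<in>S. c j * T (F j) i)"
    using assms
  proof (induction S rule: finite_induct)
    case empty
    show ?case by (simp add: X_zero nrm_zero T_zero)
  next
    case (insert x S)
    let ?g = "\<lambda>i. \<Sum>j\<in>S. c j * F j i"
    have g: "?g \<in> X" "nrm ?g \<le> (\<Sum>j\<in>S. cmod (c j) * nrm (F j))"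
      "T ?g = (\<lambda>i. \<Sum>j\<in>S. c j * T (F j) i)"
      using insert by auto
    have x: "F x \<in> X" using insert by auto
    have eq: "(\<lambda>i. \<Sum>j\<in>insert x S. c j * F j i) = (\<lambda>i. c x * F x i + ?g i)"
      using insert by simp
    show ?case
      unfolding eq using X_add[OF X_scale[OF x] g(1)] nrm_add[OF X_scale[OF x] g(1), of "c x"]
        T_add[OF X_scale[OF x] g(1), of "c x"] g x insert(1,2)
      by (simp add: nrm_scale T_scale)
  qed
  then show "(\<lambda>i. \<Sum>j\<in>S. c j * F j i) \<in> X"
    "nrm (\<lambda>i. \<Sum>j\<in>S. c j * F j i) \<le> (\<Sum>j\<in>S. cmod (c j) * nrm (F j))"
    "T (\<lambda>i. \<Sum>j\<in>S. c j * F j i) = (\<lambda>i. \<Sum>j\<in>S. c j * T (F j) i)" by auto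
qed

lemma head_vec_X: "head_vec n0 u \<in> X"
  unfolding head_vec_def by (rule lincomb_X) (auto simp: X_unit)

lemma nrm_head_vec: "nrm (head_vec n0 u) \<le> (\<Sum>j<n0. cmod (u $ j) * nrm (unit_seq j))"
  unfolding head_vec_def by (rule nrm_lincomb) (auto simp: X_unit)

lemma B_X: assumes "f \<in> X" shows "B f \<in> X"
proof -
  have "B f = (\<lambda>i. T f i + (-1) * head_vec n0 (vec n0 (T f)) i)"
    by (auto simp: tail_part_def head_vec_apply)
  also have "\<dots> \<in> X" by (intro X_add X_scale T_X head_vec_X assms)
  finally show ?thesis .
qed

lemma B_pow_X: "f \<in> X \<Longrightarrow> (B ^^ k) f \<in> X"
  by (induction k) (auto intro: B_X)

lemma T_pow_X: "f \<in> X \<Longrightarrow> (T ^^ k) f \<in> X"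
  by (induction k) (auto intro: T_X)

lemma nrm_B_pow: "f \<in> X \<Longrightarrow> nrm ((B ^^ k) f) \<le> \<delta> ^ k * nrm f"
proof (induction k)
  case (Suc k)
  have "nrm ((B ^^ Suc k) f) \<le> \<delta> * nrm ((B ^^ k) f)"
    using T_tail[OF B_pow_X[OF Suc.prems]] by simp
  also have "\<dots> \<le> \<delta> * (\<delta> ^ k * nrm f)"
    using Suc delta_pos by (intro mult_left_mono) auto
  finally show ?case by (simp add: mult_ac)
qed simp

lemma B_pow_lincomb:
  assumes "finite S" "\<And>j. j \<in> S \<Longrightarrow> F j \<in> X"
  shows "(B ^^ k) (\<lambda>i. \<Sum>j\<in>S. c j * F j i) = (\<lambda>i. \<Sum>j\<in>S. c j * (B ^^ k) (F j) i)"
proof (induction k)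
  case (Suc k)
  have "(B ^^ Suc k) (\<lambda>i. \<Sum>j\<in>S. c j * F j i) = B (\<lambda>i. \<Sum>j\<in>S. c j * (B ^^ k) (F j) i)"
    using Suc by simp
  also have "\<dots> = (\<lambda>i. \<Sum>j\<in>S. c j * (B ^^ Suc k) (F j) i)"
    using T_lincomb[OF assms(1), of "\<lambda>j. (B ^^ k) (F j)" c] assms(2)
    by (auto simp: tail_part_def B_pow_X fun_eq_iff)
  finally show ?case .
qed simp

lemma T_B_pow_head_vec:
  "T ((B ^^ k) (head_vec n0 u)) i = (\<Sum>j<n0. ret_coeff n0 T k i j * u $ j)"
proof -
  have "(B ^^ k) (head_vec n0 u) = (\<lambda>i. \<Sum>j<n0. u $ j * (B ^^ k) (unit_seq j) i)"
    unfolding head_vec_def by (rule B_pow_lincomb) (auto simp: X_unit)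
  then have "T ((B ^^ k) (head_vec n0 u)) i = (\<Sum>j<n0. u $ j * T ((B ^^ k) (unit_seq j)) i)"
    using T_lincomb[of "{..<n0}" "\<lambda>j. (B ^^ k) (unit_seq j)" "\<lambda>j. u $ j"]
    by (simp add: X_unit B_pow_X)
  then show ?thesis by (simp add: ret_coeff_def mult.commute)
qed

lemma ret_coeff_bound:
  assumes "i < n0"
  shows "cmod (ret_coeff n0 T k i j) \<le> L * nrm (unit_seq j) * \<delta> ^ k"
proof -
  have "cmod (ret_coeff n0 T k i j) \<le> L * nrm ((B ^^ k) (unit_seq j))"
    unfolding ret_coeff_def by (rule T_head) (auto simp: B_pow_X X_unit assms)
  also have "\<dots> \<le> L * (\<delta> ^ k * nrm (unit_seq j))"
    by (intro mult_left_mono nrm_B_pow X_unit L_nonneg)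
  finally show ?thesis by (simp add: mult_ac)
qed

lemma conv_radius_ret_fps: "i < n0 \<Longrightarrow> ereal (1 / \<delta>) \<le> fps_conv_radius (ret_fps n0 T i j)"
proof -
  assume i: "i < n0"
  have "ereal (1 / \<delta>) \<le> fps_conv_radius (Abs_fps (\<lambda>n. ret_coeff n0 T n i j))"
    by (rule fps_conv_radius_geI_bound[of _ "L * nrm (unit_seq j)"])
       (use ret_coeff_bound[OF i] delta_pos in \<open>auto simp: mult_ac\<close>)
  also have "\<dots> = min (fps_conv_radius (fps_X :: complex fps)) \<dots>" by simp
  also have "\<dots> \<le> fps_conv_radius (ret_fps n0 T i j)"
    unfolding ret_fps_def by (rule fps_conv_radius_mult)
  finally show ?thesis .
qed

lemma conv_radius_ret_mat:
  "i < n0 \<Longrightarrow> j < n0 \<Longrightarrow> ereal (1 / \<delta>) \<le> fps_conv_radius (ret_mat n0 T $$ (i, j))"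
proof -
  assume ij: "i < n0" "j < n0"
  have "ereal (1 / \<delta>) \<le> min (fps_conv_radius (if i = j then 1 else 0 :: complex fps)) (fps_conv_radius (ret_fps n0 T i j))"
    using conv_radius_ret_fps[OF ij(1)] by auto
  also have "\<dots> \<le> fps_conv_radius (ret_mat n0 T $$ (i, j))"
    unfolding ret_mat_index[OF ij] by (rule fps_conv_radius_diff)
  finally show ?thesis .
qed

lemma conv_radius_char_fps: "ereal (1 / \<delta>) \<le> fps_conv_radius (char_fps n0 T)"
  unfolding char_fps_def
  by (rule fps_conv_radius_det[OF ret_mat_carrier]) (rule conv_radius_ret_mat)

lemma eval_ret_fps_sums:
  assumes i: "i < n0" and z: "cmod z < 1 / \<delta>"
  shows "(\<lambda>k. z ^ Suc k * ret_coeff n0 T k i j) sums eval_fps (ret_fps n0 T i j) z"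
proof -
  let ?g = "Abs_fps (\<lambda>n. ret_coeff n0 T n i j)"
  have R: "ereal (1 / \<delta>) \<le> fps_conv_radius ?g"
    by (rule fps_conv_radius_geI_bound[of _ "L * nrm (unit_seq j)"])
       (use ret_coeff_bound[OF i] delta_pos in \<open>auto simp: mult_ac\<close>)
  have zR: "ereal (norm z) < fps_conv_radius ?g"
    using z R by (meson ereal_less_eq less_ereal.simps(1) less_le_trans)
  have "(\<lambda>k. fps_nth ?g k * z ^ k) sums eval_fps ?g z"
    by (rule sums_eval_fps[OF zR])
  then have "(\<lambda>k. z * (fps_nth ?g k * z ^ k)) sums (z * eval_fps ?g z)"
    by (rule sums_mult)
  moreover have "eval_fps (ret_fps n0 T i j) z = z * eval_fps ?g z"
    unfolding ret_fps_def using zR by (subst eval_fps_mult) auto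
  ultimately show ?thesis by (simp add: mult_ac)
qed

lemma eval_char_fps:
  assumes z: "cmod z < 1 / \<delta>"
  shows "eval_fps (char_fps n0 T) z
     = det (mat n0 n0 (\<lambda>(i, j). (if i = j then 1 else 0) - eval_fps (ret_fps n0 T i j) z))"
proof -
  have "eval_fps (char_fps n0 T) z = det (mat n0 n0 (\<lambda>(i, j). eval_fps (ret_mat n0 T $$ (i, j)) z))"
    unfolding char_fps_def
    by (rule eval_fps_det[where R = "ereal (1 / \<delta>)", OF ret_mat_carrier])
       (use z in \<open>auto intro: conv_radius_ret_mat\<close>)
  also have "mat n0 n0 (\<lambda>(i, j). eval_fps (ret_mat n0 T $$ (i, j)) z)
     = mat n0 n0 (\<lambda>(i, j). (if i = j then 1 else 0) - eval_fps (ret_fps n0 T i j) z)"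
  proof (intro eq_matI; clarsimp simp: ret_mat_index)
    fix i j assume ij: "i < n0" "j < n0"
    have "ereal (cmod z) < fps_conv_radius (ret_fps n0 T i j)"
      using conv_radius_ret_fps[OF ij(1), of j] z by (meson less_ereal.simps(1) less_le_trans)
    then show "(i = j \<longrightarrow> eval_fps (1 - ret_fps n0 T j j) z = 1 - eval_fps (ret_fps n0 T j j) z) \<and>
       (i \<noteq> j \<longrightarrow> eval_fps (- ret_fps n0 T i j) z = - eval_fps (ret_fps n0 T i j) z)"
      by (auto simp: eval_fps_diff eval_fps_minus)
  qed
  finally show ?thesis .
qed

text \<open>
  A zero of the determinant is a nontrivial solution of an \<open>n0\<close>-dimensional fixed-point equation;
  in this form it is turned into eigenvectors of \<open>T\<close> and back.
\<close>

lemma char_fps_zero_iff: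
  assumes z: "cmod z < 1 / \<delta>"
  shows "eval_fps (char_fps n0 T) z = 0 \<longleftrightarrow>
    (\<exists>u \<in> carrier_vec n0. u \<noteq> 0\<^sub>v n0 \<and>
      (\<forall>i<n0. (\<Sum>j<n0. eval_fps (ret_fps n0 T i j) z * u $ j) = u $ i))"
proof -
  let ?M = "mat n0 n0 (\<lambda>(i, j). (if i = j then 1 else 0) - eval_fps (ret_fps n0 T i j) z)"
  have "eval_fps (char_fps n0 T) z = 0 \<longleftrightarrow>
      (\<exists>v. v \<in> carrier_vec n0 \<and> v \<noteq> 0\<^sub>v n0 \<and> ?M *\<^sub>v v = 0\<^sub>v n0)"
    unfolding eval_char_fps[OF z] by (rule det_0_iff_vec_prod_zero_field) simp
  also have "\<dots> \<longleftrightarrow> (\<exists>u \<in> carrier_vec n0. u \<noteq> 0\<^sub>v n0 \<and>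
      (\<forall>i<n0. (\<Sum>j<n0. eval_fps (ret_fps n0 T i j) z * u $ j) = u $ i))"
  proof -
    have "?M *\<^sub>v v = 0\<^sub>v n0 \<longleftrightarrow>
      (\<forall>i<n0. (\<Sum>j<n0. eval_fps (ret_fps n0 T i j) z * v $ j) = v $ i)"
      if v: "v \<in> carrier_vec n0" for v
    proof -
      have "(?M *\<^sub>v v) $ i = v $ i - (\<Sum>j<n0. eval_fps (ret_fps n0 T i j) z * v $ j)"
        if i: "i < n0" for i
      proof -
        have "(?M *\<^sub>v v) $ i = (\<Sum>j<n0. ?M $$ (i, j) * v $ j)"
          using i v by (simp add: scalar_prod_def lessThan_atLeast0)
        also have "\<dots> = (\<Sum>j<n0. (if j = i then v $ j else 0) - eval_fps (ret_fps n0 T i j) z * v $ j)"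
          using i by (intro sum.cong) (simp_all add: left_diff_distrib)
        also have "\<dots> = v $ i - (\<Sum>j<n0. eval_fps (ret_fps n0 T i j) z * v $ j)"
          using i by (simp add: sum_subtractf)
        finally show ?thesis .
      qed
      moreover have "?M *\<^sub>v v = 0\<^sub>v n0 \<longleftrightarrow> (\<forall>i<n0. (?M *\<^sub>v v) $ i = 0)"
        by (metis (no_types, lifting) dim_mult_mat_vec dim_row_mat(1) eq_vecI index_zero_vec)
      ultimately show ?thesis by (metis (no_types, lifting) eq_iff_diff_eq_0)
    qed
    then show ?thesis by blast
  qed
  finally show ?thesis .
qed

lemma char_fps_0: "eval_fps (char_fps n0 T) 0 = 1"
proof -
  have "eval_fps (char_fps n0 T) 0
     = det (mat n0 n0 (\<lambda>(i, j). (if i = j then 1 else 0) - eval_fps (ret_fps n0 T i j) 0))"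
    by (rule eval_char_fps) (simp add: delta_pos)
  also have "mat n0 n0 (\<lambda>(i, j). (if i = j then 1 else 0) - eval_fps (ret_fps n0 T i j) 0) = 1\<^sub>m n0"
    by (intro eq_matI) (auto simp: eval_fps_at_0 ret_fps_def)
  finally show ?thesis by simp
qed

end

section \<open>Growth of the powers, from the zeros of the characteristic series\<close>

lemma geometric_convolution_le:
  fixes r \<delta> :: real
  assumes "0 < \<delta>" "\<delta> < r"
  shows "(\<Sum>m\<le>n. r ^ m * \<delta> ^ (n - m)) \<le> r / (r - \<delta>) * r ^ n"
proof -
  have "(r - \<delta>) * (\<Sum>m\<le>n. r ^ m * \<delta> ^ (n - m)) = r ^ Suc n - \<delta> ^ Suc n"
    by (simp only: diff_power_eq_sum lessThan_Suc_atMost)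
  also have "\<dots> \<le> r * r ^ n" using assms by simp
  finally show ?thesis using assms by (simp add: field_simps)
qed

context tail_contraction
begin

lemma B_add: "f \<in> X \<Longrightarrow> g \<in> X \<Longrightarrow> B (\<lambda>i. f i + g i) = (\<lambda>i. B f i + B g i)"
  by (auto simp: tail_part_def T_add)

text \<open>
  Split \<open>T\<^sup>n f\<close> according to the last time at which one of the first \<open>n0\<close> rows is used. As the
  powers of the tail are small, it is enough to control the first \<open>n0\<close> coordinates of the orbit.
\<close>

lemma T_pow_decomp:
  assumes f: "f \<in> X"
  defines "h \<equiv> \<lambda>n. head_vec n0 (vec n0 ((T ^^ n) f))"
  shows "(T ^^ n) f = (\<lambda>i. (\<Sum>k<n. (B ^^ k) (h (n - k)) i) + (B ^^ n) f i)"
proof (induction n)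
  case (Suc n)
  have hX: "h m \<in> X" for m unfolding h_def by (rule head_vec_X)
  have sX: "(\<lambda>i. \<Sum>k<n. (B ^^ k) (h (n - k)) i) \<in> X"
    using lincomb_X[of "{..<n}" "\<lambda>k. (B ^^ k) (h (n - k))" "\<lambda>_. 1"] by (simp add: hX B_pow_X)
  have sB: "B (\<lambda>i. \<Sum>k<n. (B ^^ k) (h (n - k)) i) = (\<lambda>i. \<Sum>k<n. (B ^^ Suc k) (h (n - k)) i)"
    using B_pow_lincomb[of "{..<n}" "\<lambda>k. (B ^^ k) (h (n - k))" 1 "\<lambda>_. 1"] by (simp add: hX B_pow_X)
  show ?case
  proof
    fix i
    have "(T ^^ Suc n) f i = h (Suc n) i + B ((T ^^ n) f) i"
      by (simp add: h_def head_vec_apply tail_part_def)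
    also have "B ((T ^^ n) f) i = (\<Sum>k<n. (B ^^ Suc k) (h (n - k)) i) + (B ^^ Suc n) f i"
      by (subst Suc.IH, subst B_add[OF sX B_pow_X[OF f]], subst sB) simp
    also have "h (Suc n) i + ((\<Sum>k<n. (B ^^ Suc k) (h (n - k)) i) + (B ^^ Suc n) f i)
        = (\<Sum>k<Suc n. (B ^^ k) (h (Suc n - k)) i) + (B ^^ Suc n) f i"
      by (subst sum.lessThan_Suc_shift) simp
    finally show "(T ^^ Suc n) f i = \<dots>" .
  qed
qed simp

text \<open>
  Applying one more row below \<open>n0\<close> to the decomposition turns it into a renewal equation for
  those coordinates.
\<close>

lemma T_pow_Suc_renewal:
  assumes f: "f \<in> X"
  shows "(T ^^ Suc n) f i
    = (\<Sum>j<n0. \<Sum>k<n. ret_coeff n0 T k i j * (T ^^ (n - k)) f j) + T ((B ^^ n) f) i"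
proof -
  define h where "h m = head_vec n0 (vec n0 ((T ^^ m) f))" for m
  have hX: "h m \<in> X" for m unfolding h_def by (rule head_vec_X)
  have sX: "(\<lambda>i. \<Sum>k<n. (B ^^ k) (h (n - k)) i) \<in> X"
    and sT: "T (\<lambda>i. \<Sum>k<n. (B ^^ k) (h (n - k)) i) = (\<lambda>i. \<Sum>k<n. T ((B ^^ k) (h (n - k))) i)"
    using lincomb_X[of "{..<n}" "\<lambda>k. (B ^^ k) (h (n - k))" "\<lambda>_. 1"]
      T_lincomb[of "{..<n}" "\<lambda>k. (B ^^ k) (h (n - k))" "\<lambda>_. 1"]
    by (simp_all add: hX B_pow_X)
  have "(T ^^ Suc n) f i = T ((T ^^ n) f) i" by simp
  also have "\<dots> = (\<Sum>k<n. T ((B ^^ k) (h (n - k))) i) + T ((B ^^ n) f) i"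
    by (subst T_pow_decomp[OF f, folded h_def], subst T_add[OF sX B_pow_X[OF f]], subst sT) simp
  also have "(\<Sum>k<n. T ((B ^^ k) (h (n - k))) i)
      = (\<Sum>k<n. \<Sum>j<n0. ret_coeff n0 T k i j * (T ^^ (n - k)) f j)"
    unfolding h_def T_B_pow_head_vec by (intro sum.cong) auto
  also have "\<dots> = (\<Sum>j<n0. \<Sum>k<n. ret_coeff n0 T k i j * (T ^^ (n - k)) f j)"
    by (rule sum.swap)
  finally show ?thesis .
qed

text \<open>
  The constant coefficient is set to 0 rather than to \<open>f i\<close>: the contribution of the initial
  value is part of the source term, in which \<open>f\<close> is moved by the tail alone.
\<close>

definition orbit_fps :: "cseq \<Rightarrow> nat \<Rightarrow> complex fps" where
  "orbit_fps f i = Abs_fps (\<lambda>n. if n = 0 then 0 else (T ^^ n) f i)"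

definition source_fps :: "cseq \<Rightarrow> nat \<Rightarrow> complex fps" where
  "source_fps f i = fps_X * Abs_fps (\<lambda>n. T ((B ^^ n) f) i)"

lemma orbit_fps_renewal:
  assumes f: "f \<in> X"
  shows "orbit_fps f i - (\<Sum>j<n0. ret_fps n0 T i j * orbit_fps f j) = source_fps f i"
proof (rule fps_ext)
  fix n
  show "fps_nth (orbit_fps f i - (\<Sum>j<n0. ret_fps n0 T i j * orbit_fps f j)) n
      = fps_nth (source_fps f i) n"
  proof (cases n)
    case 0
    then show ?thesis by (simp add: orbit_fps_def source_fps_def fps_sum_nth ret_fps_def)
  next
    case (Suc m)
    have "fps_nth (ret_fps n0 T i j * orbit_fps f j) (Suc m)
        = (\<Sum>k<m. ret_coeff n0 T k i j * (T ^^ (m - k)) f j)" for j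
    proof -
      have "fps_nth (ret_fps n0 T i j * orbit_fps f j) (Suc m)
        = fps_nth (Abs_fps (\<lambda>n. ret_coeff n0 T n i j) * orbit_fps f j) m"
        by (simp add: ret_fps_def mult.assoc)
      also have "\<dots> = (\<Sum>k\<in>{..<m} \<union> {m}. ret_coeff n0 T k i j * fps_nth (orbit_fps f j) (m - k))"
        by (simp add: fps_mult_nth atLeast0AtMost lessThan_Suc_atMost[symmetric] lessThan_Suc Un_commute)
      also have "\<dots> = (\<Sum>k<m. ret_coeff n0 T k i j * fps_nth (orbit_fps f j) (m - k))"
        by (subst sum.union_disjoint) (auto simp: orbit_fps_def)
      also have "\<dots> = (\<Sum>k<m. ret_coeff n0 T k i j * (T ^^ (m - k)) f j)"
        by (intro sum.cong) (auto simp: orbit_fps_def)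
      finally show ?thesis .
    qed
    then show ?thesis
      using T_pow_Suc_renewal[OF f, of m i]
      by (simp add: Suc fps_sum_nth orbit_fps_def source_fps_def del: funpow.simps)
  qed
qed

lemma char_fps_nth_0: "fps_nth (char_fps n0 T) 0 = 1"
  using char_fps_0 by (simp add: eval_fps_at_0)

text \<open>
  Cramer's rule over the ring of power series. The solution is a fixed matrix of power series
  applied to the source, so a bound for that matrix is uniform in \<open>f\<close>.
\<close>

lemma orbit_fps_solution:
  assumes f: "f \<in> X" and i: "i < n0"
  shows "orbit_fps f i
    = (\<Sum>j<n0. inverse (char_fps n0 T) * adj_mat (ret_mat n0 T) $$ (i, j) * source_fps f j)"
proof -
  let ?M = "ret_mat n0 T" and ?D = "char_fps n0 T"
  let ?x = "vec n0 (orbit_fps f)" and ?b = "vec n0 (source_fps f)"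
  note adj = adj_mat[OF ret_mat_carrier[of n0 T]]
  have Mx: "?M *\<^sub>v ?x = ?b"
  proof (rule eq_vecI)
    fix i assume "i < dim_vec ?b"
    then have i: "i < n0" by simp
    have "(?M *\<^sub>v ?x) $ i = (\<Sum>j<n0. ?M $$ (i, j) * orbit_fps f j)"
      using i by (simp add: scalar_prod_def lessThan_atLeast0 ret_mat_def)
    also have "\<dots> = (\<Sum>j<n0. (if j = i then orbit_fps f j else 0) - ret_fps n0 T i j * orbit_fps f j)"
      using i by (intro sum.cong) (simp_all add: ret_mat_index left_diff_distrib)
    also have "\<dots> = orbit_fps f i - (\<Sum>j<n0. ret_fps n0 T i j * orbit_fps f j)"
      using i by (simp add: sum_subtractf)
    finally show "(?M *\<^sub>v ?x) $ i = ?b $ i" using orbit_fps_renewal[OF f] i by simp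
  qed (simp add: ret_mat_def)
  have "adj_mat ?M *\<^sub>v ?b = (adj_mat ?M * ?M) *\<^sub>v ?x"
    unfolding Mx[symmetric] by (rule assoc_mult_mat_vec[symmetric, OF adj(1) ret_mat_carrier]) simp
  also have "\<dots> = (?D \<cdot>\<^sub>m 1\<^sub>m n0) *\<^sub>v ?x" by (simp add: adj char_fps_def)
  finally have "(adj_mat ?M *\<^sub>v ?b) $ i = ((?D \<cdot>\<^sub>m 1\<^sub>m n0) *\<^sub>v ?x) $ i" by simp
  moreover have "(adj_mat ?M *\<^sub>v ?b) $ i = (\<Sum>j<n0. adj_mat ?M $$ (i, j) * source_fps f j)"
    using i adj(1) by (simp add: scalar_prod_def lessThan_atLeast0)
  moreover have "((?D \<cdot>\<^sub>m 1\<^sub>m n0) *\<^sub>v ?x) $ i = ?D * orbit_fps f i"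
  proof -
    have "((?D \<cdot>\<^sub>m 1\<^sub>m n0) *\<^sub>v ?x) $ i = (\<Sum>j<n0. if j = i then ?D * orbit_fps f j else 0)"
      using i unfolding lessThan_atLeast0
      by (simp add: scalar_prod_def if_distrib[of "\<lambda>x. _ * x * _"] cong: if_cong)
    then show ?thesis using i by simp
  qed
  ultimately have "?D * orbit_fps f i = (\<Sum>j<n0. adj_mat ?M $$ (i, j) * source_fps f j)" by simp
  then have "inverse ?D * (?D * orbit_fps f i)
      = inverse ?D * (\<Sum>j<n0. adj_mat ?M $$ (i, j) * source_fps f j)" by simp
  moreover have "inverse ?D * (?D * orbit_fps f i) = orbit_fps f i"
    using inverse_mult_eq_1[of ?D] char_fps_nth_0 by (simp add: mult.assoc[symmetric])
  ultimately show ?thesis by (simp add: sum_distrib_left mult.assoc)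
qed

lemma conv_radius_adj:
  assumes "i < n0" "j < n0"
  shows "ereal (1 / \<delta>) \<le> fps_conv_radius (adj_mat (ret_mat n0 T) $$ (i, j))"
proof -
  let ?M = "ret_mat n0 T"
  have d: "mat_delete ?M j i \<in> carrier_mat (n0 - 1) (n0 - 1)"
    by (rule mat_delete_carrier) simp
  have dims: "dim_row ?M = n0" "dim_col ?M = n0" by (simp_all add: ret_mat_def)
  have r: "ereal (1 / \<delta>) \<le> fps_conv_radius (det (mat_delete ?M j i))"
  proof (rule fps_conv_radius_det[OF d])
    fix i' j' assume ij': "i' < n0 - 1" "j' < n0 - 1"
    then have "mat_delete ?M j i $$ (i', j')
        = ?M $$ (if i' < j then i' else Suc i', if j' < i then j' else Suc j')"
      by (simp add: mat_delete_def dims)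
    then show "ereal (1 / \<delta>) \<le> fps_conv_radius (mat_delete ?M j i $$ (i', j'))"
      using ij' by (auto intro!: conv_radius_ret_mat)
  qed
  have "adj_mat ?M $$ (i, j) = (- 1) ^ (j + i) * det (mat_delete ?M j i)"
    using assms by (simp add: adj_mat_def cofactor_def dims)
  then show ?thesis using r by (cases "even (j + i)") auto
qed

lemma source_fps_bound:
  assumes "f \<in> X" "i < n0"
  shows "cmod (fps_nth (source_fps f i) n) \<le> L / \<delta> * nrm f * \<delta> ^ n"
proof (cases n)
  case 0
  then show ?thesis using assms delta_pos L_nonneg by (simp add: source_fps_def nrm_nonneg)
next
  case (Suc m)
  have "cmod (T ((B ^^ m) f) i) \<le> L * nrm ((B ^^ m) f)"
    by (rule T_head) (auto simp: B_pow_X assms)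
  also have "\<dots> \<le> L * (\<delta> ^ m * nrm f)"
    by (intro mult_left_mono nrm_B_pow assms L_nonneg)
  finally show ?thesis using delta_pos by (simp add: Suc source_fps_def mult_ac)
qed

text \<open>
  Without zeros in \<open>|z| < R\<close>, the inverse of the determinant is holomorphic there, so the
  coefficients of the solution matrix are \<open>O(r\<^sup>n)\<close>. The source and the tail contribute only
  \<open>O(\<delta>\<^sup>n)\<close>, and convolving with a faster geometric decay preserves \<open>O(r\<^sup>n)\<close>.
\<close>

theorem T_pow_bound:
  assumes r: "\<delta> < r" and R: "1 / r < R" "R \<le> 1 / \<delta>"
    and nz: "\<And>z. cmod z < R \<Longrightarrow> eval_fps (char_fps n0 T) z \<noteq> 0"
  obtains C where "0 < C" "\<And>n f. f \<in> X \<Longrightarrow> nrm ((T ^^ n) f) \<le> C * r ^ n * nrm f"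
proof -
  have r0: "0 < r" using r delta_pos by simp
  \<comment> \<open>the inverse of the renewal matrix\<close>
  define H where "H = (\<lambda>i j. inverse (char_fps n0 T) * adj_mat (ret_mat n0 T) $$ (i, j))"
  have "\<exists>C>0. \<forall>n. cmod (fps_nth (H i j) n) \<le> C * r ^ n" if ij: "i < n0" "j < n0" for i j
  proof -
    have "ereal R \<le> min (ereal R) (fps_conv_radius (char_fps n0 T))"
      using conv_radius_char_fps R(2) by (meson ereal_less_eq(3) min.boundedI order_refl order_trans)
    also have "\<dots> \<le> fps_conv_radius (inverse (char_fps n0 T))"
      by (rule fps_conv_radius_inverse) (use nz in auto)
    finally have "ereal R \<le> fps_conv_radius (inverse (char_fps n0 T))" .
    moreover have "ereal R \<le> fps_conv_radius (adj_mat (ret_mat n0 T) $$ (i, j))"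
      using conv_radius_adj[OF ij] R(2) by (meson ereal_less_eq(3) order_trans)
    ultimately have "ereal R \<le> fps_conv_radius (H i j)"
      unfolding H_def by (intro order_trans[OF _ fps_conv_radius_mult]) auto
    then have "ereal (1 / r) < fps_conv_radius (H i j)"
      using R(1) by (meson less_ereal.simps(1) less_le_trans)
    from fps_nth_bound_of_conv_radius[OF this r0] show ?thesis by metis
  qed
  then obtain c where c: "\<And>i j. i < n0 \<Longrightarrow> j < n0 \<Longrightarrow> c i j > 0"
    "\<And>i j n. i < n0 \<Longrightarrow> j < n0 \<Longrightarrow> cmod (fps_nth (H i j) n) \<le> c i j * r ^ n"
    by metis
  define K where "K = r / (r - \<delta>)"
  have K0: "0 < K" unfolding K_def using r r0 by simp
  define M where "M = (\<lambda>i. \<Sum>j<n0. c i j * (L / \<delta>) * K)"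
  have x: "cmod ((T ^^ n) f i) \<le> M i * r ^ n * nrm f" if f: "f \<in> X" and i: "i < n0" and n: "n > 0" for f i n
  proof -
    have one: "cmod (fps_nth (H i j * source_fps f j) n) \<le> c i j * (L / \<delta>) * K * r ^ n * nrm f"
      if j: "j < n0" for j
    proof -
      have "cmod (fps_nth (H i j * source_fps f j) n)
          \<le> (\<Sum>m\<le>n. cmod (fps_nth (H i j) m) * cmod (fps_nth (source_fps f j) (n - m)))"
        unfolding fps_mult_nth atLeast0AtMost
        by (rule order_trans[OF norm_sum]) (simp add: norm_mult)
      also have "\<dots> \<le> (\<Sum>m\<le>n. (c i j * r ^ m) * (L / \<delta> * nrm f * \<delta> ^ (n - m)))"
        using c(1)[OF i j] r0
        by (intro sum_mono mult_mono c(2)[OF i j] source_fps_bound[OF f j]) auto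
      also have "\<dots> = c i j * (L / \<delta>) * nrm f * (\<Sum>m\<le>n. r ^ m * \<delta> ^ (n - m))"
        by (simp add: sum_distrib_left mult_ac)
      also have "\<dots> \<le> c i j * (L / \<delta>) * nrm f * (K * r ^ n)"
        unfolding K_def using c(1)[OF i j] L_nonneg delta_pos nrm_nonneg[OF f] r
        by (intro mult_left_mono geometric_convolution_le) auto
      finally show ?thesis by (simp add: mult_ac)
    qed
    have "(T ^^ n) f i = fps_nth (orbit_fps f i) n" using n by (simp add: orbit_fps_def)
    also have "\<dots> = (\<Sum>j<n0. fps_nth (H i j * source_fps f j) n)"
      unfolding orbit_fps_solution[OF f i] H_def by (simp add: fps_sum_nth)
    finally have "cmod ((T ^^ n) f i) \<le> (\<Sum>j<n0. cmod (fps_nth (H i j * source_fps f j) n))"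
      using norm_sum by metis
    also have "\<dots> \<le> (\<Sum>j<n0. c i j * (L / \<delta>) * K * r ^ n * nrm f)"
      by (intro sum_mono one) auto
    finally show ?thesis by (simp add: M_def sum_distrib_right)
  qed
  define M' where "M' = (\<Sum>i<n0. M i * nrm (unit_seq i))"
  have M0: "0 \<le> M i" if "i < n0" for i
    unfolding M_def using c(1) L_nonneg delta_pos K0 that
    by (intro sum_nonneg mult_nonneg_nonneg) (auto intro: less_imp_le)
  have M'0: "0 \<le> M'"
    unfolding M'_def by (intro sum_nonneg mult_nonneg_nonneg M0 nrm_nonneg X_unit) auto
  define h where "h f m = head_vec n0 (vec n0 ((T ^^ m) f))" for f m
  have hX: "h f m \<in> X" for f m unfolding h_def by (rule head_vec_X)
  have h: "nrm (h f n) \<le> M' * r ^ n * nrm f" if f: "f \<in> X" and n: "n > 0" for f n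
  proof -
    have "nrm (h f n) \<le> (\<Sum>j<n0. cmod (vec n0 ((T ^^ n) f) $ j) * nrm (unit_seq j))"
      unfolding h_def by (rule nrm_head_vec)
    also have "\<dots> \<le> (\<Sum>j<n0. (M j * r ^ n * nrm f) * nrm (unit_seq j))"
      using x[OF f _ n] by (intro sum_mono mult_right_mono nrm_nonneg X_unit) auto
    finally show ?thesis by (simp add: M'_def sum_distrib_left sum_distrib_right mult_ac)
  qed
  show ?thesis
  proof (rule that)
    show "0 < M' * K + 1" using M'0 K0 by (simp add: add_nonneg_pos)
    fix n f assume f: "f \<in> X"
    have sX: "(\<lambda>i. \<Sum>k<n. (B ^^ k) (h f (n - k)) i) \<in> X"
      and sn: "nrm (\<lambda>i. \<Sum>k<n. (B ^^ k) (h f (n - k)) i) \<le> (\<Sum>k<n. nrm ((B ^^ k) (h f (n - k))))"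
      using lincomb_X[of "{..<n}" "\<lambda>k. (B ^^ k) (h f (n - k))" "\<lambda>_. 1"]
        nrm_lincomb[of "{..<n}" "\<lambda>k. (B ^^ k) (h f (n - k))" "\<lambda>_. 1"]
      by (simp_all add: hX B_pow_X)
    have "nrm ((T ^^ n) f) \<le> nrm (\<lambda>i. \<Sum>k<n. (B ^^ k) (h f (n - k)) i) + nrm ((B ^^ n) f)"
      unfolding T_pow_decomp[OF f, of n, folded h_def] by (rule nrm_add[OF sX B_pow_X[OF f]])
    also have "\<dots> \<le> (\<Sum>k<n. \<delta> ^ k * (M' * r ^ (n - k) * nrm f)) + \<delta> ^ n * nrm f"
    proof (intro add_mono nrm_B_pow f order_trans[OF sn] sum_mono)
      fix k assume "k \<in> {..<n}"
      then have k: "0 < n - k" by simp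
      have "nrm ((B ^^ k) (h f (n - k))) \<le> \<delta> ^ k * nrm (h f (n - k))" by (rule nrm_B_pow[OF hX])
      also have "\<dots> \<le> \<delta> ^ k * (M' * r ^ (n - k) * nrm f)"
        using delta_pos by (intro mult_left_mono h[OF f k]) auto
      finally show "nrm ((B ^^ k) (h f (n - k))) \<le> \<delta> ^ k * (M' * r ^ (n - k) * nrm f)" .
    qed
    also have "(\<Sum>k<n. \<delta> ^ k * (M' * r ^ (n - k) * nrm f)) = M' * nrm f * (\<Sum>k<n. \<delta> ^ k * r ^ (n - k))"
      by (simp add: sum_distrib_left mult_ac)
    also have "(\<Sum>k<n. \<delta> ^ k * r ^ (n - k)) \<le> K * r ^ n"
    proof -
      have "(\<Sum>k<n. \<delta> ^ k * r ^ (n - k)) \<le> (\<Sum>k\<le>n. \<delta> ^ k * r ^ (n - k))"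
        using delta_pos r0 by (intro sum_mono2) auto
      also have "\<dots> = (\<Sum>m\<le>n. r ^ m * \<delta> ^ (n - m))"
        by (rule sum.reindex_bij_witness[of _ "\<lambda>m. n - m" "\<lambda>m. n - m"]) auto
      also have "\<dots> \<le> K * r ^ n" unfolding K_def by (rule geometric_convolution_le[OF delta_pos r])
      finally show ?thesis .
    qed
    then have "M' * nrm f * (\<Sum>k<n. \<delta> ^ k * r ^ (n - k)) \<le> M' * nrm f * (K * r ^ n)"
      by (intro mult_left_mono mult_nonneg_nonneg M'0 nrm_nonneg f)
    moreover have "\<delta> ^ n * nrm f \<le> r ^ n * nrm f"
      using delta_pos r by (intro mult_right_mono power_mono nrm_nonneg f) auto
    ultimately show "nrm ((T ^^ n) f) \<le> (M' * K + 1) * r ^ n * nrm f"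
      by (simp add: algebra_simps)
  qed
qed

end

section \<open>Eigenvectors, from the zeros of the characteristic series\<close>

text \<open>
  The only possible eigenvector with eigenvalue \<open>1/z\<close> and head \<open>u\<close>: its tail must satisfy
  \<open>f = u + z B f\<close>, which is solved by a Neumann series.
\<close>

definition eigen_seq :: "nat \<Rightarrow> (cseq \<Rightarrow> cseq) \<Rightarrow> complex \<Rightarrow> complex vec \<Rightarrow> cseq" where
  "eigen_seq n0 T z u = (\<lambda>i. \<Sum>k. z ^ k * (tail_part n0 T ^^ k) (head_vec n0 u) i)"

text \<open>
  Continuity along bounded, pointwise convergent sequences, which for kernels is dominated
  convergence. It is what allows \<open>T\<close> to be applied to a Neumann series term by term, although the
  series is only known to converge pointwise.
\<close>

definition pointwise_continuous :: "cseq set \<Rightarrow> (cseq \<Rightarrow> real) \<Rightarrow> (cseq \<Rightarrow> cseq) \<Rightarrow> bool" where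
  "pointwise_continuous X nrm T \<longleftrightarrow> (\<forall>F f C. (\<forall>k. F k \<in> X) \<longrightarrow> (\<forall>k. nrm (F k) \<le> C) \<longrightarrow>
     (\<forall>i. (\<lambda>k. F k i) \<longlonglongrightarrow> f i) \<longrightarrow> (\<forall>i. (\<lambda>k. T (F k) i) \<longlonglongrightarrow> T f i))"

lemma pointwise_continuousD:
  assumes "pointwise_continuous X nrm T" "\<And>k. F k \<in> X" "\<And>k. nrm (F k) \<le> C"
    "\<And>i. (\<lambda>k. F k i) \<longlonglongrightarrow> f i"
  shows "(\<lambda>k. T (F k) i) \<longlonglongrightarrow> T f i"
  using assms unfolding pointwise_continuous_def by metis

context tail_contraction
begin

lemma eigen_partial_X: "(\<lambda>i. \<Sum>k<K. z ^ k * (B ^^ k) (head_vec n0 u) i) \<in> X"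
  by (rule lincomb_X) (auto simp: B_pow_X head_vec_X)

lemma nrm_eigen_partial:
  assumes z: "cmod z < 1 / \<delta>"
  shows "nrm (\<lambda>i. \<Sum>k<K. z ^ k * (B ^^ k) (head_vec n0 u) i)
     \<le> nrm (head_vec n0 u) / (1 - cmod z * \<delta>)"
proof -
  let ?q = "cmod z * \<delta>"
  have q: "0 \<le> ?q" "?q < 1" using z delta_pos by (simp_all add: field_simps)
  have "nrm (\<lambda>i. \<Sum>k<K. z ^ k * (B ^^ k) (head_vec n0 u) i)
     \<le> (\<Sum>k<K. cmod (z ^ k) * nrm ((B ^^ k) (head_vec n0 u)))"
    by (rule nrm_lincomb) (auto simp: B_pow_X head_vec_X)
  also have "\<dots> \<le> (\<Sum>k<K. cmod (z ^ k) * (\<delta> ^ k * nrm (head_vec n0 u)))"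
    by (intro sum_mono mult_left_mono nrm_B_pow head_vec_X) auto
  also have "\<dots> = nrm (head_vec n0 u) * (\<Sum>k<K. ?q ^ k)"
    by (simp add: sum_distrib_left norm_power power_mult_distrib mult_ac)
  also have "(\<Sum>k<K. ?q ^ k) \<le> (\<Sum>k. ?q ^ k)"
    using q by (intro sum_le_suminf summable_geometric) auto
  also have "(\<Sum>k. ?q ^ k) = 1 / (1 - ?q)" using q by (intro suminf_geometric) auto
  finally show ?thesis
    by (simp add: mult_left_mono nrm_nonneg head_vec_X)
qed

lemma eigen_sums:
  assumes z: "cmod z < 1 / \<delta>"
  shows "(\<lambda>k. z ^ k * (B ^^ k) (head_vec n0 u) i) sums eigen_seq n0 T z u i"
proof -
  let ?q = "cmod z * \<delta>"
  have q: "0 \<le> ?q" "?q < 1" using z delta_pos by (simp_all add: field_simps)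
  obtain c where c: "\<And>f. f \<in> X \<Longrightarrow> cmod (f i) \<le> c * nrm f" using coord_bound by blast
  have "summable (\<lambda>k. z ^ k * (B ^^ k) (head_vec n0 u) i)"
  proof (rule summable_comparison_test')
    show "summable (\<lambda>k. (\<bar>c\<bar> * nrm (head_vec n0 u)) * ?q ^ k)"
      using q by (intro summable_mult summable_geometric) auto
    show "norm (z ^ k * (B ^^ k) (head_vec n0 u) i) \<le> (\<bar>c\<bar> * nrm (head_vec n0 u)) * ?q ^ k" for k
    proof -
      have "cmod ((B ^^ k) (head_vec n0 u) i) \<le> \<bar>c\<bar> * nrm ((B ^^ k) (head_vec n0 u))"
        by (rule order_trans[OF c]) (auto intro: mult_right_mono simp: B_pow_X head_vec_X nrm_nonneg)
      also have "\<dots> \<le> \<bar>c\<bar> * (\<delta> ^ k * nrm (head_vec n0 u))"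
        by (intro mult_left_mono nrm_B_pow head_vec_X) auto
      finally have "cmod z ^ k * cmod ((B ^^ k) (head_vec n0 u) i) \<le> cmod z ^ k * \<dots>"
        by (rule mult_left_mono) auto
      then show ?thesis by (simp add: norm_mult norm_power power_mult_distrib mult_ac)
    qed
  qed
  then show ?thesis unfolding eigen_seq_def by (rule summable_sums)
qed

text \<open>
  The partial sums are bounded in norm and converge pointwise, so the limit stays in the space.
  The sequence is the same in every space, and this is how an eigenvector found in one space is
  seen to belong to the other.
\<close>

lemma eigen_seq_X:
  assumes z: "cmod z < 1 / \<delta>"
  shows "eigen_seq n0 T z u \<in> X"
proof (rule X_closed)
  show "(\<lambda>i. \<Sum>k<K. z ^ k * (B ^^ k) (head_vec n0 u) i) \<in> X" for K by (rule eigen_partial_X)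
  show "nrm (\<lambda>i. \<Sum>k<K. z ^ k * (B ^^ k) (head_vec n0 u) i)
     \<le> nrm (head_vec n0 u) / (1 - cmod z * \<delta>)" for K by (rule nrm_eigen_partial[OF z])
  show "(\<lambda>K. \<Sum>k<K. z ^ k * (B ^^ k) (head_vec n0 u) i) \<longlonglongrightarrow> eigen_seq n0 T z u i" for i
    using eigen_sums[OF z] by (simp add: sums_def)
qed

lemma eigen_seq_head: "i < n0 \<Longrightarrow> eigen_seq n0 T z u i = u $ i"
proof -
  assume i: "i < n0"
  have "eigen_seq n0 T z u i = (\<Sum>k\<in>{0}. z ^ k * (B ^^ k) (head_vec n0 u) i)"
    unfolding eigen_seq_def
    by (rule suminf_finite) (use i in \<open>auto simp del: funpow.simps simp: tail_part_pow_head\<close>)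
  then show ?thesis using i by (simp add: head_vec_apply)
qed

lemma eigen_seq_eq:
  assumes z: "cmod z < 1 / \<delta>"
    and u: "\<And>i. i < n0 \<Longrightarrow> (\<Sum>j<n0. eval_fps (ret_fps n0 T i j) z * u $ j) = u $ i"
    and T_cont: "pointwise_continuous X nrm T"
  shows "z * T (eigen_seq n0 T z u) i = eigen_seq n0 T z u i"
proof -
  let ?f = "eigen_seq n0 T z u"
  let ?F = "\<lambda>K i. \<Sum>k<K. z ^ k * (B ^^ k) (head_vec n0 u) i"
  have lim: "(\<lambda>K. ?F K i) \<longlonglongrightarrow> ?f i" for i
    using eigen_sums[OF z] by (simp add: sums_def)
  have "(\<lambda>K. T (?F K) i) \<longlonglongrightarrow> T ?f i"
    by (rule pointwise_continuousD[OF T_cont eigen_partial_X nrm_eigen_partial[OF z] lim])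
  then have zT: "(\<lambda>K. z * T (?F K) i) \<longlonglongrightarrow> z * T ?f i" by (intro tendsto_mult_left)
  have TF: "z * T (?F K) i = (\<Sum>k<K. z ^ Suc k * T ((B ^^ k) (head_vec n0 u)) i)" for K
    using T_lincomb[of "{..<K}" "\<lambda>k. (B ^^ k) (head_vec n0 u)" "\<lambda>k. z ^ k"]
    by (simp add: B_pow_X head_vec_X sum_distrib_left mult_ac)
  show ?thesis
  proof (cases "i < n0")
    case True
    have "(\<lambda>k. \<Sum>j<n0. z ^ Suc k * ret_coeff n0 T k i j * u $ j)
        sums (\<Sum>j<n0. eval_fps (ret_fps n0 T i j) z * u $ j)"
      by (intro sums_sum sums_mult2 eval_ret_fps_sums True z)
    then have "(\<lambda>K. z * T (?F K) i) \<longlonglongrightarrow> u $ i"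
      unfolding TF T_B_pow_head_vec u[OF True]
      by (simp add: sums_def sum_distrib_left mult.assoc)
    with zT have "z * T ?f i = u $ i" by (rule LIMSEQ_unique)
    then show ?thesis using eigen_seq_head[OF True] by simp
  next
    case False
    have "?F (Suc K) i = z * T (?F K) i" for K
      unfolding TF
      by (subst sum.lessThan_Suc_shift)
         (use False in \<open>simp add: head_vec_apply tail_part_def\<close>)
    then have "(\<lambda>K. z * T (?F K) i) \<longlonglongrightarrow> ?f i"
      using LIMSEQ_Suc[OF lim[of i]] by simp
    with zT show ?thesis by (rule LIMSEQ_unique)
  qed
qed

lemma eigenvector_of_zero:
  assumes z: "cmod z < 1 / \<delta>" and zero: "eval_fps (char_fps n0 T) z = 0"
    and T_cont: "pointwise_continuous X nrm T"
  obtains u where "eigen_seq n0 T z u \<in> X" "eigen_seq n0 T z u \<noteq> (\<lambda>i. 0)"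
    "\<And>i. z * T (eigen_seq n0 T z u) i = eigen_seq n0 T z u i"
proof -
  obtain u where u: "u \<in> carrier_vec n0" "u \<noteq> 0\<^sub>v n0"
    "\<And>i. i < n0 \<Longrightarrow> (\<Sum>j<n0. eval_fps (ret_fps n0 T i j) z * u $ j) = u $ i"
    using zero char_fps_zero_iff[OF z] by blast
  obtain i where i: "i < n0" "u $ i \<noteq> 0"
    using u(1,2) by (metis carrier_vecD eq_vecI index_zero_vec)
  have "eigen_seq n0 T z u \<noteq> (\<lambda>i. 0)"
    using eigen_seq_head[OF i(1), of z u] i(2) by (metis)
  from that[OF eigen_seq_X[OF z] this eigen_seq_eq[OF z u(3) T_cont]] show ?thesis by blast
qed

text \<open>
  Iterating \<open>f = u + z B f\<close> recovers \<open>f\<close> from its head \<open>u\<close>, the remainder tending to 0;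
  reading the eigenvalue equation in the first \<open>n0\<close> coordinates shows that \<open>u\<close> solves the
  finite-dimensional equation. In particular the head of an eigenvector cannot vanish.
\<close>

lemma zero_of_eigenvector:
  assumes f: "f \<in> X" "f \<noteq> (\<lambda>i. 0)" and z: "cmod z < 1 / \<delta>"
    and eig: "\<And>i. z * T f i = f i"
  shows "eval_fps (char_fps n0 T) z = 0"
proof -
  define u where "u = vec n0 f"
  let ?q = "cmod z * \<delta>"
  have q: "0 \<le> ?q" "?q < 1" using z delta_pos by (simp_all add: field_simps)
  have step: "f i = head_vec n0 u i + z * B f i" for i
    using eig[of i] by (auto simp: head_vec_apply u_def tail_part_def)
  have part: "(\<lambda>i. \<Sum>k<K. z ^ k * (B ^^ k) (head_vec n0 u) i) \<in> X" for K
    by (rule eigen_partial_X)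
  have expand: "f = (\<lambda>i. (\<Sum>k<K. z ^ k * (B ^^ k) (head_vec n0 u) i) + z ^ K * (B ^^ K) f i)" for K
  proof (induction K)
    case (Suc K)
    have "(B ^^ K) (\<lambda>i. head_vec n0 u i + z * B f i)
       = (\<lambda>i. (B ^^ K) (head_vec n0 u) i + z * (B ^^ K) (B f) i)"
    proof (induction K)
      case (Suc K)
      have "B (\<lambda>i. (B ^^ K) (head_vec n0 u) i + z * (B ^^ K) (B f) i)
        = (\<lambda>i. B ((B ^^ K) (head_vec n0 u)) i + z * B ((B ^^ K) (B f)) i)"
        using B_add[OF B_pow_X[OF head_vec_X] X_scale[OF B_pow_X[OF B_X[OF f(1)]]]]
          T_scale[OF B_pow_X[OF B_X[OF f(1)]]]
        by (auto simp: tail_part_def)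
      then show ?case using Suc by simp
    qed simp
    moreover have "(\<lambda>i. head_vec n0 u i + z * B f i) = f" using step by auto
    ultimately have "(B ^^ K) f = (\<lambda>i. (B ^^ K) (head_vec n0 u) i + z * (B ^^ Suc K) f i)"
      by (simp only: funpow_Suc_right o_apply)
    then have "(B ^^ K) f i = (B ^^ K) (head_vec n0 u) i + z * (B ^^ Suc K) f i" for i
      by (rule fun_cong)
    then have "(\<Sum>k<K. z ^ k * (B ^^ k) (head_vec n0 u) i) + z ^ K * (B ^^ K) f i
       = (\<Sum>k<Suc K. z ^ k * (B ^^ k) (head_vec n0 u) i) + z ^ Suc K * (B ^^ Suc K) f i" for i
      by (simp add: algebra_simps)
    from trans[OF Suc ext[OF this]] show ?case .
  qed simp
  have "(\<Sum>j<n0. eval_fps (ret_fps n0 T i j) z * u $ j) = u $ i" if i: "i < n0" for i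
  proof -
    have eq: "u $ i = (\<Sum>k<K. z ^ Suc k * T ((B ^^ k) (head_vec n0 u)) i) + z ^ Suc K * T ((B ^^ K) f) i" for K
    proof -
      have "u $ i = z * T f i" using eig[of i] i by (simp add: u_def)
      also have "T f i = T (\<lambda>i. \<Sum>k<K. z ^ k * (B ^^ k) (head_vec n0 u) i) i + z ^ K * T ((B ^^ K) f) i"
        by (subst expand[of K], subst T_add[OF part X_scale[OF B_pow_X[OF f(1)]]])
           (simp add: T_scale B_pow_X f)
      also have "T (\<lambda>i. \<Sum>k<K. z ^ k * (B ^^ k) (head_vec n0 u) i) i
         = (\<Sum>k<K. z ^ k * T ((B ^^ k) (head_vec n0 u)) i)"
        by (subst T_lincomb) (auto simp: B_pow_X head_vec_X)
      finally show ?thesis by (simp add: algebra_simps sum_distrib_left)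
    qed
    have "(\<lambda>K. z ^ Suc K * T ((B ^^ K) f) i) \<longlonglongrightarrow> 0"
    proof (rule Lim_null_comparison)
      have "(\<lambda>K. (cmod z * L * nrm f) * ?q ^ K) \<longlonglongrightarrow> (cmod z * L * nrm f) * 0"
        using q by (intro tendsto_mult_left LIMSEQ_realpow_zero) auto
      then show "(\<lambda>K. (cmod z * L * nrm f) * ?q ^ K) \<longlonglongrightarrow> 0" by simp
      show "\<forall>\<^sub>F K in sequentially. norm (z ^ Suc K * T ((B ^^ K) f) i) \<le> (cmod z * L * nrm f) * ?q ^ K"
      proof (intro always_eventually allI)
        fix K
        have "cmod (T ((B ^^ K) f) i) \<le> L * nrm ((B ^^ K) f)" by (rule T_head[OF B_pow_X[OF f(1)] i])
        also have "\<dots> \<le> L * (\<delta> ^ K * nrm f)" by (intro mult_left_mono nrm_B_pow f L_nonneg)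
        finally have "cmod z ^ Suc K * cmod (T ((B ^^ K) f) i) \<le> cmod z ^ Suc K * \<dots>"
          by (rule mult_left_mono) simp
        then show "norm (z ^ Suc K * T ((B ^^ K) f) i) \<le> (cmod z * L * nrm f) * ?q ^ K"
          by (simp add: norm_mult norm_power power_mult_distrib mult_ac)
      qed
    qed
    then have "(\<lambda>K. u $ i - z ^ Suc K * T ((B ^^ K) f) i) \<longlonglongrightarrow> u $ i - 0"
      by (intro tendsto_intros)
    moreover have eq': "(\<Sum>k<K. z ^ Suc k * T ((B ^^ k) (head_vec n0 u)) i)
        = u $ i - z ^ Suc K * T ((B ^^ K) f) i" for K
      using eq[of K] by (metis add_diff_cancel_right')
    ultimately have "(\<lambda>k. z ^ Suc k * T ((B ^^ k) (head_vec n0 u)) i) sums (u $ i)"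
      unfolding sums_def eq' by simp
    moreover have "(\<lambda>k. z ^ Suc k * T ((B ^^ k) (head_vec n0 u)) i)
        sums (\<Sum>j<n0. eval_fps (ret_fps n0 T i j) z * u $ j)"
    proof -
      have "(\<lambda>k. \<Sum>j<n0. z ^ Suc k * ret_coeff n0 T k i j * u $ j)
        sums (\<Sum>j<n0. eval_fps (ret_fps n0 T i j) z * u $ j)"
        by (intro sums_sum sums_mult2 eval_ret_fps_sums i z)
      then show ?thesis unfolding T_B_pow_head_vec by (simp add: sum_distrib_left mult.assoc)
    qed
    ultimately show ?thesis using sums_unique2 by blast
  qed
  moreover have "u \<in> carrier_vec n0" by (simp add: u_def)
  moreover have "u \<noteq> 0\<^sub>v n0"
  proof
    assume u0: "u = 0\<^sub>v n0"
    have hz: "head_vec n0 u = (\<lambda>i. 0)" by (auto simp: u0 head_vec_apply)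
    have B0: "(B ^^ k) (\<lambda>i. 0) = (\<lambda>i. 0)" for k
      by (induction k) (auto simp: tail_part_def T_zero)
    have fK: "f i = z ^ K * (B ^^ K) f i" for i K
      using fun_cong[OF expand[of K], of i] by (simp add: hz B0)
    have "f i = 0" for i
    proof -
      obtain c where c: "\<And>f. f \<in> X \<Longrightarrow> cmod (f i) \<le> c * nrm f" using coord_bound by blast
      have "cmod (f i) \<le> \<bar>c\<bar> * nrm f * ?q ^ K" for K
      proof -
        have "cmod ((B ^^ K) f i) \<le> \<bar>c\<bar> * nrm ((B ^^ K) f)"
          by (rule order_trans[OF c]) (auto intro: mult_right_mono simp: B_pow_X f nrm_nonneg)
        also have "\<dots> \<le> \<bar>c\<bar> * (\<delta> ^ K * nrm f)"
          by (intro mult_left_mono nrm_B_pow f) auto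
        finally have "cmod z ^ K * cmod ((B ^^ K) f i) \<le> cmod z ^ K * \<dots>"
          by (rule mult_left_mono) simp
        then show ?thesis
          by (subst fK[of i K]) (simp add: norm_mult norm_power power_mult_distrib mult_ac)
      qed
      moreover have "(\<lambda>K. \<bar>c\<bar> * nrm f * ?q ^ K) \<longlonglongrightarrow> \<bar>c\<bar> * nrm f * 0"
        using q by (intro tendsto_mult_left LIMSEQ_realpow_zero) auto
      ultimately have "cmod (f i) \<le> \<bar>c\<bar> * nrm f * 0"
        by (intro LIMSEQ_le_const) auto
      then show ?thesis by simp
    qed
    with f(2) show False by auto
  qed
  ultimately show ?thesis using char_fps_zero_iff[OF z] by blast
qed

end

section \<open>Eigenfunctions of an ergodic kernel\<close>

lemma kernel_pow_bounds:
  assumes "markov_kernel P"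
  shows "0 \<le> kernel_pow P n i j \<and> kernel_pow P n i j \<le> 1"
proof (induction n arbitrary: i)
  case (Suc n)
  have P: "0 \<le> P i l" "(\<lambda>l. P i l) sums 1" for l using assms by (auto simp: markov_kernel_def)
  have le: "P i l * kernel_pow P n l j \<le> P i l" for l
    using Suc[of l] P by (simp add: mult_left_le)
  have ge: "0 \<le> P i l * kernel_pow P n l j" for l using Suc[of l] P by simp
  have s: "summable (\<lambda>l. P i l * kernel_pow P n l j)"
    by (rule summable_comparison_test'[OF sums_summable[OF P(2)], of 0]) (use le ge in auto)
  have "(\<Sum>l. P i l * kernel_pow P n l j) \<le> (\<Sum>l. P i l)"
    by (rule suminf_le[OF le s sums_summable[OF P(2)]])
  then show ?case using suminf_nonneg[OF s ge] sums_unique[OF P(2), symmetric] by simp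
qed simp

text \<open>
  A positive entry of \<open>P\<^sup>n\<close> is a chain of \<open>n\<close> positive one-step probabilities. With this,
  irreducibility and aperiodicity are used without handling the infinite sums in \<open>kernel_pow\<close>.
\<close>

lemma kernel_pow_path_induct:
  assumes "markov_kernel P" "kernel_pow P n i j > 0"
    and "\<And>i. R 0 i i"
    and step: "\<And>n i l j. P i l > 0 \<Longrightarrow> R n l j \<Longrightarrow> R (Suc n) i j"
  shows "R n i j"
  using assms(2)
proof (induction n arbitrary: i)
  case 0
  then show ?case using assms(3) by (auto split: if_splits)
next
  case (Suc n)
  have "\<exists>l. P i l * kernel_pow P n l j \<noteq> 0"
  proof (rule ccontr)
    assume "\<nexists>l. P i l * kernel_pow P n l j \<noteq> 0"
    then have "(\<lambda>l. P i l * kernel_pow P n l j) = (\<lambda>_. 0)" by auto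
    then have "kernel_pow P (Suc n) i j = 0" by (simp only: kernel_pow.simps) simp
    with Suc.prems show False by simp
  qed
  then obtain l where "P i l * kernel_pow P n l j \<noteq> 0" by blast
  moreover have "0 \<le> P i l" using assms(1) by (auto simp: markov_kernel_def)
  ultimately have "P i l > 0" "kernel_pow P n l j > 0"
    using kernel_pow_bounds[OF assms(1), of n l j] by (auto simp: less_le)
  then show ?case by (intro step[of i l n j] Suc.IH)
qed

text \<open>
  As constants are fixed by \<open>P\<close> and mapped to 0 here, this replaces one eigenvalue 1 by 0 and
  leaves the others unchanged. Evaluation at 0 is chosen since it is also available for truncated
  matrices.
\<close>

definition deflate :: "kernel \<Rightarrow> cseq \<Rightarrow> cseq" where
  "deflate P f = (\<lambda>i. kernel_op P f i - f 0)"

locale ergodic_kernel =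
  fixes P :: kernel and \<pi> :: "nat \<Rightarrow> real"
  assumes markov: "markov_kernel P"
    and irreducible: "irreducible_kernel P"
    and aperiodic: "aperiodic_kernel P"
    and invariant: "invariant_prob P \<pi>"
begin

text \<open>
  The space \<open>\<ell>\<^sup>1(\<pi>)\<close> contains both spaces of the proposition, and \<open>P\<close> and the mean are
  well behaved on it.
\<close>

definition integrable1 :: "cseq set" where
  "integrable1 = {f. summable (\<lambda>i. cmod (f i) * \<pi> i)}"

lemma P_nonneg: "0 \<le> P i j" and P_sums: "(\<lambda>j. P i j) sums 1"
  using markov by (auto simp: markov_kernel_def)

lemma P_le_1: "P i j \<le> 1"
  using sum_le_suminf[OF sums_summable[OF P_sums], of "{j}" i] P_nonneg sums_unique[OF P_sums, of i, symmetric]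
  by simp

lemma pi_nonneg: "0 \<le> \<pi> i" and pi_sums: "\<pi> sums 1" and pi_inv: "(\<lambda>i. \<pi> i * P i j) sums \<pi> j"
  using invariant by (auto simp: invariant_prob_def)

lemma pi_P_le: "\<pi> i * P i j \<le> \<pi> j"
  using sum_le_suminf[OF sums_summable[OF pi_inv], of "{i}" j] P_nonneg pi_nonneg
    sums_unique[OF pi_inv, of j, symmetric] by simp

lemma irreducible_path:
  assumes "\<And>n i. R n i i" "\<And>n i l j. P i l > 0 \<Longrightarrow> R n l j \<Longrightarrow> R (Suc n) i j"
  shows "\<exists>n\<ge>1. R n i j"
proof -
  obtain n where n: "n \<ge> 1" "kernel_pow P n i j > 0"
    using irreducible by (auto simp: irreducible_kernel_def)
  have "R n i j" by (rule kernel_pow_path_induct[OF markov n(2), of R, OF assms])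
  with n(1) show ?thesis by blast
qed

lemma pi_pos: "0 < \<pi> j"
proof -
  obtain i where i: "\<pi> i > 0"
  proof (rule ccontr)
    assume "\<not> thesis"
    then have "\<pi> i = 0" for i using that[of i] pi_nonneg[of i] by linarith
    then have "\<pi> = (\<lambda>_. 0)" by auto
    then have "(\<lambda>_. 0 :: real) sums 1" using pi_sums by simp
    then show False using sums_unique2[OF sums_zero, of "1 :: real"] by simp
  qed
  have "\<exists>n\<ge>(1::nat). \<pi> i > 0 \<longrightarrow> \<pi> j > 0"
  proof (rule irreducible_path[of "\<lambda>_ i j. \<pi> i > 0 \<longrightarrow> \<pi> j > 0"])
    fix n :: nat and i l j assume "P i l > 0" and *: "\<pi> l > 0 \<longrightarrow> \<pi> j > 0"
    show "\<pi> i > 0 \<longrightarrow> \<pi> j > 0"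
    proof
      assume "\<pi> i > 0"
      then have "0 < \<pi> i * P i l" using \<open>P i l > 0\<close> by simp
      also have "\<dots> \<le> \<pi> l" by (rule pi_P_le)
      finally show "\<pi> j > 0" using * by simp
    qed
  qed simp
  with i show ?thesis by auto
qed

lemma P_le_ratio: "P i j \<le> \<pi> j / \<pi> i"
  using pi_P_le[of i j] pi_pos[of i] by (simp add: field_simps)

lemma row_summable:
  assumes h: "summable (\<lambda>j. h j * \<pi> j)" "\<And>j. 0 \<le> h j"
  shows "summable (\<lambda>j. P i j * h j)"
proof (rule summable_comparison_test'[of "\<lambda>j. (h j * \<pi> j) / \<pi> i" 0])
  show "summable (\<lambda>j. (h j * \<pi> j) / \<pi> i)" by (rule summable_divide[OF h(1)])
  show "norm (P i j * h j) \<le> (h j * \<pi> j) / \<pi> i" for j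
    using mult_right_mono[OF P_le_ratio h(2), of i j j] h(2)[of j] P_nonneg[of i j]
    by (simp add: mult_ac)
qed

lemma
  assumes h: "summable (\<lambda>j. h j * \<pi> j)" "\<And>j. 0 \<le> h j"
  shows summable_pi_P: "summable (\<lambda>i. (\<Sum>j. P i j * h j) * \<pi> i)"
    and suminf_pi_P_le: "(\<Sum>i. (\<Sum>j. P i j * h j) * \<pi> i) \<le> (\<Sum>j. h j * \<pi> j)"
proof -
  have part: "(\<Sum>i<n. (\<Sum>j. P i j * h j) * \<pi> i) \<le> (\<Sum>j. h j * \<pi> j)" for n
  proof -
    have s: "summable (\<lambda>j. P i j * h j * \<pi> i)" for i
      by (rule summable_mult2[OF row_summable[OF h]])
    have "(\<Sum>i<n. (\<Sum>j. P i j * h j) * \<pi> i) = (\<Sum>i<n. \<Sum>j. P i j * h j * \<pi> i)"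
      by (intro sum.cong refl suminf_mult2[OF row_summable[OF h]])
    also have "\<dots> = (\<Sum>j. \<Sum>i<n. P i j * h j * \<pi> i)"
      by (rule suminf_sum[symmetric]) (rule s)
    also have "\<dots> \<le> (\<Sum>j. h j * \<pi> j)"
    proof (rule suminf_le[OF _ summable_sum[OF s] h(1)])
      fix j
      have "(\<Sum>i<n. P i j * h j * \<pi> i) = (\<Sum>i<n. \<pi> i * P i j) * h j"
        by (simp add: sum_distrib_right sum_distrib_left mult_ac)
      also have "\<dots> \<le> \<pi> j * h j"
      proof (rule mult_right_mono[OF _ h(2)])
        show "(\<Sum>i<n. \<pi> i * P i j) \<le> \<pi> j"
          using sum_le_suminf[OF sums_summable[OF pi_inv], of "{..<n}" j] P_nonneg pi_nonneg
          sums_unique[OF pi_inv, of j, symmetric] by simp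
      qed
      finally show "(\<Sum>i<n. P i j * h j * \<pi> i) \<le> h j * \<pi> j"
        by (simp add: mult.commute)
    qed
    finally show ?thesis .
  qed
  have nn: "0 \<le> (\<Sum>j. P i j * h j) * \<pi> i" for i
    using pi_nonneg P_nonneg h(2) by (intro mult_nonneg_nonneg suminf_nonneg[OF row_summable[OF h]]) auto
  show s: "summable (\<lambda>i. (\<Sum>j. P i j * h j) * \<pi> i)"
    by (rule summableI_nonneg_bounded[OF nn part])
  show "(\<Sum>i. (\<Sum>j. P i j * h j) * \<pi> i) \<le> (\<Sum>j. h j * \<pi> j)"
    by (rule suminf_le_const[OF s part])
qed

text \<open>
  By invariance the excess \<open>P h - h\<close> has mean at most 0.
\<close>

lemma pi_P_eq_of_le:
  assumes h: "summable (\<lambda>j. h j * \<pi> j)" "\<And>j. 0 \<le> h j"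
    and sub: "\<And>i. h i \<le> (\<Sum>j. P i j * h j)"
  shows "(\<Sum>j. P i j * h j) = h i"
proof -
  let ?d = "\<lambda>i. (\<Sum>j. P i j * h j) * \<pi> i - h i * \<pi> i"
  have nn: "0 \<le> ?d i" for i using mult_right_mono[OF sub pi_nonneg, of i i] by simp
  have s: "summable ?d" by (rule summable_diff[OF summable_pi_P[OF h] h(1)])
  have "(\<Sum>i. ?d i) \<le> 0"
    using suminf_pi_P_le[OF h] suminf_diff[OF summable_pi_P[OF h] h(1)] by linarith
  then have "(\<Sum>i. ?d i) = 0" using suminf_nonneg[OF s nn] by (rule antisym)
  then have "?d i = 0" using suminf_eq_zero_iff[OF s nn] by blast
  then show ?thesis using pi_pos[of i] by simp
qed

lemma
  assumes f: "f \<in> integrable1"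
  shows kernel_op_sums: "(\<lambda>j. of_real (P i j) * f j) sums kernel_op P f i"
    and cmod_kernel_op_le: "cmod (kernel_op P f i) \<le> (\<Sum>j. P i j * cmod (f j))"
proof -
  have s: "summable (\<lambda>j. norm (of_real (P i j) * f j))"
    using row_summable[of "\<lambda>j. cmod (f j)" i] f by (simp add: norm_mult P_nonneg integrable1_def)
  then show "(\<lambda>j. of_real (P i j) * f j) sums kernel_op P f i"
    unfolding kernel_op_def by (intro summable_sums[OF summable_norm_cancel])
  show "cmod (kernel_op P f i) \<le> (\<Sum>j. P i j * cmod (f j))"
    using summable_norm[OF s] by (simp add: kernel_op_def norm_mult P_nonneg)
qed

lemma integrable1_add: "f \<in> integrable1 \<Longrightarrow> g \<in> integrable1 \<Longrightarrow> (\<lambda>i. f i + g i) \<in> integrable1"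
  unfolding integrable1_def mem_Collect_eq
proof (rule summable_comparison_test'[of "\<lambda>i. cmod (f i) * \<pi> i + cmod (g i) * \<pi> i" 0])
  show "norm (cmod (f i + g i) * \<pi> i) \<le> cmod (f i) * \<pi> i + cmod (g i) * \<pi> i" for i
    using mult_right_mono[OF norm_triangle_ineq pi_nonneg, of "f i" "g i" i]
    by (simp add: pi_nonneg distrib_right)
qed (rule summable_add)

lemma integrable1_scale: "f \<in> integrable1 \<Longrightarrow> (\<lambda>i. c * f i) \<in> integrable1"
  unfolding integrable1_def by (auto simp: norm_mult mult.assoc intro: summable_mult)

lemma integrable1_const: "(\<lambda>i. c) \<in> integrable1"
  unfolding integrable1_def by (auto intro: summable_mult sums_summable[OF pi_sums])

lemma integrable1_kernel_op:
  assumes f: "f \<in> integrable1" shows "kernel_op P f \<in> integrable1"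
proof -
  have "summable (\<lambda>i. (\<Sum>j. P i j * cmod (f j)) * \<pi> i)"
    by (rule summable_pi_P) (use f in \<open>auto simp: integrable1_def\<close>)
  then have "summable (\<lambda>i. cmod (kernel_op P f i) * \<pi> i)"
    by (rule summable_comparison_test'[where N = 0])
       (auto simp: pi_nonneg intro!: mult_right_mono cmod_kernel_op_le[OF f])
  then show ?thesis by (simp add: integrable1_def)
qed

lemma integrable1_kernel_op_pow: "f \<in> integrable1 \<Longrightarrow> (kernel_op P ^^ n) f \<in> integrable1"
  by (induction n) (auto intro: integrable1_kernel_op)

lemma kernel_op_add: "f \<in> integrable1 \<Longrightarrow> g \<in> integrable1 \<Longrightarrow>
    kernel_op P (\<lambda>i. f i + g i) = (\<lambda>i. kernel_op P f i + kernel_op P g i)"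
  by (rule ext, rule sums_unique2[OF kernel_op_sums])
     (auto intro: integrable1_add sums_add[OF kernel_op_sums kernel_op_sums] simp: ring_distribs)

lemma kernel_op_scale: "f \<in> integrable1 \<Longrightarrow> kernel_op P (\<lambda>i. c * f i) = (\<lambda>i. c * kernel_op P f i)"
  by (rule ext, rule sums_unique2[OF kernel_op_sums])
     (auto intro: integrable1_scale sums_mult[OF kernel_op_sums] simp: mult.left_commute)

lemma kernel_op_const: "kernel_op P (\<lambda>i. c) = (\<lambda>i. c)"
proof
  fix i
  have "(\<lambda>j. complex_of_real (P i j) * c) sums (of_real 1 * c)"
    by (intro sums_mult2 sums_of_real P_sums)
  then show "kernel_op P (\<lambda>i. c) i = c" using kernel_op_sums[OF integrable1_const] sums_unique2 by fastforce
qed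

lemma deflate_add: "f \<in> integrable1 \<Longrightarrow> g \<in> integrable1 \<Longrightarrow>
    deflate P (\<lambda>i. f i + g i) = (\<lambda>i. deflate P f i + deflate P g i)"
  by (auto simp: deflate_def kernel_op_add)

lemma deflate_scale: "f \<in> integrable1 \<Longrightarrow> deflate P (\<lambda>i. c * f i) = (\<lambda>i. c * deflate P f i)"
  by (auto simp: deflate_def kernel_op_scale algebra_simps)

lemma deflate_pow:
  assumes f: "f \<in> integrable1"
  shows "(deflate P ^^ Suc n) f = (\<lambda>i. (kernel_op P ^^ Suc n) f i - (kernel_op P ^^ n) f 0)"
proof (induction n)
  case (Suc n)
  let ?g = "(kernel_op P ^^ Suc n) f" and ?c = "(kernel_op P ^^ n) f 0"
  have "(deflate P ^^ Suc (Suc n)) f = deflate P (\<lambda>i. ?g i + (- ?c))"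
    using Suc by simp
  also have "\<dots> = (\<lambda>i. deflate P ?g i + deflate P (\<lambda>i. - ?c) i)"
    by (rule deflate_add[OF integrable1_kernel_op_pow[OF f] integrable1_const])
  also have "\<dots> = (\<lambda>i. (kernel_op P ^^ Suc (Suc n)) f i - (kernel_op P ^^ Suc n) f 0)"
    by (simp add: deflate_def kernel_op_const)
  finally show ?case .
qed (simp add: deflate_def)

lemma mean_sums:
  assumes "f \<in> integrable1" shows "(\<lambda>i. f i * of_real (\<pi> i)) sums mean_op \<pi> f k"
  unfolding mean_op_def
  by (rule summable_sums, rule summable_norm_cancel)
     (use assms in \<open>simp add: integrable1_def norm_mult pi_nonneg\<close>)

lemma mean_add: "f \<in> integrable1 \<Longrightarrow> g \<in> integrable1 \<Longrightarrow>
    mean_op \<pi> (\<lambda>i. f i + g i) k = mean_op \<pi> f k + mean_op \<pi> g k"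
  by (rule sums_unique2[OF mean_sums])
     (auto intro: integrable1_add sums_add[OF mean_sums mean_sums] simp: ring_distribs)

lemma mean_scale: "f \<in> integrable1 \<Longrightarrow> mean_op \<pi> (\<lambda>i. c * f i) k = c * mean_op \<pi> f k"
  by (rule sums_unique2[OF mean_sums])
     (auto intro: integrable1_scale sums_mult[OF mean_sums] simp: mult.assoc)

lemma mean_const: "mean_op \<pi> (\<lambda>i. c) k = c"
proof -
  have "(\<lambda>i. c * complex_of_real (\<pi> i)) sums (c * of_real 1)"
    by (intro sums_mult sums_of_real pi_sums)
  then show ?thesis using mean_sums[OF integrable1_const] sums_unique2 by fastforce
qed

lemma mean_kernel_op:
  assumes f: "f \<in> integrable1"
  shows "mean_op \<pi> (kernel_op P f) k = mean_op \<pi> f k"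
proof -
  define F where "F n i = (\<Sum>j<n. of_real (P i j) * f j)" for n i
  have F_sums: "(\<lambda>i. F n i * of_real (\<pi> i)) sums (\<Sum>j<n. f j * of_real (\<pi> j))" for n
  proof -
    have "(\<lambda>i. \<Sum>j<n. f j * of_real (\<pi> i * P i j)) sums (\<Sum>j<n. f j * of_real (\<pi> j))"
      by (intro sums_sum sums_mult sums_of_real pi_inv)
    then show ?thesis by (simp add: F_def sum_distrib_right sum_distrib_left mult_ac)
  qed
  have "((\<lambda>n. \<Sum>i. F n i * of_real (\<pi> i)) \<longlonglongrightarrow> (\<Sum>i. kernel_op P f i * of_real (\<pi> i)))"
  proof (rule tannerys_theorem[THEN conjunct2, THEN conjunct2])
    show "(\<lambda>n. F n i * of_real (\<pi> i)) \<longlonglongrightarrow> kernel_op P f i * of_real (\<pi> i)" for i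
      using kernel_op_sums[OF f, of i] unfolding sums_def F_def by (intro tendsto_mult_right)
    show "summable (\<lambda>i. (\<Sum>j. P i j * cmod (f j)) * \<pi> i)"
      by (rule summable_pi_P) (use f in \<open>auto simp: integrable1_def\<close>)
    have "cmod (F n i) \<le> (\<Sum>j. P i j * cmod (f j))" for n i
    proof -
      have "cmod (F n i) \<le> (\<Sum>j<n. P i j * cmod (f j))"
        unfolding F_def by (rule order_trans[OF norm_sum]) (simp add: norm_mult P_nonneg)
      also have "\<dots> \<le> (\<Sum>j. P i j * cmod (f j))"
        using f by (intro sum_le_suminf[OF row_summable]) (auto simp: integrable1_def P_nonneg)
      finally show ?thesis .
    qed
    then show "\<forall>\<^sub>F (i, n) in at_top \<times>\<^sub>F sequentially.
        norm (F n i * of_real (\<pi> i)) \<le> (\<Sum>j. P i j * cmod (f j)) * \<pi> i"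
      by (intro always_eventually) (auto simp: norm_mult pi_nonneg intro!: mult_right_mono)
  qed simp
  moreover have "(\<lambda>n. \<Sum>i. F n i * of_real (\<pi> i)) \<longlonglongrightarrow> mean_op \<pi> f k"
    using mean_sums[OF f, of k] F_sums[THEN sums_unique, symmetric] by (simp add: sums_def)
  ultimately show ?thesis unfolding mean_op_def[of \<pi> "kernel_op P f"] by (rule LIMSEQ_unique)
qed

lemma mean_kernel_op_pow: "f \<in> integrable1 \<Longrightarrow> mean_op \<pi> ((kernel_op P ^^ n) f) k = mean_op \<pi> f k"
  by (induction n) (simp_all add: mean_kernel_op integrable1_kernel_op_pow)

text \<open>
  For each level \<open>c\<close> also the excess \<open>max (h - c) 0\<close> is subharmonic, hence harmonic. Where it
  vanishes, it vanishes at all successors, so \<open>{h \<le> c}\<close> is closed under transitions; by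
  irreducibility it is empty or everything.
\<close>

lemma subharmonic_constant:
  fixes h :: "nat \<Rightarrow> real"
  assumes h: "summable (\<lambda>j. h j * \<pi> j)" "\<And>j. 0 \<le> h j"
    and harm: "\<And>i. h i \<le> (\<Sum>j. P i j * h j)"
  shows "h j = h i"
proof -
  have le: "h j \<le> h i" for i j
  proof -
    define c where "c = h i"
    let ?g = "\<lambda>j. max (h j - c) 0"
    have c: "0 \<le> c" using h(2) by (simp add: c_def)
    have g: "summable (\<lambda>j. ?g j * \<pi> j)"
      by (rule summable_comparison_test'[OF h(1), of 0])
         (use c h(2) pi_nonneg in \<open>auto intro!: mult_right_mono simp: abs_mult\<close>)
    have sub: "?g i \<le> (\<Sum>j. P i j * ?g j)" for i
    proof -
      have rg: "summable (\<lambda>j. P i j * ?g j)" by (rule row_summable[OF g]) simp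
      have rh: "summable (\<lambda>j. P i j * h j)" by (rule row_summable[OF h])
      have "h i - c \<le> (\<Sum>j. P i j * h j) - (\<Sum>j. P i j * c)"
        using harm[of i] sums_unique[OF sums_mult2[OF P_sums], of c i, symmetric] by simp
      also have "\<dots> = (\<Sum>j. P i j * h j - P i j * c)"
        by (rule suminf_diff[OF rh]) (intro summable_mult2 sums_summable[OF P_sums])
      also have "\<dots> \<le> (\<Sum>j. P i j * ?g j)"
      proof (rule suminf_le[OF _ summable_diff[OF rh summable_mult2[OF sums_summable[OF P_sums]]] rg])
        show "P i j * h j - P i j * c \<le> P i j * ?g j" for j
          using mult_left_mono[of "h j - c" "?g j" "P i j"] P_nonneg
          by (simp add: right_diff_distrib)
      qed
      finally show ?thesis using suminf_nonneg[OF rg] P_nonneg by simp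
    qed
    have eq: "(\<Sum>j. P i j * ?g j) = ?g i" for i
      by (rule pi_P_eq_of_le[OF g _ sub]) simp
    have "\<exists>n\<ge>(1::nat). h i \<le> c \<longrightarrow> h j \<le> c" for j
    proof (rule irreducible_path[of "\<lambda>_ i j. h i \<le> c \<longrightarrow> h j \<le> c"])
      fix n :: nat and i l j assume p: "P i l > 0" and *: "h l \<le> c \<longrightarrow> h j \<le> c"
      show "h i \<le> c \<longrightarrow> h j \<le> c"
      proof
        assume "h i \<le> c"
        then have "(\<Sum>j. P i j * ?g j) = 0" using eq[of i] by simp
        then have "P i l * ?g l = 0"
          using suminf_eq_zero_iff[OF row_summable[OF g], of i] P_nonneg by simp
        then show "h j \<le> c" using p * by auto
      qed
    qed simp
    then show ?thesis by (auto simp: c_def)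
  qed
  show ?thesis using le[of i j] le[of j i] by simp
qed

text \<open>
  If an average of points of a circle lies on that circle, it equals every point of positive weight.
\<close>

lemma eigenfunction_rotates:
  assumes f: "f \<in> integrable1" and eig: "\<And>i. kernel_op P f i = \<mu> * f i" and mu: "cmod \<mu> = 1"
    and const: "\<And>i. cmod (f i) = m" and p: "P i j > 0"
  shows "f j = \<mu> * f i"
proof -
  let ?w = "cnj (\<mu> * f i)"
  have w': "cmod (\<mu> * f i) = m" using mu const by (simp add: norm_mult)
  then have w: "cmod ?w = m" by (simp only: complex_mod_cnj)
  have "(\<lambda>j. ?w * (of_real (P i j) * f j)) sums (?w * (\<mu> * f i))"
    using kernel_op_sums[OF f, of i] unfolding eig by (rule sums_mult)
  then have "(\<lambda>j. Re (?w * (of_real (P i j) * f j))) sums Re (?w * (\<mu> * f i))"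
    by (rule sums_Re)
  moreover have "?w * (\<mu> * f i) = of_real (m\<^sup>2)"
    using complex_norm_square[of "\<mu> * f i"] by (simp only: w' of_real_power mult.commute)
  moreover have "Re (w * (of_real (P i j) * f j)) = P i j * Re (w * f j)" for w j
    by (simp add: algebra_simps)
  ultimately have s: "(\<lambda>j. P i j * Re (?w * f j)) sums (m\<^sup>2)"
    by (simp only: Re_complex_of_real)
  have "(\<lambda>j. P i j * m\<^sup>2 - P i j * Re (?w * f j)) sums (1 * m\<^sup>2 - m\<^sup>2)"
    by (intro sums_diff sums_mult2 P_sums s)
  then have s0: "(\<lambda>j. P i j * (m\<^sup>2 - Re (?w * f j))) sums 0"
    by (simp add: right_diff_distrib)
  have nn: "0 \<le> m\<^sup>2 - Re (?w * f j)" for j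
    using complex_Re_le_cmod[of "?w * f j"] w const[of j]
    by (simp only: norm_mult power2_eq_square)
  have "P i j * (m\<^sup>2 - Re (?w * f j)) = 0"
    using suminf_eq_zero_iff[OF sums_summable[OF s0]] sums_unique[OF s0, symmetric] nn P_nonneg by simp
  then have re: "Re (?w * f j) = m\<^sup>2" using p by simp
  have "(cmod (a - b))\<^sup>2 = (cmod a)\<^sup>2 + (cmod b)\<^sup>2 - 2 * Re (cnj b * a)" for a b
    by (simp add: cmod_power2 power2_diff algebra_simps)
  then have "(cmod (f j - \<mu> * f i))\<^sup>2 = (cmod (f j))\<^sup>2 + (cmod (\<mu> * f i))\<^sup>2 - 2 * Re (?w * f j)" .
  also have "\<dots> = 0" by (simp only: re const w')
  finally show ?thesis by simp
qed

text \<open>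
  If \<open>|\<mu>| \<ge> 1\<close>, then \<open>|f|\<close> is subharmonic, hence constant, and \<open>|\<mu>| = 1\<close>. Each transition
  multiplies \<open>f\<close> by \<open>\<mu>\<close>, so \<open>\<mu>\<^sup>n = 1\<close> for all return times \<open>n\<close>; their greatest common divisor
  is 1, so \<open>\<mu> = 1\<close>.
\<close>

lemma eigenvalue_modulus:
  assumes f: "f \<in> integrable1" "f \<noteq> (\<lambda>_. 0)" and eig: "\<And>i. kernel_op P f i = \<mu> * f i"
  shows "cmod \<mu> < 1 \<or> (\<mu> = 1 \<and> (\<forall>i j. f i = f j))"
proof (cases "cmod \<mu> < 1")
  case False
  let ?h = "\<lambda>i. cmod (f i)"
  have h: "summable (\<lambda>j. ?h j * \<pi> j)" "\<And>j. 0 \<le> ?h j" using f by (auto simp: integrable1_def)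
  have le: "cmod \<mu> * ?h i \<le> (\<Sum>j. P i j * ?h j)" for i
    using cmod_kernel_op_le[OF f(1), of i] by (simp add: eig norm_mult)
  have sub: "?h i \<le> (\<Sum>j. P i j * ?h j)" for i
    using le[of i] mult_right_mono[of 1 "cmod \<mu>" "?h i"] False by simp
  have const: "cmod (f i) = cmod (f 0)" for i by (rule subharmonic_constant[OF h sub])
  obtain k where "f k \<noteq> 0" using f(2) by auto
  then have "cmod (f k) > 0" by simp
  then have "cmod (f 0) > 0" by (simp only: const[of k])
  then have pos: "cmod (f i) > 0" for i by (simp only: const[of i])
  have "cmod \<mu> * ?h 0 \<le> ?h 0" using le[of 0] pi_P_eq_of_le[OF h sub, of 0] by simp
  then have mu: "cmod \<mu> = 1" using False pos[of 0] by simp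
  note rot = eigenfunction_rotates[OF f(1) eig mu const]
  have path: "f j = \<mu> ^ n * f i" if "kernel_pow P n i j > 0" for n i j
  proof (rule kernel_pow_path_induct[OF markov that, of "\<lambda>n i j. f j = \<mu> ^ n * f i"])
    show "f j = \<mu> ^ Suc n * f i" if "P i l > 0" "f j = \<mu> ^ n * f l" for n i l j
      using rot[OF that(1)] that(2) by simp
  qed simp
  define S where "S = {n. n \<ge> 1 \<and> kernel_pow P n 0 0 > 0}"
  have S: "\<mu> ^ n = 1" if "n \<in> S" for n
  proof -
    have "f 0 = \<mu> ^ n * f 0" using path[of n 0 0] that by (simp add: S_def)
    then have "(\<mu> ^ n - 1) * f 0 = 0" by (simp add: left_diff_distrib)
    then show ?thesis using pos[of 0] by simp
  qed
  obtain n0 where n0: "n0 \<in> S" using irreducible by (auto simp: irreducible_kernel_def S_def)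
  \<comment> \<open>the order of \<open>\<mu>\<close> as a root of unity\<close>
  define m where "m = (LEAST m. m > 0 \<and> \<mu> ^ m = 1)"
  have m: "m > 0 \<and> \<mu> ^ m = 1"
    unfolding m_def by (rule LeastI[of _ n0]) (use n0 S in \<open>auto simp: S_def\<close>)
  have "m dvd n" if "n \<in> S" for n
  proof -
    have "\<mu> ^ n = \<mu> ^ (m * (n div m) + n mod m)" by simp
    also have "\<dots> = (\<mu> ^ m) ^ (n div m) * \<mu> ^ (n mod m)" by (simp only: power_add power_mult)
    also have "\<dots> = \<mu> ^ (n mod m)" using m by simp
    finally have "\<mu> ^ (n mod m) = 1" using S[OF that] by simp
    moreover have "n mod m < m" using m by simp
    ultimately have "\<not> n mod m > 0"
      using not_less_Least[of "n mod m" "\<lambda>m. m > 0 \<and> \<mu> ^ m = 1", folded m_def] by simp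
    then show ?thesis by (simp add: dvd_eq_mod_eq_0)
  qed
  then have "m dvd Gcd S" by (simp add: Gcd_greatest)
  then have "m = 1" using aperiodic by (simp add: aperiodic_kernel_def S_def)
  then have "\<mu> = 1" using m by simp
  moreover have "f i = f j" for i j
  proof -
    obtain n where "kernel_pow P n i j > 0" using irreducible by (auto simp: irreducible_kernel_def)
    from path[OF this] show ?thesis using \<open>\<mu> = 1\<close> by simp
  qed
  ultimately show ?thesis by blast
qed simp

text \<open>
  Adding a constant converts an eigenvector of the deflated operator into one of \<open>P\<close>. This works
  unless \<open>\<mu> = 1\<close>; in that case comparing means gives \<open>f 0 = 0\<close>, so \<open>f\<close> itself would be
  harmonic, hence constant and 0.
\<close>

lemma deflate_eigenvector:
  assumes f: "f \<in> integrable1" "f \<noteq> (\<lambda>_. 0)" and eig: "\<And>i. deflate P f i = \<mu> * f i" and mu: "\<mu> \<noteq> 0"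
  obtains c where "cmod \<mu> < 1" "(\<lambda>i. f i + c) \<noteq> (\<lambda>_. 0)"
    "\<And>i. kernel_op P (\<lambda>i. f i + c) i = \<mu> * (f i + c)"
proof -
  have Pf: "kernel_op P f i = \<mu> * f i + f 0" for i using eig[of i] by (simp add: deflate_def algebra_simps)
  have nonconst: "\<exists>i. f i \<noteq> c" for c
  proof (rule ccontr)
    assume "\<nexists>i. f i \<noteq> c"
    then have "f = (\<lambda>_. c)" by auto
    with Pf[of 0] mu have "c = 0" by (simp add: kernel_op_const)
    with \<open>f = _\<close> f(2) show False by simp
  qed
  have "\<mu> \<noteq> 1"
  proof
    assume 1: "\<mu> = 1"
    have "mean_op \<pi> f 0 = mean_op \<pi> (kernel_op P f) 0" by (rule mean_kernel_op[OF f(1), symmetric])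
    also have "kernel_op P f = (\<lambda>i. f i + f 0)" using Pf 1 by auto
    also have "mean_op \<pi> (\<lambda>i. f i + f 0) 0 = mean_op \<pi> f 0 + f 0"
      by (simp add: mean_add[OF f(1) integrable1_const] mean_const)
    finally have "f 0 = 0" by simp
    then have "\<And>i. kernel_op P f i = 1 * f i" using Pf 1 by simp
    from eigenvalue_modulus[OF f this] have "\<forall>i j. f i = f j" by simp
    then show False using nonconst[of "f 0"] by blast
  qed
  \<comment> \<open>chosen such that \<open>f 0 + c = \<mu> c\<close>, which makes \<open>f + c\<close> an eigenfunction of \<open>P\<close>\<close>
  define c where "c = f 0 / (\<mu> - 1)"
  have c: "f 0 + c = \<mu> * c" using \<open>\<mu> \<noteq> 1\<close> by (simp add: c_def field_simps)
  have eig': "kernel_op P (\<lambda>i. f i + c) i = \<mu> * (f i + c)" for i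
    unfolding kernel_op_add[OF f(1) integrable1_const] kernel_op_const Pf
    using c by (simp add: algebra_simps)
  have ne: "(\<lambda>i. f i + c) \<noteq> (\<lambda>_. 0)"
    using nonconst[of "- c"] by (metis add_eq_0_iff2)
  have "cmod \<mu> < 1"
    using eigenvalue_modulus[OF integrable1_add[OF f(1) integrable1_const] ne eig'] \<open>\<mu> \<noteq> 1\<close> by blast
  with ne eig' that show ?thesis by blast
qed

end

section \<open>Convergence rates\<close>

locale deflated_contraction =
  ergodic_kernel P \<pi> + tail_contraction X nrm "deflate P" n0 \<delta> L
  for P :: kernel and \<pi> X nrm n0 \<delta> L +
  assumes X_integrable: "X \<subseteq> integrable1"
    and const_X: "(\<lambda>i. 1) \<in> X"
    and mean_bound: "\<exists>c. \<forall>f\<in>X. cmod (mean_op \<pi> f 0) \<le> c * nrm f"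
begin

text \<open>
  With \<open>S = T\<^sup>n f\<close> one has \<open>P\<^sup>n f - \<pi>(f) 1 = S - \<pi>(S) 1\<close>, since the two sides differ by a
  constant and both have mean 0.
\<close>

lemma rate_of_growth:
  assumes r: "0 < r" "r < 1" and C: "\<And>n f. f \<in> X \<Longrightarrow> nrm ((deflate P ^^ n) f) \<le> C * r ^ n * nrm f"
  shows "r \<in> conv_rates X nrm P \<pi>"
proof -
  obtain c where c: "\<And>f. f \<in> X \<Longrightarrow> cmod (mean_op \<pi> f 0) \<le> c * nrm f" using mean_bound by blast
  define C' where "C' = (1 + \<bar>c\<bar> * nrm (\<lambda>i. 1)) * \<bar>C\<bar> + 1"
  have C'pos: "0 < C'" unfolding C'_def using nrm_nonneg[OF const_X]
    by (intro add_nonneg_pos mult_nonneg_nonneg add_nonneg_nonneg) auto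
  have main: "(\<lambda>i. (kernel_op P ^^ n) f i - mean_op \<pi> f i) \<in> X \<and>
      nrm (\<lambda>i. (kernel_op P ^^ n) f i - mean_op \<pi> f i) \<le> C' * r ^ n * nrm f"
    if n: "n \<ge> 1" and f: "f \<in> X" for n f
  proof -
    obtain m where m: "n = Suc m" using n by (cases n) auto
    have fi: "f \<in> integrable1" using f X_integrable by blast
    let ?S = "(deflate P ^^ n) f"
    have SX: "?S \<in> X" by (rule T_pow_X[OF f])
    have S: "?S = (\<lambda>i. (kernel_op P ^^ n) f i + (- (kernel_op P ^^ m) f 0))"
      using deflate_pow[OF fi, of m] by (simp add: m)
    have "mean_op \<pi> ?S 0 = mean_op \<pi> f 0 - (kernel_op P ^^ m) f 0"
      unfolding S
      by (subst mean_add[OF integrable1_kernel_op_pow[OF fi] integrable1_const])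
         (simp add: mean_kernel_op_pow[OF fi] mean_const)
    then have eq: "(\<lambda>i. (kernel_op P ^^ n) f i - mean_op \<pi> f i)
        = (\<lambda>i. ?S i + (- mean_op \<pi> ?S 0) * 1)"
      by (subst (1) S) (auto simp: mean_op_def)
    have "nrm (\<lambda>i. ?S i + (- mean_op \<pi> ?S 0) * 1) \<le> nrm ?S + nrm (\<lambda>i. (- mean_op \<pi> ?S 0) * 1)"
      by (rule nrm_add[OF SX X_scale[OF const_X]])
    also have "nrm (\<lambda>i. (- mean_op \<pi> ?S 0) * 1) = cmod (mean_op \<pi> ?S 0) * nrm (\<lambda>i. 1)"
      using nrm_scale[OF const_X, of "- mean_op \<pi> ?S 0"] by simp
    also have "cmod (mean_op \<pi> ?S 0) \<le> \<bar>c\<bar> * nrm ?S"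
      by (rule order_trans[OF c[OF SX]]) (simp add: mult_right_mono nrm_nonneg[OF SX])
    also have "nrm ?S + \<bar>c\<bar> * nrm ?S * nrm (\<lambda>i. 1) = (1 + \<bar>c\<bar> * nrm (\<lambda>i. 1)) * nrm ?S"
      by (simp add: algebra_simps)
    also have "nrm ?S \<le> \<bar>C\<bar> * r ^ n * nrm f"
      by (rule order_trans[OF C[OF f]]) (use r nrm_nonneg[OF f] in \<open>auto intro!: mult_right_mono\<close>)
    also have "(1 + \<bar>c\<bar> * nrm (\<lambda>i. 1)) * (\<bar>C\<bar> * r ^ n * nrm f) \<le> C' * r ^ n * nrm f"
      unfolding C'_def using r nrm_nonneg[OF f] by (simp add: algebra_simps)
    finally have "nrm (\<lambda>i. ?S i + (- mean_op \<pi> ?S 0) * 1) \<le> C' * r ^ n * nrm f"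
      using nrm_nonneg[OF const_X] by (simp add: mult_left_mono mult_right_mono)
    then show ?thesis unfolding eq by (intro conjI X_add SX X_scale const_X)
  qed
  show ?thesis unfolding conv_rates_def using r C'pos main by blast
qed

lemma rate_of_no_zero:
  assumes "\<delta> < r" "r < 1" "1 / r < R" "R \<le> 1 / \<delta>"
    and "\<And>z. cmod z < R \<Longrightarrow> eval_fps (char_fps n0 (deflate P)) z \<noteq> 0"
  shows "r \<in> conv_rates X nrm P \<pi>"
proof -
  obtain C where "0 < C" "\<And>n f. f \<in> X \<Longrightarrow> nrm ((deflate P ^^ n) f) \<le> C * r ^ n * nrm f"
    by (rule T_pow_bound[OF assms(1,3,4,5)]) auto
  then show ?thesis using assms(1,2) delta_pos by (intro rate_of_growth) auto
qed

text \<open>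
  An eigenfunction for an eigenvalue other than 1 has mean 0, so it is multiplied by \<open>\<mu>\<^sup>n\<close>
  under \<open>P\<^sup>n - \<Pi>\<close>.
\<close>

lemma eigenvalue_le_rate:
  assumes g: "g \<in> X" "g \<noteq> (\<lambda>_. 0)" and eig: "\<And>i. kernel_op P g i = \<mu> * g i" and mu: "\<mu> \<noteq> 1"
    and \<rho>: "\<rho> \<in> conv_rates X nrm P \<pi>"
  shows "cmod \<mu> \<le> \<rho>"
proof (rule ccontr)
  assume "\<not> cmod \<mu> \<le> \<rho>"
  then have gt: "\<rho> < cmod \<mu>" by simp
  have gi: "g \<in> integrable1" using g X_integrable by blast
  obtain C where C: "C > 0" "\<rho> > 0" "\<And>n f. n \<ge> 1 \<Longrightarrow> f \<in> X \<Longrightarrow>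
      nrm (\<lambda>i. (kernel_op P ^^ n) f i - mean_op \<pi> f i) \<le> C * \<rho> ^ n * nrm f"
    using \<rho> unfolding conv_rates_def by blast
  have Pg: "kernel_op P g = (\<lambda>i. \<mu> * g i)" using eig by auto
  have mean0: "mean_op \<pi> g k = 0" for k
  proof -
    have "mean_op \<pi> g k = \<mu> * mean_op \<pi> g k"
      using mean_kernel_op[OF gi, of k] mean_scale[OF gi, of \<mu> k] by (simp only: Pg)
    then have "(1 - \<mu>) * mean_op \<pi> g k = 0" by (simp add: left_diff_distrib)
    then show ?thesis using mu by simp
  qed
  have pow: "(kernel_op P ^^ n) g = (\<lambda>i. \<mu> ^ n * g i)" for n
  proof (induction n)
    case (Suc n)
    then have "(kernel_op P ^^ Suc n) g = kernel_op P (\<lambda>i. \<mu> ^ n * g i)" by simp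
    also have "\<dots> = (\<lambda>i. \<mu> ^ n * (\<mu> * g i))" by (simp only: kernel_op_scale[OF gi] Pg)
    finally show ?case by (simp add: mult_ac)
  qed simp
  obtain i where i: "g i \<noteq> 0" using g(2) by auto
  obtain c where "\<And>f. f \<in> X \<Longrightarrow> cmod (f i) \<le> c * nrm f" using coord_bound by blast
  then have "cmod (g i) \<le> c * nrm g" using g(1) by blast
  then have "nrm g \<noteq> 0" using i by auto
  then have ng: "nrm g > 0" using nrm_nonneg[OF g(1)] by simp
  have le: "(cmod \<mu> / \<rho>) ^ n \<le> C" if "n \<ge> 1" for n
  proof -
    have "cmod \<mu> ^ n * nrm g \<le> C * \<rho> ^ n * nrm g"
      using C(3)[OF that g(1)] nrm_scale[OF g(1), of "\<mu> ^ n"] by (simp add: pow mean0 norm_power)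
    then show ?thesis using ng C(2) by (simp add: power_divide field_simps)
  qed
  obtain n where "C < (cmod \<mu> / \<rho>) ^ n"
    using real_arch_pow[of "cmod \<mu> / \<rho>" C] gt C(2) by auto
  also have "\<dots> \<le> (cmod \<mu> / \<rho>) ^ Suc n"
    using gt C(2) by (intro power_increasing) auto
  also have "\<dots> \<le> C" by (rule le) simp
  finally show False by simp
qed

lemma rate_ge_of_zero:
  assumes f: "f \<in> X" "f \<noteq> (\<lambda>_. 0)" and eig: "\<And>i. z * deflate P f i = f i" and z: "z \<noteq> 0"
  shows "1 / cmod z < 1" and "\<rho> \<in> conv_rates X nrm P \<pi> \<Longrightarrow> 1 / cmod z \<le> \<rho>"
proof -
  have fi: "f \<in> integrable1" using f X_integrable by blast
  have e: "deflate P f i = (1 / z) * f i" for i using eig[of i] z by (simp add: field_simps)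
  obtain c where c: "cmod (1 / z) < 1" "(\<lambda>i. f i + c) \<noteq> (\<lambda>_. 0)"
    "\<And>i. kernel_op P (\<lambda>i. f i + c) i = 1 / z * (f i + c)"
    by (rule deflate_eigenvector[OF fi f(2) e]) (use z in auto)
  then show "1 / cmod z < 1" by (simp add: norm_divide)
  assume \<rho>: "\<rho> \<in> conv_rates X nrm P \<pi>"
  have gX: "(\<lambda>i. f i + c) \<in> X" using X_add[OF f(1) X_scale[OF const_X, of c]] by simp
  have "1 / z \<noteq> 1" using c(1) by (metis less_irrefl norm_one)
  from eigenvalue_le_rate[OF gX c(2,3) this \<rho>] show "1 / cmod z \<le> \<rho>" by (simp add: norm_divide)
qed

lemma conv_rates_bdd_below: "bdd_below (conv_rates X nrm P \<pi>)"
  by (rule bdd_belowI[of _ 0]) (auto simp: conv_rates_def)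

lemma Inf_rate_le:
  assumes "\<delta> < 1" and nz: "\<And>z. cmod z < 1 / \<delta> \<Longrightarrow> eval_fps (char_fps n0 (deflate P)) z \<noteq> 0"
  shows "Inf (conv_rates X nrm P \<pi>) \<le> \<delta>"
proof (rule dense_ge_bounded[OF assms(1)])
  fix r assume r: "\<delta> < r" "r < 1"
  have "r \<in> conv_rates X nrm P \<pi>"
    by (rule rate_of_no_zero[OF r _ order_refl nz]) (use r delta_pos in \<open>auto simp: field_simps\<close>)
  then show "Inf (conv_rates X nrm P \<pi>) \<le> r" by (rule cInf_lower[OF _ conv_rates_bdd_below])
qed

lemma Inf_rate_eq:
  assumes f: "f \<in> X" "f \<noteq> (\<lambda>_. 0)" and eig: "\<And>i. z * deflate P f i = f i"
    and z: "z \<noteq> 0" "cmod z < 1 / \<delta>"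
    and min: "\<And>w. cmod w < cmod z \<Longrightarrow> eval_fps (char_fps n0 (deflate P)) w \<noteq> 0"
  shows "Inf (conv_rates X nrm P \<pi>) = 1 / cmod z"
proof (rule antisym)
  have z1: "1 / cmod z < 1" by (rule rate_ge_of_zero(1)[OF f eig z(1)])
  have dz: "\<delta> < 1 / cmod z" using z delta_pos by (simp add: field_simps)
  have mem: "r \<in> conv_rates X nrm P \<pi>" if r: "1 / cmod z < r" "r < 1" for r
  proof (rule rate_of_no_zero[OF _ r(2) _ _ min])
    show "\<delta> < r" using dz r by simp
    then show "1 / r < cmod z" using r z delta_pos by (simp add: field_simps)
  qed (use z in auto)
  show "Inf (conv_rates X nrm P \<pi>) \<le> 1 / cmod z"
    by (rule dense_ge_bounded[OF z1]) (auto intro: cInf_lower[OF _ conv_rates_bdd_below] mem)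
  obtain r where r: "1 / cmod z < r" "r < 1" using dense[OF z1] by blast
  show "1 / cmod z \<le> Inf (conv_rates X nrm P \<pi>)"
    by (rule cInf_greatest) (use mem[OF r] rate_ge_of_zero(2)[OF f eig z(1)] in auto)
qed

end

section \<open>The weighted supremum norm\<close>

lemma wsup_le:
  assumes "f \<in> wsup V" "V i > 0"
  shows "cmod (f i) \<le> wsup_norm V f * V i"
proof -
  have "cmod (f i) / V i \<le> wsup_norm V f"
    unfolding wsup_norm_def using assms(1) by (intro cSUP_upper) (auto simp: wsup_def)
  then show ?thesis using assms(2) by (simp add: pos_divide_le_eq)
qed

lemma
  assumes "\<And>i. V i > 0" "\<And>i. cmod (f i) \<le> M * V i"
  shows wsupI: "f \<in> wsup V" and wsup_norm_le: "wsup_norm V f \<le> M"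
proof -
  have b: "cmod (f i) / V i \<le> M" for i using assms by (simp add: pos_divide_le_eq)
  then show "f \<in> wsup V" by (auto simp: wsup_def intro!: bdd_aboveI)
  show "wsup_norm V f \<le> M" unfolding wsup_norm_def by (rule cSUP_least) (use b in auto)
qed

lemma wsup_norm_nonneg: "(\<And>i. V i > 0) \<Longrightarrow> f \<in> wsup V \<Longrightarrow> 0 \<le> wsup_norm V f"
  using wsup_le[of f V 0] by (metis norm_ge_zero order_trans zero_le_mult_iff less_le_not_le)

lemma tail_contraction_wsup:
  fixes V row :: "nat \<Rightarrow> real"
  assumes V: "\<And>i. V i > 0"
    and T_add: "\<And>f g. f \<in> wsup V \<Longrightarrow> g \<in> wsup V \<Longrightarrow> T (\<lambda>i. f i + g i) = (\<lambda>i. T f i + T g i)"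
    and T_scale: "\<And>f c. f \<in> wsup V \<Longrightarrow> T (\<lambda>i. c * f i) = (\<lambda>i. c * T f i)"
    and T_row: "\<And>f i. f \<in> wsup V \<Longrightarrow> cmod (T f i) \<le> wsup_norm V f * row i"
    and row: "\<And>i. n0 \<le> i \<Longrightarrow> row i \<le> \<delta> * V i" "\<And>i. 0 \<le> row i"
    and \<delta>: "0 < \<delta>"
  shows "tail_contraction (wsup V) (wsup_norm V) T n0 \<delta> (\<Sum>i<n0. row i)"
proof
  note le = wsup_le[OF _ V]
  have add: "cmod (f i + g i) \<le> (wsup_norm V f + wsup_norm V g) * V i"
    if "f \<in> wsup V" "g \<in> wsup V" for f g i
    using le[OF that(1), of i] le[OF that(2), of i] norm_triangle_ineq[of "f i" "g i"]
    by (simp add: distrib_right)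
  show "(\<lambda>i. f i + g i) \<in> wsup V" "wsup_norm V (\<lambda>i. f i + g i) \<le> wsup_norm V f + wsup_norm V g"
    if "f \<in> wsup V" "g \<in> wsup V" for f g
    using wsupI[OF V add[OF that]] wsup_norm_le[OF V add[OF that]] by auto
  have scale: "cmod (c * f i) \<le> (cmod c * wsup_norm V f) * V i" if "f \<in> wsup V" for f c i
    using mult_left_mono[OF le[OF that, of i], of "cmod c"] by (simp add: norm_mult mult.assoc)
  show scaleX: "(\<lambda>i. c * f i) \<in> wsup V" if "f \<in> wsup V" for f c
    by (rule wsupI[OF V scale[OF that]])
  show "wsup_norm V (\<lambda>i. c * f i) = cmod c * wsup_norm V f" if f: "f \<in> wsup V" for f c
  proof (rule antisym)
    show "wsup_norm V (\<lambda>i. c * f i) \<le> cmod c * wsup_norm V f"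
      by (rule wsup_norm_le[OF V scale[OF f]])
    show "cmod c * wsup_norm V f \<le> wsup_norm V (\<lambda>i. c * f i)"
    proof (cases "c = 0")
      case False
      have "wsup_norm V f \<le> wsup_norm V (\<lambda>i. c * f i) / cmod c"
      proof (rule wsup_norm_le[OF V])
        show "cmod (f i) \<le> wsup_norm V (\<lambda>i. c * f i) / cmod c * V i" for i
          using le[OF scaleX[OF f, of c], of i] False by (simp add: norm_mult field_simps)
      qed
      then show ?thesis using False by (simp add: field_simps)
    qed (use wsup_norm_nonneg[OF V scaleX[OF f, of 0]] in simp)
  qed
  show "unit_seq j \<in> wsup V" for j
    by (rule wsupI[of V _ "1 / V j"]) (auto simp: V unit_seq_def less_imp_le[OF V] order_less_imp_not_eq2[OF V])
  show "0 \<le> wsup_norm V f" if "f \<in> wsup V" for f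
    by (rule wsup_norm_nonneg[OF V that])
  show "\<exists>c. \<forall>f\<in>wsup V. cmod (f i) \<le> c * wsup_norm V f" for i
    using le by (intro exI[of _ "V i"]) (auto simp: mult.commute)
  show "f \<in> wsup V"
    if F: "\<And>k. F k \<in> wsup V" "\<And>k. wsup_norm V (F k) \<le> C" "\<And>i. (\<lambda>k. F k i) \<longlonglongrightarrow> f i" for F f C
  proof (rule wsupI[OF V])
    fix i
    have "cmod (F k i) \<le> C * V i" for k
      by (rule order_trans[OF le[OF F(1)] mult_right_mono[OF F(2)]]) (use V[of i] in simp)
    then show "cmod (f i) \<le> C * V i"
      by (intro LIMSEQ_le_const2[OF tendsto_norm[OF F(3)]]) auto
  qed
  show "T f \<in> wsup V" if f: "f \<in> wsup V" for f
  proof (rule wsupI[OF V])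
    fix i
    have "row i \<le> (\<delta> + (\<Sum>i<n0. row i / V i)) * V i"
    proof (cases "i < n0")
      case True
      have nn: "0 \<le> row i / V i" for i using row(2) V less_imp_le by (metis divide_nonneg_nonneg)
      have "row i / V i \<le> (\<Sum>i<n0. row i / V i)"
        by (rule member_le_sum) (use True nn in auto)
      then have "row i / V i \<le> \<delta> + (\<Sum>i<n0. row i / V i)" using \<delta> by simp
      then show ?thesis using V[of i] by (simp add: pos_divide_le_eq)
    next
      case False
      have "0 \<le> (\<Sum>i<n0. row i / V i)" using row(2) V by (intro sum_nonneg divide_nonneg_pos) auto
      then have "0 \<le> (\<Sum>i<n0. row i / V i) * V i" using V[of i] by simp
      then show ?thesis using row(1)[of i] False unfolding distrib_right by linarith
    qed
    then have "wsup_norm V f * row i \<le> wsup_norm V f * ((\<delta> + (\<Sum>i<n0. row i / V i)) * V i)"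
      by (rule mult_left_mono) (rule wsup_norm_nonneg[OF V f])
    with T_row[OF f, of i]
    show "cmod (T f i) \<le> wsup_norm V f * (\<delta> + (\<Sum>i<n0. row i / V i)) * V i"
      by (simp only: mult.assoc)
  qed
  show "cmod (T f i) \<le> (\<Sum>i<n0. row i) * wsup_norm V f" if f: "f \<in> wsup V" and i: "i < n0" for f i
  proof -
    have "row i \<le> (\<Sum>i<n0. row i)" by (rule member_le_sum) (use i row(2) in auto)
    then have "wsup_norm V f * row i \<le> wsup_norm V f * (\<Sum>i<n0. row i)"
      by (rule mult_left_mono) (rule wsup_norm_nonneg[OF V f])
    with T_row[OF f, of i] show ?thesis by (simp only: mult.commute)
  qed
  show "wsup_norm V (tail_part n0 T f) \<le> \<delta> * wsup_norm V f" if f: "f \<in> wsup V" for f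
  proof (rule wsup_norm_le[OF V])
    fix i
    have nn: "0 \<le> wsup_norm V f" by (rule wsup_norm_nonneg[OF V f])
    show "cmod (tail_part n0 T f i) \<le> \<delta> * wsup_norm V f * V i"
    proof (cases "i < n0")
      case True
      then show ?thesis using \<delta> nn V[of i] by (simp add: tail_part_def)
    next
      case False
      have "wsup_norm V f * row i \<le> wsup_norm V f * (\<delta> * V i)"
        by (rule mult_left_mono[OF _ nn]) (use row(1) False in auto)
      with T_row[OF f, of i] False show ?thesis by (simp add: tail_part_def mult_ac)
    qed
  qed
  show "0 \<le> (\<Sum>i<n0. row i)" by (intro sum_nonneg row(2))
qed (use T_add T_scale \<delta> in auto)

section \<open>The weighted square-summable norm\<close>

lemma L2_set_sq: "(L2_set f A)\<^sup>2 = (\<Sum>i\<in>A. (f i)\<^sup>2)"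
  by (simp add: L2_set_def sum_nonneg)

lemma
  assumes \<pi>: "\<And>i. 0 \<le> \<pi> i" and f: "\<And>n. L2_set (\<lambda>i. cmod (f i) * sqrt (\<pi> i)) {..<n} \<le> C"
  shows ell2I: "f \<in> ell2 \<pi>" and ell2_norm_le: "ell2_norm \<pi> f \<le> C"
proof -
  have C: "0 \<le> C" using f[of 0] by simp
  have part: "(\<Sum>i<n. (cmod (f i))\<^sup>2 * \<pi> i) \<le> C\<^sup>2" for n
    using power_mono[OF f[of n], of 2] \<pi> by (simp add: L2_set_sq power_mult_distrib)
  have s: "summable (\<lambda>i. (cmod (f i))\<^sup>2 * \<pi> i)"
    by (rule summableI_nonneg_bounded[OF _ part]) (simp add: \<pi>)
  then show "f \<in> ell2 \<pi>" by (simp add: ell2_def)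
  have "(\<Sum>i. (cmod (f i))\<^sup>2 * \<pi> i) \<le> C\<^sup>2" by (rule suminf_le_const[OF s part])
  then show "ell2_norm \<pi> f \<le> C" unfolding ell2_norm_def using C by (intro real_le_lsqrt) auto
qed

lemma ell2_L2_set_le:
  assumes \<pi>: "\<And>i. 0 \<le> \<pi> i" and f: "f \<in> ell2 \<pi>"
  shows "L2_set (\<lambda>i. cmod (f i) * sqrt (\<pi> i)) {..<n} \<le> ell2_norm \<pi> f"
  unfolding L2_set_def ell2_norm_def
  using f \<pi> by (intro real_sqrt_le_mono) (auto simp: power_mult_distrib ell2_def intro!: sum_le_suminf)

lemma ell2_norm_sq:
  assumes \<pi>: "\<And>i. 0 \<le> \<pi> i" and f: "f \<in> ell2 \<pi>"
  shows "(ell2_norm \<pi> f)\<^sup>2 = (\<Sum>i. (cmod (f i))\<^sup>2 * \<pi> i)"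
  unfolding ell2_norm_def using f \<pi> by (intro real_sqrt_pow2 suminf_nonneg) (auto simp: ell2_def)

lemma ell2_norm_nonneg: "(\<And>i. 0 \<le> \<pi> i) \<Longrightarrow> f \<in> ell2 \<pi> \<Longrightarrow> 0 \<le> ell2_norm \<pi> f"
  using ell2_L2_set_le[of \<pi> f 0] by simp

lemma ell2_coord_le:
  assumes \<pi>: "\<And>i. 0 \<le> \<pi> i" and f: "f \<in> ell2 \<pi>"
  shows "cmod (f i) * sqrt (\<pi> i) \<le> ell2_norm \<pi> f"
  using member_le_L2_set[where A = "{..<Suc i}" and i = i and f = "\<lambda>i. cmod (f i) * sqrt (\<pi> i)"] ell2_L2_set_le[OF assms, of "Suc i"]
  by simp

lemma tail_contraction_ell2:
  assumes \<pi>: "\<And>i. 0 < \<pi> i"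
    and T_add: "\<And>f g. f \<in> ell2 \<pi> \<Longrightarrow> g \<in> ell2 \<pi> \<Longrightarrow> T (\<lambda>i. f i + g i) = (\<lambda>i. T f i + T g i)"
    and T_scale: "\<And>f c. f \<in> ell2 \<pi> \<Longrightarrow> T (\<lambda>i. c * f i) = (\<lambda>i. c * T f i)"
    and T_head: "\<And>f i. f \<in> ell2 \<pi> \<Longrightarrow> i < n0 \<Longrightarrow> cmod (T f i) \<le> L * ell2_norm \<pi> f"
    and T_tail: "\<And>f n. f \<in> ell2 \<pi> \<Longrightarrow>
        L2_set (\<lambda>i. cmod (tail_part n0 T f i) * sqrt (\<pi> i)) {..<n} \<le> \<delta> * ell2_norm \<pi> f"
    and \<delta>: "0 < \<delta>" and L: "0 \<le> L"
  shows "tail_contraction (ell2 \<pi>) (ell2_norm \<pi>) T n0 \<delta> L"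
proof
  have \<pi>0: "0 \<le> \<pi> i" for i using \<pi>[of i] by simp
  have add: "L2_set (\<lambda>i. cmod (f i + g i) * sqrt (\<pi> i)) {..<n} \<le> ell2_norm \<pi> f + ell2_norm \<pi> g"
    if "f \<in> ell2 \<pi>" "g \<in> ell2 \<pi>" for f g n
  proof -
    have "L2_set (\<lambda>i. cmod (f i + g i) * sqrt (\<pi> i)) {..<n}
      \<le> L2_set (\<lambda>i. cmod (f i) * sqrt (\<pi> i) + cmod (g i) * sqrt (\<pi> i)) {..<n}"
      using \<pi>0
      by (intro L2_set_mono) (auto simp: distrib_right[symmetric] intro!: mult_right_mono norm_triangle_ineq)
    also have "\<dots> \<le> L2_set (\<lambda>i. cmod (f i) * sqrt (\<pi> i)) {..<n} + L2_set (\<lambda>i. cmod (g i) * sqrt (\<pi> i)) {..<n}"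
      by (rule L2_set_triangle_ineq)
    also have "\<dots> \<le> ell2_norm \<pi> f + ell2_norm \<pi> g"
      by (intro add_mono ell2_L2_set_le \<pi>0 that)
    finally show ?thesis .
  qed
  show addX: "(\<lambda>i. f i + g i) \<in> ell2 \<pi>" and "ell2_norm \<pi> (\<lambda>i. f i + g i) \<le> ell2_norm \<pi> f + ell2_norm \<pi> g"
    if "f \<in> ell2 \<pi>" "g \<in> ell2 \<pi>" for f g
    using ell2I[OF \<pi>0 add[OF that]] ell2_norm_le[OF \<pi>0 add[OF that]] by auto
  show "(\<lambda>i. c * f i) \<in> ell2 \<pi>" if "f \<in> ell2 \<pi>" for f c
    using that unfolding ell2_def by (auto simp: norm_mult power_mult_distrib mult.assoc intro: summable_mult)
  show "ell2_norm \<pi> (\<lambda>i. c * f i) = cmod c * ell2_norm \<pi> f" if "f \<in> ell2 \<pi>" for f c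
  proof -
    have "(\<Sum>i. (cmod (c * f i))\<^sup>2 * \<pi> i) = (\<Sum>i. (cmod c)\<^sup>2 * ((cmod (f i))\<^sup>2 * \<pi> i))"
      by (simp add: norm_mult power_mult_distrib mult.assoc)
    also have "\<dots> = (cmod c)\<^sup>2 * (\<Sum>i. (cmod (f i))\<^sup>2 * \<pi> i)"
      using that by (intro suminf_mult) (simp add: ell2_def)
    finally show ?thesis by (simp add: ell2_norm_def real_sqrt_mult)
  qed
  show "0 \<le> ell2_norm \<pi> f" if "f \<in> ell2 \<pi>" for f by (rule ell2_norm_nonneg[OF \<pi>0 that])
  have fin: "f \<in> ell2 \<pi>" if "\<And>i. n \<le> i \<Longrightarrow> f i = 0" for f n
    unfolding ell2_def mem_Collect_eq by (rule summable_finite[of "{..<n}"]) (use that in auto)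
  show "unit_seq j \<in> ell2 \<pi>" for j by (rule fin[of "Suc j"]) (auto simp: unit_seq_def)
  show "\<exists>c. \<forall>f\<in>ell2 \<pi>. cmod (f i) \<le> c * ell2_norm \<pi> f" for i
  proof (intro exI[of _ "1 / sqrt (\<pi> i)"] ballI)
    fix f assume f: "f \<in> ell2 \<pi>"
    show "cmod (f i) \<le> 1 / sqrt (\<pi> i) * ell2_norm \<pi> f"
      using ell2_coord_le[OF \<pi>0 f, of i] \<pi>[of i] by (simp add: field_simps)
  qed
  show "f \<in> ell2 \<pi>"
    if F: "\<And>k. F k \<in> ell2 \<pi>" "\<And>k. ell2_norm \<pi> (F k) \<le> C" "\<And>i. (\<lambda>k. F k i) \<longlonglongrightarrow> f i" for F f C
  proof (rule ell2I[OF \<pi>0])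
    fix n
    have "(\<lambda>k. L2_set (\<lambda>i. cmod (F k i) * sqrt (\<pi> i)) {..<n}) \<longlonglongrightarrow> L2_set (\<lambda>i. cmod (f i) * sqrt (\<pi> i)) {..<n}"
      unfolding L2_set_def by (intro tendsto_intros F(3))
    moreover have "L2_set (\<lambda>i. cmod (F k i) * sqrt (\<pi> i)) {..<n} \<le> C" for k
      using ell2_L2_set_le[OF \<pi>0 F(1)] F(2) order_trans by blast
    ultimately show "L2_set (\<lambda>i. cmod (f i) * sqrt (\<pi> i)) {..<n} \<le> C"
      by (intro LIMSEQ_le_const2) auto
  qed
  show "T f \<in> ell2 \<pi>" if f: "f \<in> ell2 \<pi>" for f
  proof -
    have "T f = (\<lambda>i. (if i < n0 then T f i else 0) + tail_part n0 T f i)" by (auto simp: tail_part_def)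
    also have "\<dots> \<in> ell2 \<pi>"
      by (intro addX fin[of n0] ell2I[OF \<pi>0 T_tail[OF f]]) auto
    finally show ?thesis .
  qed
  show "ell2_norm \<pi> (tail_part n0 T f) \<le> \<delta> * ell2_norm \<pi> f" if f: "f \<in> ell2 \<pi>" for f
    by (rule ell2_norm_le[OF \<pi>0 T_tail[OF f]])
qed (use T_add T_scale T_head \<delta> L in auto)

section \<open>Kernels whose rows and columns contract far out\<close>

text \<open>
  The Schur test in the form used below: the weight \<open>V\<close> is the test sequence.
\<close>

lemma suminf_Cauchy_Schwarz:
  fixes K V a :: "nat \<Rightarrow> real"
  assumes nn: "\<And>j. 0 \<le> K j" "\<And>j. 0 < V j" "\<And>j. 0 \<le> a j"
    and s: "summable (\<lambda>j. K j * V j)" "summable (\<lambda>j. K j * ((a j)\<^sup>2 / V j))"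
  shows "(\<Sum>j. K j * a j)\<^sup>2 \<le> (\<Sum>j. K j * V j) * (\<Sum>j. K j * ((a j)\<^sup>2 / V j))"
proof -
  let ?A = "\<Sum>j. K j * V j" and ?B = "\<Sum>j. K j * ((a j)\<^sup>2 / V j)"
  have nA: "0 \<le> K j * V j" and nB: "0 \<le> K j * ((a j)\<^sup>2 / V j)" and nC: "0 \<le> K j * a j" for j
    using nn[of j] by (auto simp: less_imp_le)
  have A0: "0 \<le> ?A" and B0: "0 \<le> ?B" by (intro suminf_nonneg s nA nB)+
  have part: "(\<Sum>j<n. K j * a j) \<le> sqrt (?A * ?B)" for n
  proof (rule real_le_rsqrt)
    have "(\<Sum>j<n. K j * a j) = (\<Sum>j<n. sqrt (K j * V j) * sqrt (K j * ((a j)\<^sup>2 / V j)))"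
    proof (intro sum.cong refl)
      fix j
      have "K j * V j * (K j * ((a j)\<^sup>2 / V j)) = (K j * a j)\<^sup>2"
        using nn(2)[of j] by (simp add: power2_eq_square)
      then have "sqrt (K j * V j) * sqrt (K j * ((a j)\<^sup>2 / V j)) = sqrt ((K j * a j)\<^sup>2)"
        by (simp only: real_sqrt_mult[symmetric])
      then show "K j * a j = sqrt (K j * V j) * sqrt (K j * ((a j)\<^sup>2 / V j))"
        using nC[of j] by simp
    qed
    then have "(\<Sum>j<n. K j * a j)\<^sup>2 \<le> (\<Sum>j<n. (sqrt (K j * V j))\<^sup>2) * (\<Sum>j<n. (sqrt (K j * ((a j)\<^sup>2 / V j)))\<^sup>2)"
      by (simp only: Cauchy_Schwarz_ineq_sum)
    also have "\<dots> = (\<Sum>j<n. K j * V j) * (\<Sum>j<n. K j * ((a j)\<^sup>2 / V j))"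
      using nA nB by simp
    also have "\<dots> \<le> ?A * ?B"
      by (intro mult_mono sum_le_suminf s A0 sum_nonneg nA nB) auto
    finally show "(\<Sum>j<n. K j * a j)\<^sup>2 \<le> ?A * ?B" .
  qed
  have sC: "summable (\<lambda>j. K j * a j)" by (rule summableI_nonneg_bounded[OF nC part])
  have "(\<Sum>j. K j * a j) \<le> sqrt (?A * ?B)" by (rule suminf_le_const[OF sC part])
  then have "(\<Sum>j. K j * a j)\<^sup>2 \<le> (sqrt (?A * ?B))\<^sup>2"
    by (intro power_mono suminf_nonneg sC nC)
  then show ?thesis using A0 B0 by simp
qed

text \<open>
  Moving the mass of the row to the last column amounts to freezing the argument at \<open>k - 1\<close>. The
  operator is extended by 0 beyond \<open>k\<close>, so that all truncations act on the same space.
\<close>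

definition truncated_op :: "kernel \<Rightarrow> nat \<Rightarrow> cseq \<Rightarrow> cseq" where
  "truncated_op P k f = (\<lambda>i. if i < k then deflate P (\<lambda>j. f (min j (k - 1))) i else 0)"

text \<open>
  The situation far out in the chain: from \<open>n0\<close> on, the weighted row and column sums of the
  deflated kernel are at most \<open>\<delta>\<close>. The summands \<open>V 0\<close> and \<open>if j = 0\<close> come from the
  deflation.
\<close>

locale contracting_kernel = ergodic_kernel P \<pi> for P \<pi> +
  fixes V :: "nat \<Rightarrow> real" and n0 n1 :: nat and \<delta> :: real
  assumes V_eq: "\<And>i. V i = 1 / sqrt (\<pi> i)"
    and sqrt_pi_summable: "summable (\<lambda>i. sqrt (\<pi> i))"
    and row_le: "\<And>i. n0 \<le> i \<Longrightarrow> (\<Sum>j. P i j * V j) + V 0 \<le> \<delta> * V i"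
    and col_le: "\<And>j n. (\<Sum>i=n0..<n. sqrt (\<pi> i) * (P i j + (if j = 0 then 1 else 0))) \<le> \<delta> * sqrt (\<pi> j)"
    and pi_decreasing: "\<And>i. n1 \<le> i \<Longrightarrow> \<pi> (Suc i) \<le> \<pi> i"
    and delta_pos: "0 < \<delta>"
begin

definition row :: "nat \<Rightarrow> real" where "row i = (\<Sum>j. P i j * V j) + V 0"

lemma V_pos: "0 < V i" by (simp add: V_eq pi_pos)

lemma V_mult_pi: "V i * \<pi> i = sqrt (\<pi> i)"
  using pi_pos[of i] by (simp add: V_eq real_div_sqrt)

lemma V_pi_summable: "summable (\<lambda>j. V j * \<pi> j)"
  by (simp add: V_mult_pi sqrt_pi_summable)

lemma P_V_summable: "summable (\<lambda>j. P i j * V j)"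
  by (rule row_summable[OF V_pi_summable]) (rule less_imp_le[OF V_pos])

lemma row_nonneg: "0 \<le> row i"
  unfolding row_def using V_pos P_nonneg
  by (intro add_nonneg_nonneg suminf_nonneg P_V_summable mult_nonneg_nonneg) (auto intro: less_imp_le)

lemma wsup_integrable: "wsup V \<subseteq> integrable1"
proof
  fix f assume f: "f \<in> wsup V"
  have "summable (\<lambda>i. cmod (f i) * \<pi> i)"
  proof (rule summable_comparison_test'[of "\<lambda>i. wsup_norm V f * sqrt (\<pi> i)" 0])
    show "summable (\<lambda>i. wsup_norm V f * sqrt (\<pi> i))" by (intro summable_mult sqrt_pi_summable)
    show "norm (cmod (f i) * \<pi> i) \<le> wsup_norm V f * sqrt (\<pi> i)" for i
      using mult_right_mono[OF wsup_le[OF f V_pos] pi_nonneg, of i i]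
      by (simp add: pi_nonneg V_mult_pi mult.assoc)
  qed
  then show "f \<in> integrable1" by (simp add: integrable1_def)
qed

lemma deflate_row:
  assumes f: "f \<in> wsup V"
  shows "cmod (deflate P f i) \<le> wsup_norm V f * row i"
proof -
  have fi: "f \<in> integrable1" using f wsup_integrable by blast
  have "cmod (deflate P f i) \<le> cmod (kernel_op P f i) + cmod (f 0)"
    unfolding deflate_def by (rule norm_triangle_ineq4)
  also have "\<dots> \<le> (\<Sum>j. P i j * cmod (f j)) + wsup_norm V f * V 0"
    by (intro add_mono cmod_kernel_op_le fi wsup_le[OF f V_pos])
  also have "(\<Sum>j. P i j * cmod (f j)) \<le> (\<Sum>j. wsup_norm V f * (P i j * V j))"
  proof (rule suminf_le)
    show "summable (\<lambda>j. P i j * cmod (f j))"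
      by (rule row_summable) (use fi in \<open>auto simp: integrable1_def\<close>)
    show "P i j * cmod (f j) \<le> wsup_norm V f * (P i j * V j)" for j
      using mult_left_mono[OF wsup_le[OF f V_pos, of j] P_nonneg[of i j]] by (simp add: mult_ac)
  qed (intro summable_mult P_V_summable)
  also have "\<dots> = wsup_norm V f * (\<Sum>j. P i j * V j)" by (rule suminf_mult[OF P_V_summable])
  finally show ?thesis by (simp add: row_def distrib_left)
qed

sublocale sup: tail_contraction "wsup V" "wsup_norm V" "deflate P" n0 \<delta> "\<Sum>i<n0. row i"
  by (rule tail_contraction_wsup)
     (use wsup_integrable row_le row_nonneg deflate_row V_pos delta_pos in
       \<open>auto intro!: deflate_add deflate_scale simp: row_def\<close>)

lemma const_wsup: "(\<lambda>i. 1) \<in> wsup V"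
proof (rule wsupI[OF V_pos])
  fix i
  have "sqrt (\<pi> i) \<le> 1"
    using sum_le_suminf[OF sums_summable[OF pi_sums], of "{i}"] pi_nonneg sums_unique[OF pi_sums, symmetric]
    by simp
  then show "cmod 1 \<le> 1 * V i" using pi_pos[of i] by (simp add: V_eq)
qed

lemma mean_bound_sup: "f \<in> wsup V \<Longrightarrow> cmod (mean_op \<pi> f k) \<le> (\<Sum>i. sqrt (\<pi> i)) * wsup_norm V f"
proof -
  assume f: "f \<in> wsup V"
  have fi: "f \<in> integrable1" using f wsup_integrable by blast
  have "cmod (mean_op \<pi> f k) \<le> (\<Sum>i. wsup_norm V f * sqrt (\<pi> i))"
    unfolding mean_op_def
  proof (rule norm_suminf_le)
    show "summable (\<lambda>i. wsup_norm V f * sqrt (\<pi> i))" by (intro summable_mult sqrt_pi_summable)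
    show "norm (f i * of_real (\<pi> i)) \<le> wsup_norm V f * sqrt (\<pi> i)" for i
      using mult_right_mono[OF wsup_le[OF f V_pos] pi_nonneg, of i i]
      by (simp add: pi_nonneg V_mult_pi mult.assoc norm_mult)
  qed
  also have "\<dots> = wsup_norm V f * (\<Sum>i. sqrt (\<pi> i))" by (rule suminf_mult[OF sqrt_pi_summable])
  finally show ?thesis by (simp add: mult.commute)
qed

sublocale sup: deflated_contraction P \<pi> "wsup V" "wsup_norm V" n0 \<delta> "\<Sum>i<n0. row i"
  by unfold_locales (use wsup_integrable const_wsup mean_bound_sup in auto)

lemma
  assumes f: "f \<in> ell2 \<pi>"
  shows ell2_integrable: "f \<in> integrable1"
    and ell2_mean_le: "(\<Sum>i. cmod (f i) * \<pi> i) \<le> ell2_norm \<pi> f"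
proof -
  have part: "(\<Sum>i<n. cmod (f i) * \<pi> i) \<le> ell2_norm \<pi> f" for n
  proof -
    have "(\<Sum>i<n. cmod (f i) * \<pi> i) = (\<Sum>i<n. \<bar>cmod (f i) * sqrt (\<pi> i)\<bar> * \<bar>sqrt (\<pi> i)\<bar>)"
      by (intro sum.cong) (auto simp: pi_nonneg mult.assoc)
    also have "\<dots> \<le> L2_set (\<lambda>i. cmod (f i) * sqrt (\<pi> i)) {..<n} * L2_set (\<lambda>i. sqrt (\<pi> i)) {..<n}"
      by (rule L2_set_mult_ineq)
    also have "\<dots> \<le> ell2_norm \<pi> f * 1"
    proof (intro mult_mono ell2_L2_set_le pi_nonneg f ell2_norm_nonneg L2_set_nonneg)
      have "(\<Sum>i<n. \<pi> i) \<le> 1"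
        using sum_le_suminf[OF sums_summable[OF pi_sums], of "{..<n}"] pi_nonneg sums_unique[OF pi_sums, symmetric]
        by simp
      then show "L2_set (\<lambda>i. sqrt (\<pi> i)) {..<n} \<le> 1" by (simp add: L2_set_def pi_nonneg)
    qed
    finally show ?thesis by simp
  qed
  have s: "summable (\<lambda>i. cmod (f i) * \<pi> i)"
    by (rule summableI_nonneg_bounded[OF _ part]) (simp add: pi_nonneg)
  then show "f \<in> integrable1" by (simp add: integrable1_def)
  show "(\<Sum>i. cmod (f i) * \<pi> i) \<le> ell2_norm \<pi> f" by (rule suminf_le_const[OF s part])
qed

lemma deflate_head_ell2:
  assumes f: "f \<in> ell2 \<pi>" and i: "i < n0"
  shows "cmod (deflate P f i) \<le> ((\<Sum>i<n0. 1 / \<pi> i) + V 0) * ell2_norm \<pi> f"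
proof -
  have s: "summable (\<lambda>j. cmod (f j) * \<pi> j)" using ell2_integrable[OF f] by (simp add: integrable1_def)
  have nn: "0 \<le> ell2_norm \<pi> f" by (rule ell2_norm_nonneg[OF pi_nonneg f])
  have "cmod (deflate P f i) \<le> cmod (kernel_op P f i) + cmod (f 0)"
    unfolding deflate_def by (rule norm_triangle_ineq4)
  also have "cmod (kernel_op P f i) \<le> (\<Sum>j. P i j * cmod (f j))"
    by (rule cmod_kernel_op_le[OF ell2_integrable[OF f]])
  also have "\<dots> \<le> (\<Sum>j. 1 / \<pi> i * (cmod (f j) * \<pi> j))"
  proof (rule suminf_le)
    show "summable (\<lambda>j. P i j * cmod (f j))" by (rule row_summable[OF s]) simp
    show "P i j * cmod (f j) \<le> 1 / \<pi> i * (cmod (f j) * \<pi> j)" for j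
      using mult_right_mono[OF P_le_ratio[of i j], of "cmod (f j)"] by (simp add: mult_ac)
  qed (intro summable_mult s)
  also have "\<dots> = 1 / \<pi> i * (\<Sum>j. cmod (f j) * \<pi> j)" by (rule suminf_mult[OF s])
  also have "\<dots> \<le> (\<Sum>i<n0. 1 / \<pi> i) * ell2_norm \<pi> f"
    using ell2_mean_le[OF f] i pi_nonneg suminf_nonneg[OF s]
    by (intro mult_mono member_le_sum sum_nonneg) auto
  also have "cmod (f 0) \<le> V 0 * ell2_norm \<pi> f"
    using ell2_coord_le[OF pi_nonneg f, of 0] pi_pos[of 0] by (simp add: V_eq field_simps)
  finally show ?thesis by (simp add: distrib_right)
qed

text \<open>
  Schur test with the test sequence \<open>V\<close>: the row sums enter through the Cauchy-Schwarz inequality,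
  and the column sums after the order of summation has been exchanged.
\<close>

lemma deflate_tail_ell2:
  assumes f: "f \<in> ell2 \<pi>"
  shows "L2_set (\<lambda>i. cmod (tail_part n0 (deflate P) f i) * sqrt (\<pi> i)) {..<n} \<le> \<delta> * ell2_norm \<pi> f"
proof -
  define K where "K i j = P i j + (if j = 0 then 1 else 0)" for i j
  define h where "h j = (cmod (f j))\<^sup>2 / V j" for j
  have K0: "0 \<le> K i j" for i j by (simp add: K_def P_nonneg)
  have h_eq: "h j = (cmod (f j))\<^sup>2 * sqrt (\<pi> j)" for j by (simp add: h_def V_eq)
  have h0: "0 \<le> h j" for j by (simp add: h_eq pi_nonneg)
  have hV: "h j * sqrt (\<pi> j) = (cmod (f j))\<^sup>2 * \<pi> j" for j by (simp add: h_eq pi_nonneg mult.assoc)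
  have s2: "summable (\<lambda>j. (cmod (f j))\<^sup>2 * \<pi> j)" using f by (simp add: ell2_def)
  have K_sums: "(\<lambda>j. K i j * a j) sums ((\<Sum>j. P i j * a j) + a 0)"
    if "summable (\<lambda>j. P i j * a j)" for i a
  proof -
    have "(\<lambda>j. if j = 0 then a j else 0) sums a 0" by (rule sums_single)
    from sums_add[OF summable_sums[OF that] this] show ?thesis
      by (rule back_subst[of "\<lambda>x. x sums _"]) (auto simp: K_def distrib_right)
  qed
  have Ph: "summable (\<lambda>j. P i j * h j)" for i
  proof (rule row_summable[OF _ h0])
    have "\<pi> j \<le> 1" for j
      using sum_le_suminf[OF sums_summable[OF pi_sums], of "{j}"] pi_nonneg sums_unique[OF pi_sums, symmetric]
      by simp
    then have "h j * \<pi> j \<le> (cmod (f j))\<^sup>2 * \<pi> j" for j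
      unfolding h_eq using pi_nonneg[of j] by (auto intro!: mult_right_mono mult_left_le)
    then show "summable (\<lambda>j. h j * \<pi> j)"
      by (intro summable_comparison_test'[OF s2, of 0]) (use h0 pi_nonneg in auto)
  qed
  have Kh: "summable (\<lambda>j. K i j * h j)" for i using K_sums[OF Ph] by (rule sums_summable)
  have row: "(cmod (deflate P f i))\<^sup>2 * \<pi> i \<le> \<delta> * (sqrt (\<pi> i) * (\<Sum>j. K i j * h j))"
    if i: "n0 \<le> i" for i
  proof -
    have Pf: "summable (\<lambda>j. P i j * cmod (f j))"
      by (rule row_summable) (use ell2_integrable[OF f] in \<open>auto simp: integrable1_def\<close>)
    have "cmod (deflate P f i) \<le> cmod (kernel_op P f i) + cmod (f 0)"
      unfolding deflate_def by (rule norm_triangle_ineq4)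
    also have "\<dots> \<le> (\<Sum>j. P i j * cmod (f j)) + cmod (f 0)"
      by (intro add_right_mono cmod_kernel_op_le ell2_integrable f)
    also have "\<dots> = (\<Sum>j. K i j * cmod (f j))" by (rule sums_unique[OF K_sums[OF Pf]])
    finally have "(cmod (deflate P f i))\<^sup>2 \<le> (\<Sum>j. K i j * cmod (f j))\<^sup>2" by (intro power_mono) auto
    also have "\<dots> \<le> (\<Sum>j. K i j * V j) * (\<Sum>j. K i j * ((cmod (f j))\<^sup>2 / V j))"
      by (rule suminf_Cauchy_Schwarz[OF K0 V_pos _ sums_summable[OF K_sums[OF P_V_summable]] Kh[unfolded h_def]]) simp
    also have "\<dots> = row i * (\<Sum>j. K i j * h j)"
      using sums_unique[OF K_sums[OF P_V_summable[of i]], symmetric] by (simp add: row_def h_def)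
    also have "\<dots> \<le> (\<delta> * V i) * (\<Sum>j. K i j * h j)"
      using row_le[OF i] K0 h0 by (intro mult_right_mono suminf_nonneg Kh) (auto simp: row_def)
    finally have "(cmod (deflate P f i))\<^sup>2 * \<pi> i \<le> (\<delta> * V i) * (\<Sum>j. K i j * h j) * \<pi> i"
      by (rule mult_right_mono) (rule pi_nonneg)
    also have "\<dots> = \<delta> * ((V i * \<pi> i) * (\<Sum>j. K i j * h j))" by (simp add: mult_ac)
    finally show ?thesis by (simp only: V_mult_pi)
  qed
  have nn: "0 \<le> ell2_norm \<pi> f" by (rule ell2_norm_nonneg[OF pi_nonneg f])
  have "(L2_set (\<lambda>i. cmod (tail_part n0 (deflate P) f i) * sqrt (\<pi> i)) {..<n})\<^sup>2
      = (\<Sum>i<n. (cmod (tail_part n0 (deflate P) f i))\<^sup>2 * \<pi> i)"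
    by (simp add: L2_set_sq power_mult_distrib pi_nonneg)
  also have "\<dots> = (\<Sum>i=n0..<n. (cmod (deflate P f i))\<^sup>2 * \<pi> i)"
    by (rule sum.mono_neutral_cong_right) (auto simp: tail_part_def)
  also have "\<dots> \<le> (\<Sum>i=n0..<n. \<delta> * (sqrt (\<pi> i) * (\<Sum>j. K i j * h j)))"
    by (intro sum_mono row) auto
  also have "\<dots> = \<delta> * (\<Sum>i=n0..<n. \<Sum>j. sqrt (\<pi> i) * (K i j * h j))"
    by (simp add: sum_distrib_left suminf_mult[OF Kh])
  also have "(\<Sum>i=n0..<n. \<Sum>j. sqrt (\<pi> i) * (K i j * h j)) = (\<Sum>j. \<Sum>i=n0..<n. sqrt (\<pi> i) * (K i j * h j))"
    by (rule suminf_sum[symmetric]) (intro summable_mult Kh)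
  also have "\<dots> \<le> (\<Sum>j. \<delta> * ((cmod (f j))\<^sup>2 * \<pi> j))"
  proof (rule suminf_le)
    fix j
    have "(\<Sum>i=n0..<n. sqrt (\<pi> i) * (K i j * h j)) = (\<Sum>i=n0..<n. sqrt (\<pi> i) * K i j) * h j"
      by (simp only: sum_distrib_right mult.assoc)
    also have "\<dots> \<le> (\<delta> * sqrt (\<pi> j)) * h j"
      by (rule mult_right_mono[OF _ h0]) (use col_le[of j n] in \<open>simp add: K_def\<close>)
    also have "\<dots> = \<delta> * ((cmod (f j))\<^sup>2 * \<pi> j)" using hV[of j] by (simp add: mult_ac)
    finally show "(\<Sum>i=n0..<n. sqrt (\<pi> i) * (K i j * h j)) \<le> \<delta> * ((cmod (f j))\<^sup>2 * \<pi> j)" .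
  qed (intro summable_sum summable_mult Kh s2)+
  also have "\<dots> = \<delta> * (ell2_norm \<pi> f)\<^sup>2"
    by (simp add: suminf_mult[OF s2] ell2_norm_sq[OF pi_nonneg f])
  finally have "(L2_set (\<lambda>i. cmod (tail_part n0 (deflate P) f i) * sqrt (\<pi> i)) {..<n})\<^sup>2
      \<le> (\<delta> * ell2_norm \<pi> f)\<^sup>2"
    using delta_pos by (simp add: power2_eq_square mult_ac)
  then show ?thesis by (rule power2_le_imp_le) (use delta_pos nn in simp)
qed

sublocale sq: tail_contraction "ell2 \<pi>" "ell2_norm \<pi>" "deflate P" n0 \<delta> "(\<Sum>i<n0. 1 / \<pi> i) + V 0"
  by (rule tail_contraction_ell2[OF pi_pos _ _ deflate_head_ell2 deflate_tail_ell2 delta_pos])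
     (use V_pos[of 0] in \<open>auto intro!: deflate_add deflate_scale ell2_integrable add_nonneg_nonneg
        sum_nonneg less_imp_le[OF pi_pos]\<close>)

sublocale sq: deflated_contraction P \<pi> "ell2 \<pi>" "ell2_norm \<pi>" n0 \<delta> "(\<Sum>i<n0. 1 / \<pi> i) + V 0"
proof
  show "ell2 \<pi> \<subseteq> integrable1" using ell2_integrable by blast
  show "(\<lambda>i. 1) \<in> ell2 \<pi>" using sums_summable[OF pi_sums] by (simp add: ell2_def)
  have "cmod (mean_op \<pi> f 0) \<le> ell2_norm \<pi> f" if f: "f \<in> ell2 \<pi>" for f
  proof -
    have "cmod (mean_op \<pi> f 0) \<le> (\<Sum>i. cmod (f i) * \<pi> i)"
      unfolding mean_op_def
      by (rule norm_suminf_le) (use ell2_integrable[OF f] pi_nonneg in \<open>auto simp: integrable1_def norm_mult\<close>)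
    then show ?thesis using ell2_mean_le[OF f] by simp
  qed
  then show "\<exists>c. \<forall>f\<in>ell2 \<pi>. cmod (mean_op \<pi> f 0) \<le> c * ell2_norm \<pi> f"
    by (intro exI[of _ 1]) auto
qed

end

section \<open>Truncation\<close>

lemma uniform_limit_sum:
  fixes F :: "'i \<Rightarrow> nat \<Rightarrow> complex \<Rightarrow> complex"
  assumes "\<And>i. i \<in> S \<Longrightarrow> uniform_limit K (F i) (l i) sequentially"
  shows "uniform_limit K (\<lambda>n z. \<Sum>i\<in>S. F i n z) (\<lambda>z. \<Sum>i\<in>S. l i z) sequentially"
  using assms
proof (induction S rule: infinite_finite_induct)
  case (insert x S)
  have "uniform_limit K (\<lambda>n z. F x n z + (\<Sum>i\<in>S. F i n z)) (\<lambda>z. l x z + (\<Sum>i\<in>S. l i z)) sequentially"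
    by (rule uniform_limit_add) (use insert in auto)
  then show ?case using insert(1,2) by simp
qed (auto intro: uniform_limit_const)

lemma uniform_limit_prod:
  fixes F :: "'i \<Rightarrow> nat \<Rightarrow> complex \<Rightarrow> complex"
  assumes "\<And>i. i \<in> S \<Longrightarrow> uniform_limit K (F i) (l i) sequentially"
    and "\<And>i. i \<in> S \<Longrightarrow> continuous_on K (l i)" and "compact K"
  shows "uniform_limit K (\<lambda>n z. \<Prod>i\<in>S. F i n z) (\<lambda>z. \<Prod>i\<in>S. l i z) sequentially"
  using assms(1,2)
proof (induction S rule: infinite_finite_induct)
  case (insert x S)
  have bounded: "bounded (g ` K)" if "continuous_on K g" for g :: "complex \<Rightarrow> complex"
    using compact_continuous_image[OF that assms(3)] by (rule compact_imp_bounded)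
  have "uniform_limit K (\<lambda>n z. F x n z * (\<Prod>i\<in>S. F i n z)) (\<lambda>z. l x z * (\<Prod>i\<in>S. l i z)) sequentially"
    by (rule uniform_lim_mult) (use insert in \<open>auto intro!: bounded continuous_on_prod\<close>)
  then show ?case using insert(1,2) by simp
qed (auto intro: uniform_limit_const)

context contracting_kernel
begin

text \<open>
  Monotonicity of the weight is what makes the truncations no larger than the kernel itself.
\<close>

lemma V_mono:
  assumes i: "n1 \<le> i" and ij: "i \<le> j"
  shows "V i \<le> V j"
  using ij
proof (induction j rule: dec_induct)
  case (step j)
  have "\<pi> (Suc j) \<le> \<pi> j" using step i by (intro pi_decreasing) simp
  then have "V j \<le> V (Suc j)" using pi_pos[of j] pi_pos[of "Suc j"] by (simp add: V_eq frac_le)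
  then show ?case using step by simp
qed auto

lemma
  assumes k: "n1 < k" and f: "f \<in> wsup V"
  shows clamp_wsup: "(\<lambda>j. f (min j (k - 1))) \<in> wsup V"
    and clamp_norm: "wsup_norm V (\<lambda>j. f (min j (k - 1))) \<le> wsup_norm V f"
proof -
  have le: "cmod (f (min j (k - 1))) \<le> wsup_norm V f * V j" for j
  proof -
    have "V (min j (k - 1)) \<le> V j" using k by (auto simp: min_def intro!: V_mono)
    then have "wsup_norm V f * V (min j (k - 1)) \<le> wsup_norm V f * V j"
      by (rule mult_left_mono) (rule wsup_norm_nonneg[OF V_pos f])
    then show ?thesis using wsup_le[OF f V_pos, of "min j (k - 1)"] by simp
  qed
  show "(\<lambda>j. f (min j (k - 1))) \<in> wsup V" by (rule wsupI[OF V_pos le])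
  show "wsup_norm V (\<lambda>j. f (min j (k - 1))) \<le> wsup_norm V f" by (rule wsup_norm_le[OF V_pos le])
qed

lemma truncated_tail_contraction:
  assumes k: "n1 < k"
  shows "tail_contraction (wsup V) (wsup_norm V) (truncated_op P k) n0 \<delta> (\<Sum>i<n0. row i)"
proof (rule tail_contraction_wsup[OF V_pos])
  note cl = clamp_wsup[OF k] and cli = clamp_wsup[OF k, THEN set_mp[OF wsup_integrable]]
  show "truncated_op P k (\<lambda>i. f i + g i) = (\<lambda>i. truncated_op P k f i + truncated_op P k g i)"
    if "f \<in> wsup V" "g \<in> wsup V" for f g
    using deflate_add[OF cli[OF that(1)] cli[OF that(2)]] by (auto simp: truncated_op_def)
  show "truncated_op P k (\<lambda>i. c * f i) = (\<lambda>i. c * truncated_op P k f i)" if "f \<in> wsup V" for f c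
    using deflate_scale[OF cli[OF that]] by (auto simp: truncated_op_def)
  show "cmod (truncated_op P k f i) \<le> wsup_norm V f * row i" if f: "f \<in> wsup V" for f i
  proof -
    have "cmod (truncated_op P k f i) \<le> wsup_norm V (\<lambda>j. f (min j (k - 1))) * row i"
      using deflate_row[OF cl[OF f], of i] wsup_norm_nonneg[OF V_pos cl[OF f]] row_nonneg[of i]
      by (simp add: truncated_op_def)
    also have "\<dots> \<le> wsup_norm V f * row i" by (intro mult_right_mono clamp_norm k f row_nonneg)
    finally show ?thesis .
  qed
qed (use row_le row_nonneg delta_pos in \<open>auto simp: row_def\<close>)

lemma deflate_tendsto:
  assumes F: "\<And>k. F k \<in> wsup V" "\<And>k. wsup_norm V (F k) \<le> C" and lim: "\<And>i. (\<lambda>k. F k i) \<longlonglongrightarrow> f i"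
  shows "(\<lambda>k. deflate P (F k) i) \<longlonglongrightarrow> deflate P f i"
proof -
  have "(\<lambda>k. \<Sum>j. of_real (P i j) * F k j) \<longlonglongrightarrow> (\<Sum>j. of_real (P i j) * f j)"
  proof (rule tannerys_theorem[THEN conjunct2, THEN conjunct2])
    show "(\<lambda>k. of_real (P i j) * F k j) \<longlonglongrightarrow> of_real (P i j) * f j" for j
      by (intro tendsto_intros lim)
    show "summable (\<lambda>j. C * (P i j * V j))" by (intro summable_mult P_V_summable)
    have "norm (of_real (P i j) * F k j) \<le> C * (P i j * V j)" for k j
    proof -
      have "cmod (F k j) \<le> wsup_norm V (F k) * V j" by (rule wsup_le[OF F(1) V_pos])
      also have "\<dots> \<le> C * V j" by (intro mult_right_mono F(2) less_imp_le[OF V_pos])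
      finally have "P i j * cmod (F k j) \<le> P i j * (C * V j)" by (rule mult_left_mono[OF _ P_nonneg])
      then show ?thesis by (simp add: norm_mult P_nonneg mult_ac)
    qed
    then show "\<forall>\<^sub>F (j, k) in at_top \<times>\<^sub>F sequentially. norm (of_real (P i j) * F k j) \<le> C * (P i j * V j)"
      by (intro always_eventually) auto
  qed simp
  then show ?thesis unfolding deflate_def kernel_op_def by (intro tendsto_diff lim)
qed

lemma deflate_continuous: "pointwise_continuous (wsup V) (wsup_norm V) (deflate P)"
  unfolding pointwise_continuous_def using deflate_tendsto by blast

lemma truncated_continuous:
  assumes k: "n1 < k"
  shows "pointwise_continuous (wsup V) (wsup_norm V) (truncated_op P k)"
  unfolding pointwise_continuous_def
proof (intro allI impI)
  fix F f C i
  assume F: "\<forall>m. F m \<in> wsup V" "\<forall>m. wsup_norm V (F m) \<le> C" and lim: "\<forall>i. (\<lambda>m. F m i) \<longlonglongrightarrow> f i"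
  have "(\<lambda>m. deflate P (\<lambda>j. F m (min j (k - 1))) i) \<longlonglongrightarrow> deflate P (\<lambda>j. f (min j (k - 1))) i"
  proof (rule deflate_tendsto)
    show "wsup_norm V (\<lambda>j. F m (min j (k - 1))) \<le> C" for m
      using clamp_norm[OF k F(1)[rule_format]] F(2)[rule_format] by (rule order_trans)
  qed (use F lim clamp_wsup[OF k] in auto)
  then show "(\<lambda>m. truncated_op P k (F m) i) \<longlonglongrightarrow> truncated_op P k f i"
    by (simp add: truncated_op_def)
qed

abbreviation cut :: "nat \<Rightarrow> nat" where
  "cut k \<equiv> n1 + k"

text \<open>
  The truncations of size greater than \<open>n1\<close>, re-indexed from 0, so that the bounds hold for every
  index; \<open>cut k\<close> is the last row of the \<open>k\<close>-th one.
\<close>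

definition trunc_seq :: "nat \<Rightarrow> cseq \<Rightarrow> cseq" where
  "trunc_seq k = truncated_op P (Suc (cut k))"

abbreviation char_fun :: "complex \<Rightarrow> complex" where
  "char_fun \<equiv> eval_fps (char_fps n0 (deflate P))"

abbreviation char_fun_trunc :: "nat \<Rightarrow> complex \<Rightarrow> complex" where
  "char_fun_trunc k \<equiv> eval_fps (char_fps n0 (trunc_seq k))"

lemma trunc_seq_tail_contraction:
  "tail_contraction (wsup V) (wsup_norm V) (trunc_seq k) n0 \<delta> (\<Sum>i<n0. row i)"
  unfolding trunc_seq_def by (rule truncated_tail_contraction) simp

text \<open>
  Joint convergence of operators and arguments: for fixed \<open>i\<close> and \<open>j\<close>, truncation is not noticed
  once \<open>k\<close> is large.
\<close>

lemma trunc_seq_tendsto: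
  assumes F: "\<And>k. F k \<in> wsup V" "\<And>k. wsup_norm V (F k) \<le> C" and lim: "\<And>i. (\<lambda>k. F k i) \<longlonglongrightarrow> f i"
  shows "(\<lambda>k. trunc_seq k (F k) i) \<longlonglongrightarrow> deflate P f i"
proof -
  let ?G = "\<lambda>k j. F k (min j (n1 + k))"
  have "(\<lambda>k. deflate P (?G k) i) \<longlonglongrightarrow> deflate P f i"
  proof (rule deflate_tendsto)
    fix k
    have k: "n1 < Suc (n1 + k)" by simp
    show "?G k \<in> wsup V" using clamp_wsup[OF k F(1)[of k]] by simp
    show "wsup_norm V (?G k) \<le> C"
      using order_trans[OF clamp_norm[OF k F(1)[of k]] F(2)[of k]] by simp
  next
    fix j
    have "\<forall>\<^sub>F k in sequentially. F k j = ?G k j"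
      by (rule eventually_mono[OF eventually_ge_at_top[of j]]) (simp add: min_def)
    with lim[of j] show "(\<lambda>k. ?G k j) \<longlonglongrightarrow> f j" by (rule Lim_transform_eventually)
  qed
  moreover have "\<forall>\<^sub>F k in sequentially. deflate P (?G k) i = trunc_seq k (F k) i"
    by (rule eventually_mono[OF eventually_ge_at_top[of i]]) (simp add: trunc_seq_def truncated_op_def)
  ultimately show ?thesis by (rule Lim_transform_eventually)
qed

lemma ret_coeff_tendsto:
  "(\<lambda>k. ret_coeff n0 (trunc_seq k) n i j) \<longlonglongrightarrow> ret_coeff n0 (deflate P) n i j"
proof -
  define F where "F n k = (tail_part n0 (trunc_seq k) ^^ n) (unit_seq j)" for n k
  have FX: "F n k \<in> wsup V" for n k
    unfolding F_def by (intro tail_contraction.B_pow_X[OF trunc_seq_tail_contraction]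
        tail_contraction.X_unit[OF trunc_seq_tail_contraction])
  have Fn: "wsup_norm V (F n k) \<le> \<delta> ^ n * wsup_norm V (unit_seq j)" for n k
    unfolding F_def by (intro tail_contraction.nrm_B_pow[OF trunc_seq_tail_contraction]
        tail_contraction.X_unit[OF trunc_seq_tail_contraction])
  have lim: "(\<lambda>k. F n k i) \<longlonglongrightarrow> (tail_part n0 (deflate P) ^^ n) (unit_seq j) i" for n i
  proof (induction n arbitrary: i)
    case (Suc n)
    have lim: "(\<lambda>k. trunc_seq k (F n k) i) \<longlonglongrightarrow> deflate P ((tail_part n0 (deflate P) ^^ n) (unit_seq j)) i"
      by (rule trunc_seq_tendsto[OF FX Fn Suc.IH])
    show ?case
    proof (cases "i < n0")
      case True
      then show ?thesis by (simp add: F_def tail_part_pow_head del: funpow.simps)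
    next
      case False
      then show ?thesis using lim by (simp add: F_def tail_part_pow_tail del: funpow.simps)
    qed
  qed (simp add: F_def)
  show ?thesis
    unfolding ret_coeff_def using trunc_seq_tendsto[OF FX Fn lim, of n i] by (simp add: F_def)
qed

text \<open>
  Each coefficient converges, and all of them obey the same geometric bound, so the sum of the
  weighted differences tends to 0 by dominated convergence.
\<close>

lemma eval_ret_fps_uniform_limit:
  assumes R: "0 \<le> R" "R < 1 / \<delta>" and i: "i < n0"
  shows "uniform_limit (cball 0 R) (\<lambda>k. eval_fps (ret_fps n0 (trunc_seq k) i j))
     (eval_fps (ret_fps n0 (deflate P) i j)) sequentially"
proof -
  define c where "c k n = ret_coeff n0 (trunc_seq k) n i j - ret_coeff n0 (deflate P) n i j" for k n
  define M where "M = (\<Sum>i<n0. row i) * wsup_norm V (unit_seq j)"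
  have q: "0 \<le> R * \<delta>" "R * \<delta> < 1" using R delta_pos by (simp_all add: field_simps)
  have cb: "cmod (c k n) \<le> 2 * M * \<delta> ^ n" for k n
    using norm_triangle_ineq4[of "ret_coeff n0 (trunc_seq k) n i j" "ret_coeff n0 (deflate P) n i j"]
      tail_contraction.ret_coeff_bound[OF trunc_seq_tail_contraction i, of k n j] sup.ret_coeff_bound[OF i, of n j]
    by (simp add: c_def M_def)
  have cl: "(\<lambda>k. c k n) \<longlonglongrightarrow> 0" for n
    unfolding c_def by (rule LIM_zero[OF ret_coeff_tendsto])
  have sM: "summable (\<lambda>n. 2 * M * R * (R * \<delta>) ^ n)"
    using q by (intro summable_mult summable_geometric) auto
  have bd: "R ^ Suc n * cmod (c k n) \<le> 2 * M * R * (R * \<delta>) ^ n" for k n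
    using mult_left_mono[OF cb[of k n], of "R ^ Suc n"] R by (simp add: power_mult_distrib mult_ac)
  have nb: "norm (R ^ Suc n * cmod (c k n)) \<le> 2 * M * R * (R * \<delta>) ^ n" for k n
    using bd[of n k] R(1) by (simp only: real_norm_def abs_mult abs_norm_cancel power_abs abs_of_nonneg)
  have sc: "summable (\<lambda>n. R ^ Suc n * cmod (c k n))" for k
    by (rule summable_comparison_test'[OF sM nb])
  define \<epsilon> where "\<epsilon> k = (\<Sum>n. R ^ Suc n * cmod (c k n))" for k
  have "\<epsilon> \<longlonglongrightarrow> (\<Sum>n. 0)"
    unfolding \<epsilon>_def
  proof (rule tannerys_theorem[THEN conjunct2, THEN conjunct2])
    show "(\<lambda>k. R ^ Suc n * cmod (c k n)) \<longlonglongrightarrow> 0" for n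
      using tendsto_mult_right_zero[OF tendsto_norm_zero[OF cl]] by blast
    show "\<forall>\<^sub>F (n, k) in at_top \<times>\<^sub>F sequentially.
        norm (R ^ Suc n * cmod (c k n)) \<le> 2 * M * R * (R * \<delta>) ^ n"
      by (intro always_eventually) (auto simp only: split_beta nb)
  qed (rule sM, simp)
  then have \<epsilon>0: "\<epsilon> \<longlonglongrightarrow> 0" by simp
  have dist: "dist (eval_fps (ret_fps n0 (trunc_seq k) i j) z) (eval_fps (ret_fps n0 (deflate P) i j) z) \<le> \<epsilon> k"
    if z: "z \<in> cball 0 R" for k z
  proof -
    have z': "cmod z \<le> R" "cmod z < 1 / \<delta>" using z R by auto
    have "(\<lambda>n. z ^ Suc n * c k n) sums
       (eval_fps (ret_fps n0 (trunc_seq k) i j) z - eval_fps (ret_fps n0 (deflate P) i j) z)"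
      using sums_diff[OF tail_contraction.eval_ret_fps_sums[OF trunc_seq_tail_contraction i z'(2), of k j]
          sup.eval_ret_fps_sums[OF i z'(2), of j]]
      by (simp add: c_def right_diff_distrib)
    then have "eval_fps (ret_fps n0 (trunc_seq k) i j) z - eval_fps (ret_fps n0 (deflate P) i j) z
        = (\<Sum>n. z ^ Suc n * c k n)" by (rule sums_unique)
    moreover have "cmod (\<Sum>n. z ^ Suc n * c k n) \<le> \<epsilon> k"
      unfolding \<epsilon>_def
    proof (rule norm_suminf_le[OF _ sc])
      show "cmod (z ^ Suc n * c k n) \<le> R ^ Suc n * cmod (c k n)" for n
        unfolding norm_mult norm_power by (intro mult_right_mono power_mono z') auto
    qed
    ultimately show ?thesis by (simp add: dist_norm)
  qed
  show ?thesis
  proof (rule uniform_limitI)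
    fix e :: real assume "0 < e"
    with \<epsilon>0 have "\<forall>\<^sub>F k in sequentially. \<epsilon> k < e" by (rule order_tendstoD(2))
    then show "\<forall>\<^sub>F k in sequentially. \<forall>z\<in>cball 0 R.
       dist (eval_fps (ret_fps n0 (trunc_seq k) i j) z) (eval_fps (ret_fps n0 (deflate P) i j) z) < e"
    proof eventually_elim
      case (elim k)
      show ?case using le_less_trans[OF dist elim] by blast
    qed
  qed
qed

lemma continuous_ret_fps:
  assumes "R < 1 / \<delta>" "i < n0"
  shows "continuous_on (cball 0 R) (eval_fps (ret_fps n0 (deflate P) i j))"
proof (rule continuous_on_subset[OF continuous_on_eval_fps])
  show "cball 0 R \<subseteq> eball 0 (fps_conv_radius (ret_fps n0 (deflate P) i j))"
    using sup.conv_radius_ret_fps[OF assms(2), of j] assms(1)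
    by (auto simp: in_eball_iff) (meson ereal_less_eq(3) le_less_trans less_ereal.simps(1) less_le_trans)
qed

lemma char_fps_uniform_limit:
  assumes R: "0 \<le> R" "R < 1 / \<delta>"
  shows "uniform_limit (cball 0 R) (\<lambda>k. char_fun_trunc k)
     (char_fun) sequentially"
proof -
  define m where "m T z i j = (if i = j then 1 else 0) - eval_fps (ret_fps n0 T i j) z" for T z i j
  have det: "det (mat n0 n0 (\<lambda>(i, j). m T z i j))
     = (\<Sum>p | p permutes {0..<n0}. signof p * (\<Prod>i=0..<n0. m T z i (p i)))" for T z
    by (subst det_def'[of _ n0]) (auto intro!: sum.cong prod.cong dest: permutes_in_image)
  have ev: "char_fun z
      = (\<Sum>p | p permutes {0..<n0}. signof p * (\<Prod>i=0..<n0. m (deflate P) z i (p i)))"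
     "char_fun_trunc k z
      = (\<Sum>p | p permutes {0..<n0}. signof p * (\<Prod>i=0..<n0. m (trunc_seq k) z i (p i)))"
    if "z \<in> cball 0 R" for z k
  proof -
    have z: "cmod z < 1 / \<delta>" using that R by auto
    show "char_fun z
      = (\<Sum>p | p permutes {0..<n0}. signof p * (\<Prod>i=0..<n0. m (deflate P) z i (p i)))"
      using sup.eval_char_fps[OF z] det[of "deflate P" z] by (simp add: m_def)
    show "char_fun_trunc k z
      = (\<Sum>p | p permutes {0..<n0}. signof p * (\<Prod>i=0..<n0. m (trunc_seq k) z i (p i)))"
      using tail_contraction.eval_char_fps[OF trunc_seq_tail_contraction z, of k] det[of "trunc_seq k" z]
      by (simp add: m_def)
  qed
  have "uniform_limit (cball 0 R)
     (\<lambda>k z. \<Sum>p | p permutes {0..<n0}. signof p * (\<Prod>i=0..<n0. m (trunc_seq k) z i (p i)))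
     (\<lambda>z. \<Sum>p | p permutes {0..<n0}. signof p * (\<Prod>i=0..<n0. m (deflate P) z i (p i))) sequentially"
  proof (intro uniform_limit_sum bounded_linear.uniform_limit[OF bounded_linear_mult_right] uniform_limit_prod)
    fix p i assume "i \<in> {0..<n0}"
    then have i: "i < n0" by simp
    show "uniform_limit (cball 0 R) (\<lambda>k z. m (trunc_seq k) z i (p i)) (\<lambda>z. m (deflate P) z i (p i)) sequentially"
      unfolding m_def by (intro uniform_limit_intros eval_ret_fps_uniform_limit R i)
    show "continuous_on (cball 0 R) (\<lambda>z. m (deflate P) z i (p i))"
      unfolding m_def by (intro continuous_intros continuous_ret_fps R i)
  qed auto
  then show ?thesis
    by (rule uniform_limit_cong'[THEN iffD1, rotated 2]) (use ev in auto)
qed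

lemma holomorphic_char_fps: "char_fun holomorphic_on ball 0 (1 / \<delta>)"
  and holomorphic_char_fps_trunc: "char_fun_trunc k holomorphic_on ball 0 (1 / \<delta>)"
proof -
  have "eval_fps F holomorphic_on ball 0 (1 / \<delta>)" if "ereal (1 / \<delta>) \<le> fps_conv_radius F" for F :: "complex fps"
  proof (rule holomorphic_on_eval_fps)
    show "ball 0 (1 / \<delta>) \<subseteq> eball 0 (fps_conv_radius F)"
      using that by (auto simp: in_eball_iff) (meson less_ereal.simps(1) less_le_trans)
  qed
  note this[OF sup.conv_radius_char_fps] this[OF tail_contraction.conv_radius_char_fps[OF trunc_seq_tail_contraction[of k]]]
  then show "char_fun holomorphic_on ball 0 (1 / \<delta>)"
    "char_fun_trunc k holomorphic_on ball 0 (1 / \<delta>)" .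
qed

lemma eventually_no_zero:
  assumes R: "0 \<le> R" "R < 1 / \<delta>"
    and nz: "\<And>z. z \<in> cball 0 R \<Longrightarrow> char_fun z \<noteq> 0"
  shows "\<forall>\<^sub>F k in sequentially. \<forall>z\<in>cball 0 R. char_fun_trunc k z \<noteq> 0"
proof -
    have "continuous_on (cball 0 R) char_fun"
    by (rule continuous_on_subset[OF holomorphic_on_imp_continuous_on[OF holomorphic_char_fps]]) (use R in auto)
  then have "continuous_on (cball 0 R) (\<lambda>z. cmod (char_fun z))" by (rule continuous_on_norm)
  then obtain z0 where z0: "z0 \<in> cball 0 R" "\<And>z. z \<in> cball 0 R \<Longrightarrow> cmod (char_fun z0) \<le> cmod (char_fun z)"
    using continuous_attains_inf[of "cball 0 R :: complex set" "\<lambda>z. cmod (char_fun z)"] R by auto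
  have "0 < cmod (char_fun z0)" using nz[OF z0(1)] by simp
  from uniform_limitD[OF char_fps_uniform_limit[OF R] this] show ?thesis
  proof eventually_elim
    case (elim k)
    show ?case
    proof
      fix z :: complex assume z: "z \<in> cball 0 R"
      then show "char_fun_trunc k z \<noteq> 0"
        using elim[rule_format, OF z] z0(2)[OF z] by (auto simp: dist_norm)
    qed
  qed
qed

text \<open>
  Hurwitz's theorem on a small disc around the zero. The limit is not constant there, since by
  analytic continuation it would vanish at 0, where its value is 1.
\<close>

lemma eventually_zero_near:
  assumes z0: "cmod z0 < 1 / \<delta>" "char_fun z0 = 0" and e: "0 < e"
  shows "\<forall>\<^sub>F k in sequentially. \<exists>z. dist z0 z < e \<and> cmod z < 1 / \<delta> \<and> char_fun_trunc k z = 0"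
proof (rule ccontr)
  assume "\<not> ?thesis"
  from not_eventually_sequentiallyD[OF this] obtain r :: "nat \<Rightarrow> nat" where r: "strict_mono r"
    "\<And>k. \<not> (\<exists>z. dist z0 z < e \<and> cmod z < 1 / \<delta> \<and> char_fun_trunc (r k) z = 0)"
    by blast
    define S where "S = ball z0 e \<inter> ball 0 (1 / \<delta>)"
  have S: "open S" "connected S" "z0 \<in> S" "S \<subseteq> ball 0 (1 / \<delta>)"
    unfolding S_def using z0 e by (auto intro!: convex_connected convex_Int)
  have "char_fun z0 \<noteq> 0"
  proof (rule Hurwitz_no_zeros[OF S(1,2), of "\<lambda>k. char_fun_trunc (r k)" char_fun])
    show "char_fun_trunc (r k) holomorphic_on S" for k
      using holomorphic_char_fps_trunc S(4) by (rule holomorphic_on_subset)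
    show "char_fun holomorphic_on S" using holomorphic_char_fps S(4) by (rule holomorphic_on_subset)
    show "uniform_limit K (\<lambda>k. char_fun_trunc (r k)) char_fun sequentially"
      if K: "compact K" "K \<subseteq> S" for K
    proof (cases "K = {}")
      case False
      have "continuous_on K cmod" by (intro continuous_intros)
      then obtain w where w: "w \<in> K" "\<And>z. z \<in> K \<Longrightarrow> cmod z \<le> cmod w"
        using continuous_attains_sup[OF K(1) False, of cmod] by blast
      have "cmod w < 1 / \<delta>" using w(1) K(2) S(4) by auto
      then have u: "uniform_limit (cball 0 (cmod w)) (\<lambda>k. char_fun_trunc k) char_fun sequentially"
        by (intro char_fps_uniform_limit) auto
      have "uniform_limit (cball 0 (cmod w)) (\<lambda>k. char_fun_trunc (r k)) char_fun sequentially"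
      proof (rule uniform_limitI)
        fix \<epsilon> :: real assume "0 < \<epsilon>"
        from eventually_subseq[OF r(1) uniform_limitD[OF u this]]
        show "\<forall>\<^sub>F k in sequentially. \<forall>z\<in>cball 0 (cmod w).
            dist (char_fun_trunc (r k) z) (char_fun z) < \<epsilon>" .
      qed
      then show ?thesis by (rule uniform_limit_on_subset) (use w in auto)
    qed simp
    show "\<not> char_fun constant_on S"
    proof
      assume "char_fun constant_on S"
      then have "char_fun z = char_fun z0" if "z \<in> S" for z using that S(3) unfolding constant_on_def by metis
      then have "char_fun 0 = 0"
        using analytic_continuation_open[of S "ball 0 (1 / \<delta>)" char_fun "\<lambda>_. 0" 0] S z0 delta_pos holomorphic_char_fps
        by (auto intro: holomorphic_intros)
      then show False using sup.char_fps_0 by simp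
    qed
    show "char_fun_trunc (r k) z \<noteq> 0" if "z \<in> S" for k z
      using r(2)[of k] that by (auto simp: S_def)
  qed (rule S(3))
  with z0(2) show False by contradiction
qed

end

section \<open>Eigenvalues of the truncated matrices\<close>

context ergodic_kernel
begin

lemma clamp_integrable: "(\<lambda>j. f (min j m)) \<in> integrable1"
proof -
  have "cmod (f (min j m)) \<le> (\<Sum>i\<le>m. cmod (f i))" for j
    by (rule member_le_sum[of "min j m" _ "\<lambda>i. cmod (f i)"]) auto
  then have "summable (\<lambda>j. cmod (f (min j m)) * \<pi> j)"
    by (intro summable_comparison_test'[OF summable_mult[OF sums_summable[OF pi_sums]], of 0 _ "\<Sum>i\<le>m. cmod (f i)"])
       (auto simp: pi_nonneg intro!: mult_right_mono)
  then show ?thesis by (simp add: integrable1_def)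
qed

lemma kernel_op_clamp_add:
  "kernel_op P (\<lambda>j. g (min j m) + c) i = kernel_op P (\<lambda>j. g (min j m)) i + c"
  by (simp add: kernel_op_add[OF clamp_integrable integrable1_const] kernel_op_const)

lemma trunc_row_sum:
  assumes i: "i \<le> m"
  shows "(\<Sum>j<Suc m. trunc P (Suc m) $$ (i, j) * g j) = kernel_op P (\<lambda>j. g (min j m)) i"
proof -
  have s: "(\<lambda>j. of_real (P i j) * g (min j m)) sums kernel_op P (\<lambda>j. g (min j m)) i"
    by (rule kernel_op_sums[OF clamp_integrable])
  have t: "summable (\<lambda>l. P i (m + l))"
    using summable_ignore_initial_segment[OF sums_summable[OF P_sums], of i m] by (simp add: add.commute)
  have "kernel_op P (\<lambda>j. g (min j m)) i
      = (\<Sum>l. of_real (P i (l + m)) * g (min (l + m) m)) + (\<Sum>j<m. of_real (P i j) * g (min j m))"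
    using suminf_split_initial_segment[OF sums_summable[OF s], of m] sums_unique[OF s] by simp
  also have "(\<Sum>l. of_real (P i (l + m)) * g (min (l + m) m)) = (\<Sum>l. of_real (P i (m + l)) * g m)"
    by (simp add: add.commute[of _ m])
  also have "\<dots> = (\<Sum>l. of_real (P i (m + l))) * g m"
    by (rule suminf_mult2[symmetric]) (intro summable_of_real t)
  also have "(\<Sum>l. complex_of_real (P i (m + l))) = of_real (\<Sum>l. P i (m + l))"
    by (rule suminf_of_real[OF t, symmetric])
  finally show ?thesis using i by (simp add: trunc_def)
qed

lemma trunc_carrier: "trunc P k \<in> carrier_mat k k"
  by (simp add: trunc_def)

lemma spectrum_trunc_iff:
  "\<mu> \<in> spectrum (trunc P (Suc m)) \<longleftrightarrow>
     (\<exists>g. (\<exists>i\<le>m. g i \<noteq> 0) \<and> (\<forall>i\<le>m. kernel_op P (\<lambda>j. g (min j m)) i = \<mu> * g i))"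
proof -
  let ?A = "trunc P (Suc m)"
  have dim: "dim_row ?A = Suc m" by (simp add: trunc_def)
  have mult: "(?A *\<^sub>v v) $ i = kernel_op P (\<lambda>j. (\<lambda>j. v $ j) (min j m)) i"
    if "v \<in> carrier_vec (Suc m)" "i \<le> m" for v i
  proof -
    have "(?A *\<^sub>v v) $ i = (\<Sum>j<Suc m. ?A $$ (i, j) * v $ j)"
      using that by (simp add: scalar_prod_def lessThan_atLeast0 trunc_def del: sum.op_ivl_Suc)
    also have "\<dots> = kernel_op P (\<lambda>j. (\<lambda>j. v $ j) (min j m)) i" by (rule trunc_row_sum[OF that(2)])
    finally show ?thesis .
  qed
  show ?thesis
  proof
    assume "\<mu> \<in> spectrum ?A"
    then obtain v where v: "v \<in> carrier_vec (Suc m)" "v \<noteq> 0\<^sub>v (Suc m)" "?A *\<^sub>v v = \<mu> \<cdot>\<^sub>v v"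
      by (auto simp: spectrum_def eigenvalue_def eigenvector_def dim)
    obtain i where i: "i < Suc m" "v $ i \<noteq> 0"
      using v(1,2) by (metis carrier_vecD eq_vecI index_zero_vec)
    have "kernel_op P (\<lambda>j. v $ (min j m)) i = \<mu> * v $ i" if "i \<le> m" for i
      using mult[OF v(1) that] v(1,3) that by simp
    then show "\<exists>g. (\<exists>i\<le>m. g i \<noteq> 0) \<and> (\<forall>i\<le>m. kernel_op P (\<lambda>j. g (min j m)) i = \<mu> * g i)"
      using i by (intro exI[of _ "\<lambda>j. v $ j"] conjI exI[of _ i]) auto
  next
    assume "\<exists>g. (\<exists>i\<le>m. g i \<noteq> 0) \<and> (\<forall>i\<le>m. kernel_op P (\<lambda>j. g (min j m)) i = \<mu> * g i)"
    then obtain g i where g: "i \<le> m" "g i \<noteq> 0" "\<And>i. i \<le> m \<Longrightarrow> kernel_op P (\<lambda>j. g (min j m)) i = \<mu> * g i"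
      by blast
    let ?v = "vec (Suc m) g"
    have "?A *\<^sub>v ?v = \<mu> \<cdot>\<^sub>v ?v"
    proof (rule eq_vecI)
      fix i assume "i < dim_vec (\<mu> \<cdot>\<^sub>v ?v)"
      then have i: "i \<le> m" by simp
      have "(?A *\<^sub>v ?v) $ i = kernel_op P (\<lambda>j. ?v $ (min j m)) i" using mult[of ?v i] i by simp
      also have "(\<lambda>j. ?v $ (min j m)) = (\<lambda>j. g (min j m))" by auto
      finally show "(?A *\<^sub>v ?v) $ i = (\<mu> \<cdot>\<^sub>v ?v) $ i" using g(3)[OF i] i by simp
    qed (simp add: dim)
    moreover have "?v \<noteq> 0\<^sub>v (Suc m)"
    proof
      assume "?v = 0\<^sub>v (Suc m)"
      then have "?v $ i = 0\<^sub>v (Suc m) $ i" by simp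
      then show False using g(1,2) by simp
    qed
    ultimately show "\<mu> \<in> spectrum ?A"
      unfolding spectrum_def eigenvalue_def eigenvector_def dim by (auto intro: exI[of _ ?v])
  qed
qed

text \<open>
  Since constants are fixed, a relation \<open>P\<^sub>k g = \<mu> g + c\<close> with \<open>\<mu> \<noteq> 1\<close> becomes an eigenvalue
  equation after adding a suitable constant to \<open>g\<close>.
\<close>

lemma spectrum_trunc_of_affine:
  assumes "\<mu> \<noteq> 1" and eig: "\<And>i. i \<le> m \<Longrightarrow> kernel_op P (\<lambda>j. g (min j m)) i = \<mu> * g i + c"
    and nonconst: "\<And>s. \<exists>i\<le>m. g i \<noteq> s"
  shows "\<mu> \<in> spectrum (trunc P (Suc m))"
  unfolding spectrum_trunc_iff
proof (intro exI[of _ "\<lambda>i. g i + c / (\<mu> - 1)"] conjI allI impI)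
  obtain i where "i \<le> m" "g i \<noteq> - (c / (\<mu> - 1))" using nonconst by blast
  then show "\<exists>i\<le>m. g i + c / (\<mu> - 1) \<noteq> 0" by (auto simp: add_eq_0_iff2)
  fix i assume i: "i \<le> m"
  have "c + c / (\<mu> - 1) = \<mu> * (c / (\<mu> - 1))" using assms(1) by (simp add: field_simps)
  then show "kernel_op P (\<lambda>j. g (min j m) + c / (\<mu> - 1)) i = \<mu> * (g i + c / (\<mu> - 1))"
    unfolding kernel_op_clamp_add eig[OF i] by (simp add: distrib_left add.assoc)
qed

lemma truncated_op_apply:
  "truncated_op P (Suc m) f i = (if i \<le> m then kernel_op P (\<lambda>j. f (min j m)) i - f 0 else 0)"
  by (simp add: truncated_op_def deflate_def)

text \<open>
  This is an eigenvector of the matrix that \<open>P\<^sub>k\<close> induces on sequences modulo constants,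
  represented by their values relative to the value at 0. It is needed to know that \<open>P\<^sub>k\<close> has an
  eigenvalue other than 1 at all, without which \<open>\<rho>\<^sub>k\<close> would be the maximum of an empty set.
\<close>

lemma trunc_affine_eigenvector:
  assumes "0 < m"
  obtains \<mu> g c where "g 0 = 0" "\<exists>i\<le>m. g i \<noteq> (0 :: complex)"
    "\<And>i. i \<le> m \<Longrightarrow> kernel_op P (\<lambda>j. g (min j m)) i = \<mu> * g i + c"
proof -
  let ?A = "trunc P (Suc m)"
  \<comment> \<open>subtracting row 0 removes the constants; column 0 is dropped because \<open>g 0 = 0\<close>\<close>
  let ?C = "mat m m (\<lambda>(i, j). ?A $$ (Suc i, Suc j) - ?A $$ (0, Suc j))"
  have C: "?C \<in> carrier_mat m m" by simp
  obtain \<mu> where "\<mu> \<in> spectrum ?C" using spectrum_non_empty[OF C assms] by blast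
  then obtain w where w: "w \<in> carrier_vec m" "w \<noteq> 0\<^sub>v m" "?C *\<^sub>v w = \<mu> \<cdot>\<^sub>v w"
    by (auto simp: spectrum_def eigenvalue_def eigenvector_def)
  define g where "g i = (case i of 0 \<Rightarrow> 0 | Suc j \<Rightarrow> w $ j)" for i
  have Pg: "kernel_op P (\<lambda>j. g (min j m)) i = (\<Sum>j<m. ?A $$ (i, Suc j) * w $ j)" if "i \<le> m" for i
    unfolding trunc_row_sum[OF that, symmetric]
    by (subst sum.lessThan_Suc_shift) (simp add: g_def)
  define c where "c = kernel_op P (\<lambda>j. g (min j m)) 0"
  have eig: "kernel_op P (\<lambda>j. g (min j m)) i = \<mu> * g i + c" if i: "i \<le> m" for i
  proof (cases i)
    case 0
    then show ?thesis by (simp add: c_def g_def)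
  next
    case (Suc l)
    then have l: "l < m" using i by simp
    have "\<mu> * w $ l = (?C *\<^sub>v w) $ l" using w(1) l by (simp add: w(3))
    also have "\<dots> = (\<Sum>j<m. (?A $$ (Suc l, Suc j) - ?A $$ (0, Suc j)) * w $ j)"
      using w(1) l by (simp add: scalar_prod_def lessThan_atLeast0)
    also have "\<dots> = kernel_op P (\<lambda>j. g (min j m)) i - c"
      unfolding c_def Pg[OF i] Pg[OF le0] by (simp add: Suc left_diff_distrib sum_subtractf)
    finally show ?thesis by (simp add: Suc g_def)
  qed
  obtain l where l: "l < m" "w $ l \<noteq> 0"
    using w(1,2) by (metis carrier_vecD eq_vecI index_zero_vec)
  show ?thesis
  proof (rule that[of g])
    show "g 0 = 0" by (simp add: g_def)
    show "\<exists>i\<le>m. g i \<noteq> 0" using l by (intro exI[of _ "Suc l"]) (simp add: g_def)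
  qed (rule eig)
qed

end

context contracting_kernel
begin

lemma finite_support_wsup:
  assumes "\<And>i. n \<le> i \<Longrightarrow> f i = 0" shows "f \<in> wsup V"
proof (rule wsupI[OF V_pos])
  fix i
  have nn: "0 \<le> cmod (f i) / V i" for i using V_pos[of i] by (simp add: less_imp_le)
  have "cmod (f i) / V i \<le> (\<Sum>j<n. cmod (f j) / V j)"
  proof (cases "i < n")
    case True
    then show ?thesis by (intro member_le_sum nn) auto
  qed (use assms in \<open>auto intro!: sum_nonneg nn\<close>)
  then show "cmod (f i) \<le> (\<Sum>j<n. cmod (f j) / V j) * V i"
    using V_pos[of i] by (simp add: pos_divide_le_eq)
qed

lemma trunc_char_0: "char_fun_trunc k 0 = 1"
  by (rule tail_contraction.char_fps_0[OF trunc_seq_tail_contraction])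

lemma spectrum_of_trunc_zero:
  assumes z: "cmod z < 1 / \<delta>" "z \<noteq> 1" and zero: "char_fun_trunc k z = 0"
  shows "1 / z \<in> spectrum (trunc P (Suc (cut k)))"
proof -
  have z0: "z \<noteq> 0" using zero trunc_char_0 by auto
  have cont: "pointwise_continuous (wsup V) (wsup_norm V) (trunc_seq k)"
    unfolding trunc_seq_def by (rule truncated_continuous) simp
  obtain f where f: "f \<noteq> (\<lambda>i. 0)" "\<And>i. z * trunc_seq k f i = f i"
    by (rule tail_contraction.eigenvector_of_zero[OF trunc_seq_tail_contraction z(1) zero cont]) (rule that)
  have out: "f i = 0" if "cut k < i" for i
    using f(2)[of i] that by (simp add: trunc_seq_def truncated_op_apply)
  have eig: "kernel_op P (\<lambda>j. f (min j (cut k))) i = 1 / z * f i + f 0" if "i \<le> cut k" for i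
  proof -
    have "z * (kernel_op P (\<lambda>j. f (min j (cut k))) i - f 0) = f i"
      using f(2)[of i] that by (simp add: trunc_seq_def truncated_op_apply)
    then show ?thesis using z0 by (simp add: field_simps)
  qed
  show ?thesis
  proof (rule spectrum_trunc_of_affine[OF _ eig])
    show "1 / z \<noteq> 1" using z(2) by auto
    show "\<exists>i\<le>cut k. f i \<noteq> s" for s
    proof (rule ccontr)
      assume "\<not> (\<exists>i\<le>cut k. f i \<noteq> s)"
      then have s: "f i = s" if "i \<le> cut k" for i using that by blast
      then have "(\<lambda>j. f (min j (cut k))) = (\<lambda>_. s)" by auto
      then have "kernel_op P (\<lambda>j. f (min j (cut k))) 0 = s" by (simp only: kernel_op_const)
      then have "s = 0" using eig[of 0] s[of 0] z0 by simp
      then have "f i = 0" for i using s[of i] out[of i] by (cases "i \<le> cut k") auto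
      then show False using f(1) by auto
    qed
  qed
qed

lemma trunc_zero_of_affine:
  assumes \<mu>: "\<delta> < cmod \<mu>" and eig: "\<And>i. i \<le> cut k \<Longrightarrow> kernel_op P (\<lambda>j. g (min j (cut k))) i = \<mu> * g i + c"
    and s: "\<mu> * s = c - g 0" and ne: "\<exists>i\<le>cut k. g i + s \<noteq> 0"
  shows "char_fun_trunc k (1 / \<mu>) = 0"
proof -
  define f where "f i = (if i \<le> cut k then g i + s else 0)" for i
  have \<mu>0: "\<mu> \<noteq> 0" using \<mu> delta_pos by auto
  show ?thesis
  proof (rule tail_contraction.zero_of_eigenvector[OF trunc_seq_tail_contraction])
    show "f \<in> wsup V" by (rule finite_support_wsup[of "Suc (cut k)"]) (simp add: f_def)
    show "f \<noteq> (\<lambda>i. 0)" using ne by (auto simp: f_def fun_eq_iff)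
    show "cmod (1 / \<mu>) < 1 / \<delta>" using \<mu> delta_pos by (simp add: norm_divide frac_less2)
    show "1 / \<mu> * trunc_seq k f i = f i" for i
    proof (cases "i \<le> cut k")
      case True
      have "trunc_seq k f i = kernel_op P (\<lambda>j. g (min j (cut k)) + s) i - (g 0 + s)"
        using True by (simp add: trunc_seq_def truncated_op_apply f_def)
      also have "\<dots> = \<mu> * g i + (c - g 0)" unfolding kernel_op_clamp_add eig[OF True] by simp
      also have "\<dots> = \<mu> * (g i + s)" by (simp add: s[symmetric] distrib_left)
      finally show ?thesis using \<mu>0 True by (simp add: f_def)
    next
      case False
      then show ?thesis by (simp add: f_def trunc_seq_def truncated_op_apply)
    qed
  qed
qed

lemma trunc_zero_of_spectrum:
  assumes sp: "\<mu> \<in> spectrum (trunc P (Suc (cut k)))" and \<mu>: "\<mu> \<noteq> 1" "\<delta> < cmod \<mu>"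
  shows "char_fun_trunc k (1 / \<mu>) = 0"
proof -
  obtain g where g: "\<exists>i\<le>cut k. g i \<noteq> 0" "\<And>i. i \<le> cut k \<Longrightarrow> kernel_op P (\<lambda>j. g (min j (cut k))) i = \<mu> * g i"
    using sp unfolding spectrum_trunc_iff by blast
  have \<mu>0: "\<mu> \<noteq> 0" using \<mu>(2) delta_pos by auto
  show ?thesis
  proof (rule trunc_zero_of_affine[OF \<mu>(2), of k g 0 "- g 0 / \<mu>"])
    show "\<mu> * (- g 0 / \<mu>) = 0 - g 0" using \<mu>0 by simp
    show "\<exists>i\<le>cut k. g i + - g 0 / \<mu> \<noteq> 0"
    proof (rule ccontr)
      assume "\<not> (\<exists>i\<le>cut k. g i + - g 0 / \<mu> \<noteq> 0)"
      then have *: "g i + - g 0 / \<mu> = 0" if "i \<le> cut k" for i using that by blast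
      have c: "g i = g 0 / \<mu>" if "i \<le> cut k" for i using *[OF that] by simp
      have "g 0 * (\<mu> - 1) = 0" using c[of 0] \<mu>0 by (simp add: field_simps)
      then have "g 0 = 0" using \<mu>(1) by simp
      then have "g i = 0" if "i \<le> cut k" for i using c[OF that] by simp
      then show False using g(1) by auto
    qed
  qed (use g(2) in auto)
qed

text \<open>
  If the eigenvalue on the quotient by the constants were 1, the deflated truncation would have the
  eigenvalue 1, which is excluded because 1 is not a zero.
\<close>

lemma trunc_eigenvalue_exists:
  assumes d: "\<delta> < 1" and k: "0 < k" and nz: "char_fun_trunc k 1 \<noteq> 0"
  obtains \<mu> where "\<mu> \<in> spectrum (trunc P (Suc (cut k)))" "\<mu> \<noteq> 1"
proof -
  obtain \<mu> g c where g: "g 0 = 0" "\<exists>i\<le>cut k. g i \<noteq> (0 :: complex)"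
    "\<And>i. i \<le> cut k \<Longrightarrow> kernel_op P (\<lambda>j. g (min j (cut k))) i = \<mu> * g i + c"
    by (rule trunc_affine_eigenvector[of "cut k"]) (use k in simp, rule that)
  have nonconst: "\<exists>i\<le>cut k. g i \<noteq> s" for s
  proof (cases "s = 0")
    case False
    then show ?thesis using g(1) by (intro exI[of _ 0]) auto
  qed (use g(2) in simp)
  have "\<mu> \<noteq> 1"
  proof
    assume 1: "\<mu> = 1"
    have "char_fun_trunc k (1 / 1) = 0"
    proof (rule trunc_zero_of_affine[of 1 k g c c])
      show "\<exists>i\<le>cut k. g i + c \<noteq> 0" using nonconst[of "- c"] by (auto simp: add_eq_0_iff2)
    qed (use d g 1 in auto)
    with nz show False by simp
  qed
  from that[OF spectrum_trunc_of_affine[OF this g(3) nonconst] this] show ?thesis .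
qed

lemma rho_trunc_eventually_less:
  assumes r: "\<delta> < r" "r < 1"
    and nz: "\<And>z. z \<in> cball 0 (1 / r) \<Longrightarrow> char_fun z \<noteq> 0"
  shows "\<forall>\<^sub>F k in sequentially. rho_trunc P k < r"
proof -
  have r0: "0 < r" using r delta_pos by simp
  have "\<forall>\<^sub>F k in sequentially. rho_trunc P (Suc (cut k)) < r"
    using eventually_no_zero[of "1 / r"] eventually_gt_at_top[of 0]
  proof (rule eventually_elim2)
    show "1 / r < 1 / \<delta>" using r delta_pos by (simp add: frac_less2)
    fix k :: nat assume D: "\<forall>z\<in>cball 0 (1 / r). char_fun_trunc k z \<noteq> 0" and k: "0 < k"
    let ?S = "{z \<in> spectrum (trunc P (Suc (cut k))). cmod z < 1}"
    have small: "cmod \<mu> < r" if "\<mu> \<in> spectrum (trunc P (Suc (cut k)))" "\<mu> \<noteq> 1" for \<mu>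
    proof (rule ccontr)
      assume "\<not> cmod \<mu> < r"
      then have ge: "r \<le> cmod \<mu>" by simp
      then have "char_fun_trunc k (1 / \<mu>) = 0"
        using trunc_zero_of_spectrum[OF that] r by simp
      moreover have "1 / \<mu> \<in> cball 0 (1 / r)" using ge r0 by (simp add: norm_divide frac_le)
      ultimately show False using D by blast
    qed
    have "char_fun_trunc k 1 \<noteq> 0" using D r r0 by simp
    then obtain \<mu> where \<mu>: "\<mu> \<in> spectrum (trunc P (Suc (cut k)))" "\<mu> \<noteq> 1"
      using trunc_eigenvalue_exists[OF _ k] r by auto
    then have ne: "?S \<noteq> {}" using small[OF \<mu>] r by auto
    have fin: "finite ?S" using card_finite_spectrum(1)[OF trunc_carrier] by simp
    have "\<forall>x\<in>cmod ` ?S. x < r" by (auto intro!: small)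
    then show "rho_trunc P (Suc (cut k)) < r"
      unfolding rho_trunc_def using fin ne by (subst Max_less_iff) auto
  qed (use r0 nz in auto)
  then show ?thesis
    using eventually_sequentially_seg[of "\<lambda>k. rho_trunc P k < r" "Suc n1"] by (simp add: add.commute)
qed

lemma rho_trunc_eventually_greater:
  assumes z0: "cmod z0 < 1 / \<delta>" "1 < cmod z0" "char_fun z0 = 0"
    and s: "s < 1 / cmod z0"
  shows "\<forall>\<^sub>F k in sequentially. s < rho_trunc P k"
proof -
  \<comment> \<open>a positive substitute for \<open>s\<close>, so that \<open>1 / t\<close> makes sense\<close>
  define t where "t = max s (1 / (2 * cmod z0))"
  have "0 < 1 / (2 * cmod z0)" "1 / (2 * cmod z0) < 1 / cmod z0"
    using z0(2) by (auto intro!: frac_less2)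
  then have t: "0 < t" "s \<le> t" "t < 1 / cmod z0"
    using s by (auto simp: t_def)
  have "0 < cmod z0" using z0(2) by linarith
  then have "t * cmod z0 < 1" using t(3) by (simp only: pos_less_divide_eq)
  then have tz: "cmod z0 < 1 / t" using t(1) by (simp add: pos_less_divide_eq mult.commute)
  define e where "e = min (cmod z0 - 1) (1 / t - cmod z0)"
  have e: "0 < e" using z0(2) tz by (simp add: e_def)
  have "\<forall>\<^sub>F k in sequentially. s < rho_trunc P (Suc (cut k))"
    using eventually_zero_near[OF z0(1,3) e]
  proof eventually_elim
    case (elim k)
    then obtain z where z: "dist z0 z < e" "cmod z < 1 / \<delta>" "char_fun_trunc k z = 0"
      by blast
    have "\<bar>cmod z0 - cmod z\<bar> < e" using norm_triangle_ineq3[of z0 z] z(1) by (simp add: dist_norm)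
    then have zb: "1 < cmod z" "cmod z < 1 / t" by (auto simp: e_def)
    then have "1 / z \<in> spectrum (trunc P (Suc (cut k)))"
      by (intro spectrum_of_trunc_zero z) auto
    moreover have zpos: "0 < cmod z" using zb(1) by linarith
    then have "cmod (1 / z) < 1"
      using zb(1) by (simp only: norm_divide norm_one pos_divide_less_eq mult_1)
    ultimately have "cmod (1 / z) \<le> rho_trunc P (Suc (cut k))"
      unfolding rho_trunc_def using card_finite_spectrum(1)[OF trunc_carrier] by (intro Max_ge) auto
    moreover have "t * cmod z < 1" using zb(2) t(1) by (simp add: pos_less_divide_eq mult.commute)
    then have "t < cmod (1 / z)" using zpos by (simp only: norm_divide norm_one pos_less_divide_eq)
    ultimately show ?case using t(2) by simp
  qed
  then show ?thesis
    using eventually_sequentially_seg[of "\<lambda>k. s < rho_trunc P k" "Suc n1"] by (simp add: add.commute)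
qed

end

section \<open>The spectral dichotomy\<close>

context contracting_kernel
begin

lemma rates_of_no_zero:
  assumes d: "\<delta> < 1" and nz: "\<And>z. cmod z < 1 / \<delta> \<Longrightarrow> char_fun z \<noteq> 0"
  shows "rate2 P \<pi> \<le> \<delta>" "rateV V P \<pi> \<le> \<delta>"
    and "\<delta> < s \<Longrightarrow> \<forall>\<^sub>F k in sequentially. rho_trunc P k < s"
proof -
  show "rate2 P \<pi> \<le> \<delta>" unfolding rate2_def by (rule sq.Inf_rate_le[OF d nz])
  show "rateV V P \<pi> \<le> \<delta>" unfolding rateV_def by (rule sup.Inf_rate_le[OF d nz])
  assume s: "\<delta> < s"
  obtain r where r: "\<delta> < r" "r < min s 1" using dense[of \<delta> "min s 1"] s d by auto
  have "\<forall>\<^sub>F k in sequentially. rho_trunc P k < r"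
  proof (rule rho_trunc_eventually_less)
    fix z :: complex assume "z \<in> cball 0 (1 / r)"
    moreover have "1 / r < 1 / \<delta>" using r delta_pos by (simp add: frac_less2)
    ultimately have "cmod z < 1 / \<delta>" by simp
    then show "char_fun z \<noteq> 0" by (rule nz)
  qed (use r in auto)
  then show "\<forall>\<^sub>F k in sequentially. rho_trunc P k < s"
    by eventually_elim (use r in auto)
qed

text \<open>
  The zeros in a closed disc form a compact set, so there is one of least modulus; its reciprocal is
  the common value.
\<close>

lemma rates_of_zero:
  assumes z: "cmod z < 1 / \<delta>" "char_fun z = 0"
  obtains R where "\<delta> < R" "rate2 P \<pi> = R" "rateV V P \<pi> = R" "(\<lambda>k. rho_trunc P k) \<longlonglongrightarrow> R"
proof -
    let ?Z = "cball 0 (cmod z) \<inter> char_fun -` {0}"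
  have "continuous_on (cball 0 (cmod z)) char_fun"
    by (rule continuous_on_subset[OF holomorphic_on_imp_continuous_on[OF holomorphic_char_fps]])
       (use z(1) in auto)
  then have "closed ?Z" by (rule continuous_closed_preimage) auto
  then have "compact ?Z" by (simp add: compact_eq_bounded_closed bounded_Int)
  moreover have "?Z \<noteq> {}" using z(2) by auto
  ultimately obtain z0 where z0: "z0 \<in> ?Z" "\<And>w. w \<in> ?Z \<Longrightarrow> cmod z0 \<le> cmod w"
    using continuous_attains_inf[of ?Z cmod] continuous_on_norm_id by blast
  have D0: "char_fun z0 = 0" and z0le: "cmod z0 \<le> cmod z" using z0(1) by auto
  have min: "char_fun w \<noteq> 0" if "cmod w < cmod z0" for w
    using z0(2)[of w] z0le that by auto
  have z0d: "cmod z0 < 1 / \<delta>" using z0le z(1) by simp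
  have z00: "z0 \<noteq> 0" using D0 sup.char_fps_0 by auto
  obtain u where u: "eigen_seq n0 (deflate P) z0 u \<in> wsup V" "eigen_seq n0 (deflate P) z0 u \<noteq> (\<lambda>i. 0)"
    "\<And>i. z0 * deflate P (eigen_seq n0 (deflate P) z0 u) i = eigen_seq n0 (deflate P) z0 u i"
    by (rule sup.eigenvector_of_zero[OF z0d D0 deflate_continuous]) (rule that)
  have uq: "eigen_seq n0 (deflate P) z0 u \<in> ell2 \<pi>" by (rule sq.eigen_seq_X[OF z0d])
  let ?R = "1 / cmod z0"
  have R1: "?R < 1" by (rule sup.rate_ge_of_zero(1)[OF u z00])
  have z01: "1 < cmod z0" using R1 z00 by simp
  have dR: "\<delta> < ?R" using z0d z00 delta_pos by (simp add: field_simps)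
  show ?thesis
  proof (rule that[OF dR])
    show "rate2 P \<pi> = ?R" unfolding rate2_def by (rule sq.Inf_rate_eq[OF uq u(2,3) z00 z0d min])
    show "rateV V P \<pi> = ?R" unfolding rateV_def by (rule sup.Inf_rate_eq[OF u z00 z0d min])
    show "(\<lambda>k. rho_trunc P k) \<longlonglongrightarrow> ?R"
    proof (rule order_tendstoI)
      fix s assume "s < ?R"
      then show "\<forall>\<^sub>F k in sequentially. s < rho_trunc P k"
        by (rule rho_trunc_eventually_greater[OF z0d z01 D0])
    next
      fix s assume s: "?R < s"
      obtain r where r: "?R < r" "r < min s 1" using dense[of ?R "min s 1"] s R1 by auto
      have "\<forall>\<^sub>F k in sequentially. rho_trunc P k < r"
      proof (rule rho_trunc_eventually_less)
        fix w :: complex assume "w \<in> cball 0 (1 / r)"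
        moreover have "1 / r < cmod z0"
        proof -
          have "0 < r" using r dR delta_pos by linarith
          moreover have "0 < cmod z0" using z01 by linarith
          then have "1 < r * cmod z0" using r(1) by (simp only: pos_divide_less_eq)
          ultimately show ?thesis by (simp add: pos_divide_less_eq mult.commute)
        qed
        ultimately show "char_fun w \<noteq> 0" by (intro min) simp
      qed (use r dR in auto)
      then show "\<forall>\<^sub>F k in sequentially. rho_trunc P k < s"
        by eventually_elim (use r in auto)
    qed
  qed
qed

end

section \<open>Asymptotically homogeneous band kernels\<close>

text \<open>
  The asymptotic hypotheses of the proposition, on top of ergodicity.
\<close>

locale band_kernel = ergodic_kernel P \<pi> for P \<pi> +
  fixes N i\<^sub>0 :: nat and a :: "int \<Rightarrow> real" and \<tau> :: real
  assumes band: "\<And>i j. i\<^sub>0 \<le> i \<Longrightarrow> int N < \<bar>int i - int j\<bar> \<Longrightarrow> P i j = 0"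
    and a_nonneg: "\<And>m. m \<in> {- int N..int N} \<Longrightarrow> 0 \<le> a m"
    and a_lim: "\<And>m. m \<in> {- int N..int N} \<Longrightarrow> (\<lambda>i. P i (nat (int i + m))) \<longlonglongrightarrow> a m"
    and tau: "0 \<le> \<tau>" "\<tau> < 1"
    and ratio_lim: "(\<lambda>i. \<pi> (i + 1) / \<pi> i) \<longlonglongrightarrow> \<tau>"
    and drift: "(\<Sum>k = - int N..int N. of_int k * a k) < 0"
begin

definition scaled :: "nat \<Rightarrow> int \<Rightarrow> real" where
  "scaled i m = P i (nat (int i + m)) * sqrt (\<pi> i / \<pi> (nat (int i + m)))"

definition scaled_lim :: "int \<Rightarrow> real" where
  "scaled_lim m = (if \<tau> > 0 then a m * \<tau> powr (- of_int m / 2) else if m = 0 then a 0 else 0)"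

definition \<alpha> :: real where
  "\<alpha> = (if \<tau> > 0 then \<Sum>m = - int N..int N. a m * \<tau> powr (- of_int m / 2) else a 0)"

lemma alpha_eq: "\<alpha> = (\<Sum>m = - int N..int N. scaled_lim m)"
  by (simp add: \<alpha>_def scaled_lim_def)

lemma ratio_lim_add: "(\<lambda>i. \<pi> (i + d) / \<pi> i) \<longlonglongrightarrow> \<tau> ^ d"
proof (induction d)
  case 0
  have "(\<lambda>i. \<pi> (i + 0) / \<pi> i) = (\<lambda>i. 1)" using pi_pos by (auto simp: less_imp_neq[symmetric])
  then show ?case by simp
next
  case (Suc d)
  have "(\<lambda>i. \<pi> (i + 1 + d) / \<pi> (i + 1) * (\<pi> (i + 1) / \<pi> i)) \<longlonglongrightarrow> \<tau> ^ d * \<tau>"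
    by (intro tendsto_mult ratio_lim LIMSEQ_ignore_initial_segment[OF Suc, of 1])
  moreover have "\<pi> (i + 1 + d) / \<pi> (i + 1) * (\<pi> (i + 1) / \<pi> i) = \<pi> (i + Suc d) / \<pi> i" for i
    using pi_pos[of "i + 1"] by simp
  ultimately show ?case by (simp add: mult.commute)
qed

lemma ratio_lim_sub:
  assumes "\<tau> > 0" shows "(\<lambda>i. \<pi> (nat (int i - int d)) / \<pi> i) \<longlonglongrightarrow> 1 / \<tau> ^ d"
proof (rule LIMSEQ_offset[of _ d])
  have "(\<lambda>i. 1 / (\<pi> (i + d) / \<pi> i)) \<longlonglongrightarrow> 1 / \<tau> ^ d"
    by (intro tendsto_divide tendsto_const ratio_lim_add) (use assms in auto)
  then show "(\<lambda>i. \<pi> (nat (int (i + d) - int d)) / \<pi> (i + d)) \<longlonglongrightarrow> 1 / \<tau> ^ d" by simp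
qed

lemma ratio_lim_int:
  assumes "\<tau> > 0" shows "(\<lambda>i. \<pi> (nat (int i + m)) / \<pi> i) \<longlonglongrightarrow> \<tau> powr of_int m"
proof (cases "0 \<le> m")
  case True
  then obtain d where m: "m = int d" using nonneg_int_cases by blast
  have "nat (int i + int d) = i + d" for i by simp
  then show ?thesis using ratio_lim_add[of d] assms by (simp add: m powr_realpow)
next
  case False
  then obtain d where m: "m = - int d" by (metis neg_int_cases not_le)
  have "\<tau> powr of_int m = 1 / \<tau> ^ d" using assms by (simp add: m powr_minus_divide powr_realpow)
  then show ?thesis using ratio_lim_sub[OF assms, of d] by (simp add: m)
qed

lemma scaled_nonneg: "0 \<le> scaled i m"
  by (simp add: scaled_def P_nonneg pi_nonneg)

text \<open>
  For \<open>\<tau> = 0\<close> and \<open>m \<noteq> 0\<close> the scaled entry tends to 0: for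
  \<open>m < 0\<close> the ratio of the weights vanishes, and for \<open>m > 0\<close> the bound
  \<open>P(i,j) \<le> \<pi>(j)/\<pi>(i)\<close> makes up for the growing weight.
\<close>

lemma scaled_tendsto:
  assumes m: "m \<in> {- int N..int N}"
  shows "(\<lambda>i. scaled i m) \<longlonglongrightarrow> scaled_lim m"
proof (cases "\<tau> > 0")
  case True
  have "(\<lambda>i. P i (nat (int i + m)) * sqrt (1 / (\<pi> (nat (int i + m)) / \<pi> i))) \<longlonglongrightarrow> a m * sqrt (1 / \<tau> powr of_int m)"
    by (intro tendsto_intros a_lim m ratio_lim_int True) (use True in auto)
  moreover have "sqrt (1 / \<tau> powr of_int m) = \<tau> powr (- of_int m / 2)"
    using True by (simp add: powr_minus_divide[symmetric] powr_half_sqrt[symmetric] powr_powr)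
  ultimately show ?thesis using True by (simp add: scaled_def scaled_lim_def)
next
  case False
  then have tau0: "\<tau> = 0" using tau by simp
  have small: "(\<lambda>i. scaled i m) \<longlonglongrightarrow> 0"
    if "m \<noteq> 0"
  proof (cases "0 < m")
    case True
    then obtain d where d: "m = int d" "d > 0" using zero_less_imp_eq_int by blast
    have "(\<lambda>i. sqrt (\<pi> (i + d) / \<pi> i)) \<longlonglongrightarrow> sqrt (\<tau> ^ d)" by (intro tendsto_intros ratio_lim_add)
    then have lim: "(\<lambda>i. sqrt (\<pi> (i + d) / \<pi> i)) \<longlonglongrightarrow> 0"
      using d(2) tau0 by (simp add: zero_power)
    show ?thesis
    proof (rule tendsto_sandwich[OF _ _ tendsto_const lim])
      have "scaled i m \<le> sqrt (\<pi> (i + d) / \<pi> i)" for i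
      proof -
        have n: "nat (int i + m) = i + d" by (simp add: d)
        have "scaled i m \<le> \<pi> (i + d) / \<pi> i * sqrt (\<pi> i / \<pi> (i + d))"
          unfolding scaled_def n by (intro mult_right_mono P_le_ratio) (simp add: pi_nonneg)
        also have "\<dots> = sqrt (\<pi> (i + d) / \<pi> i) * (sqrt (\<pi> (i + d) / \<pi> i) * sqrt (\<pi> i / \<pi> (i + d)))"
          by (simp add: pi_nonneg mult.assoc[symmetric])
        also have "sqrt (\<pi> (i + d) / \<pi> i) * sqrt (\<pi> i / \<pi> (i + d)) = 1"
          using pi_pos[of i] pi_pos[of "i + d"] by (simp add: real_sqrt_mult[symmetric])
        finally show ?thesis by simp
      qed
      then show "\<forall>\<^sub>F i in sequentially. scaled i m \<le> sqrt (\<pi> (i + d) / \<pi> i)" by simp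
    qed (simp add: scaled_nonneg)
  next
    case False
    then obtain d where d: "m = - int d" "d > 0" using \<open>m \<noteq> 0\<close> by (metis linorder_neqE_linordered_idom neg_int_cases)
    have "(\<lambda>i. sqrt (\<pi> (i + d) / \<pi> i)) \<longlonglongrightarrow> sqrt (\<tau> ^ d)" by (intro tendsto_intros ratio_lim_add)
    then have lim: "(\<lambda>i. sqrt (\<pi> (i + d) / \<pi> i)) \<longlonglongrightarrow> 0"
      using d(2) tau0 by (simp add: zero_power)
    have "(\<lambda>i. scaled (i + d) m) \<longlonglongrightarrow> 0"
    proof (rule tendsto_sandwich[OF _ _ tendsto_const lim])
      have "scaled (i + d) m \<le> sqrt (\<pi> (i + d) / \<pi> i)" for i
      proof -
        have n: "nat (int (i + d) + m) = i" by (simp add: d)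
        have "scaled (i + d) m \<le> 1 * sqrt (\<pi> (i + d) / \<pi> i)"
          unfolding scaled_def n by (intro mult_right_mono P_le_1) (simp add: pi_nonneg)
        then show ?thesis by simp
      qed
      then show "\<forall>\<^sub>F i in sequentially. scaled (i + d) m \<le> sqrt (\<pi> (i + d) / \<pi> i)" by simp
    qed (simp add: scaled_nonneg)
    then show ?thesis by (rule LIMSEQ_offset)
  qed
  show ?thesis
  proof (cases "m = 0")
    case True
    have "(\<lambda>i. scaled i 0) = (\<lambda>i. P i (nat (int i + 0)))"
      using pi_pos by (auto simp: scaled_def less_imp_neq[symmetric])
    then show ?thesis using a_lim[OF m] False True by (simp add: scaled_lim_def)
  next
    case mz: False
    then show ?thesis using small[OF mz] False by (simp add: scaled_lim_def)
  qed
qed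

lemma scaled_lim_nonneg: "m \<in> {- int N..int N} \<Longrightarrow> 0 \<le> scaled_lim m"
  using a_nonneg by (auto simp: scaled_lim_def)

lemma alpha_nonneg: "0 \<le> \<alpha>"
  unfolding alpha_eq by (intro sum_nonneg scaled_lim_nonneg)

lemma alpha0_eq: "alpha0 N P \<pi> = ereal \<alpha>"
proof -
  have "sqrt (P i j * adj_kernel P \<pi> j i) = P i j * sqrt (\<pi> i / \<pi> j)" for i j
  proof -
    have "P i j * adj_kernel P \<pi> j i = (P i j)\<^sup>2 * (\<pi> i / \<pi> j)"
      by (simp add: adj_kernel_def power2_eq_square)
    then show ?thesis by (simp only: real_sqrt_mult real_sqrt_abs abs_of_nonneg P_nonneg)
  qed
  then have "alpha0 N P \<pi> = (\<Sum>m = - int N..int N. limsup (\<lambda>i. ereal (scaled i m)))"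
    unfolding alpha0_def scaled_def by simp
  also have "\<dots> = (\<Sum>m = - int N..int N. ereal (scaled_lim m))"
    by (intro sum.cong refl lim_imp_Limsup) (auto intro: scaled_tendsto)
  finally show ?thesis by (simp add: alpha_eq)
qed

lemma inj_shift: "int N \<le> int i \<Longrightarrow> inj_on (\<lambda>m. nat (int i + m)) {- int N..int N}"
  by (rule inj_onI) auto

lemma sum_a_le_1: "(\<Sum>m = - int N..int N. a m) \<le> 1"
proof (rule LIMSEQ_le_const2)
  show "(\<lambda>i. \<Sum>m = - int N..int N. P i (nat (int i + m))) \<longlonglongrightarrow> (\<Sum>m = - int N..int N. a m)"
    by (intro tendsto_sum a_lim)
  have "(\<Sum>m = - int N..int N. P i (nat (int i + m))) \<le> 1" if i: "N \<le> i" for i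
  proof -
    have "(\<Sum>m = - int N..int N. P i (nat (int i + m))) = sum (P i) ((\<lambda>m. nat (int i + m)) ` {- int N..int N})"
      by (subst sum.reindex[OF inj_shift]) (use i in auto)
    also have "\<dots> \<le> (\<Sum>j. P i j)"
      by (rule sum_le_suminf[OF sums_summable[OF P_sums]]) (auto simp: P_nonneg)
    finally show ?thesis using sums_unique[OF P_sums, symmetric] by simp
  qed
  then show "\<exists>M. \<forall>i\<ge>M. (\<Sum>m = - int N..int N. P i (nat (int i + m))) \<le> 1" by blast
qed

text \<open>
  This is the limit of the invariance equation at \<open>j\<close>, divided by \<open>\<pi> j\<close>. Only an inequality
  remains, because rows with small index may also feed \<open>j\<close>.
\<close>

lemma sum_a_weighted_le_1:
  assumes "\<tau> > 0"
  shows "(\<Sum>m = - int N..int N. a m * \<tau> powr (- of_int m)) \<le> 1"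
proof (rule LIMSEQ_le_const2)
  define w where "w i m = P i (nat (int i + m)) * (\<pi> i / \<pi> (nat (int i + m)))" for i m
  have "(\<lambda>i. w i m) \<longlonglongrightarrow> a m * \<tau> powr (- of_int m)" if "m \<in> {- int N..int N}" for m
  proof -
    have "(\<lambda>i. P i (nat (int i + m)) * (1 / (\<pi> (nat (int i + m)) / \<pi> i))) \<longlonglongrightarrow> a m * (1 / \<tau> powr of_int m)"
      by (intro tendsto_intros a_lim that ratio_lim_int assms) (use assms in auto)
    then show ?thesis by (simp add: w_def powr_minus_divide)
  qed
  moreover have "filterlim (\<lambda>j. nat (int j - m)) at_top sequentially" for m
    unfolding filterlim_at_top
  proof
    fix Z :: nat
    show "\<forall>\<^sub>F j in sequentially. Z \<le> nat (int j - m)"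
      by (rule eventually_mono[OF eventually_ge_at_top[of "Z + nat \<bar>m\<bar>"]]) linarith
  qed
  ultimately have lim: "(\<lambda>j. w (nat (int j - m)) m) \<longlonglongrightarrow> a m * \<tau> powr (- of_int m)"
    if "m \<in> {- int N..int N}" for m
    using that filterlim_compose[of "\<lambda>i. w i m"] by blast
  show "(\<lambda>j. \<Sum>m = - int N..int N. w (nat (int j - m)) m)
      \<longlonglongrightarrow> (\<Sum>m = - int N..int N. a m * \<tau> powr (- of_int m))"
    by (intro tendsto_sum lim)
  have "(\<Sum>m = - int N..int N. w (nat (int j - m)) m) \<le> 1" if j: "N \<le> j" for j
  proof -
    have inj: "inj_on (\<lambda>m. nat (int j - m)) {- int N..int N}"
      by (rule inj_onI) (use j in auto)
    have "(\<Sum>m = - int N..int N. w (nat (int j - m)) m)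
        = (\<Sum>m = - int N..int N. \<pi> (nat (int j - m)) * P (nat (int j - m)) j) / \<pi> j"
      unfolding sum_divide_distrib
    proof (intro sum.cong refl)
      fix m assume "m \<in> {- int N..int N}"
      then have "nat (int (nat (int j - m)) + m) = j" using j by auto
      then show "w (nat (int j - m)) m = \<pi> (nat (int j - m)) * P (nat (int j - m)) j / \<pi> j"
        by (simp add: w_def)
    qed
    also have "(\<Sum>m = - int N..int N. \<pi> (nat (int j - m)) * P (nat (int j - m)) j)
        = (\<Sum>i\<in>(\<lambda>m. nat (int j - m)) ` {- int N..int N}. \<pi> i * P i j)"
      by (subst sum.reindex[OF inj]) auto
    also have "\<dots> \<le> (\<Sum>i. \<pi> i * P i j)"
      by (rule sum_le_suminf[OF sums_summable[OF pi_inv]]) (auto simp: P_nonneg pi_nonneg)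
    also have "\<dots> = \<pi> j" by (rule sums_unique[OF pi_inv, symmetric])
    finally show ?thesis using pi_pos[of j] by (simp add: divide_right_mono)
  qed
  then show "\<exists>M. \<forall>j\<ge>M. (\<Sum>m = - int N..int N. w (nat (int j - m)) m) \<le> 1" by blast
qed

text \<open>
  Each summand \<open>a\<^sub>m \<tau>\<^bsup>-m/2\<^esup>\<close> is the geometric mean of \<open>a\<^sub>m\<close> and \<open>a\<^sub>m \<tau>\<^bsup>-m\<^esup>\<close>, and both of
  these families have sum at most 1. The negative drift provides some \<open>k < 0\<close> with
  \<open>a\<^sub>k > 0\<close>, for which the inequality of the means is strict.
\<close>

lemma alpha_less_1: "\<alpha> < 1"
proof -
  have "\<exists>k\<in>{- int N..int N}. of_int k * a k < 0"
  proof (rule ccontr)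
    assume "\<not> ?thesis"
    then have "0 \<le> (\<Sum>k = - int N..int N. of_int k * a k)" by (intro sum_nonneg) (auto simp: not_less)
    with drift show False by simp
  qed
  then obtain k where k: "k \<in> {- int N..int N}" "of_int k * a k < 0" by blast
  have ak: "0 < a k" "k < 0" using k(2) a_nonneg[OF k(1)] by (auto simp: mult_less_0_iff)
  show ?thesis
  proof (cases "\<tau> > 0")
    case True
    let ?x = "\<lambda>m. \<tau> powr (- real_of_int m / 2)"
    have sq: "(?x m)\<^sup>2 = \<tau> powr (- of_int m)" for m
      by (simp add: power2_eq_square powr_add[symmetric])
    \<comment> \<open>the defect in the inequality of the arithmetic and geometric means\<close>
    have gap: "(a m + a m * \<tau> powr (- of_int m)) / 2 - a m * ?x m = a m * (1 - ?x m)\<^sup>2 / 2" for m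
      by (simp add: sq[symmetric] power2_eq_square field_simps)
    have "(\<Sum>m = - int N..int N. a m * ?x m) < (\<Sum>m = - int N..int N. (a m + a m * \<tau> powr (- of_int m)) / 2)"
    proof (rule sum_strict_mono_ex1)
      show "\<forall>m\<in>{- int N..int N}. a m * ?x m \<le> (a m + a m * \<tau> powr (- of_int m)) / 2"
      proof
        fix m assume "m \<in> {- int N..int N}"
        then have "0 \<le> a m * (1 - ?x m)\<^sup>2 / 2" using a_nonneg by simp
        then show "a m * ?x m \<le> (a m + a m * \<tau> powr (- of_int m)) / 2" using gap[of m] by linarith
      qed
      have "?x k < 1 powr (- real_of_int k / 2)"
        by (rule powr_less_mono2) (use True tau ak in auto)
      then have "0 < a k * (1 - ?x k)\<^sup>2 / 2" using ak(1) by simp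
      then have "a k * ?x k < (a k + a k * \<tau> powr (- of_int k)) / 2" using gap[of k] by linarith
      with k(1) show "\<exists>m\<in>{- int N..int N}. a m * ?x m < (a m + a m * \<tau> powr (- of_int m)) / 2" by blast
    qed simp
    also have "\<dots> = ((\<Sum>m = - int N..int N. a m) + (\<Sum>m = - int N..int N. a m * \<tau> powr (- of_int m))) / 2"
      by (simp add: sum.distrib sum_divide_distrib[symmetric])
    also have "\<dots> \<le> 1" using sum_a_le_1 sum_a_weighted_le_1[OF True] by simp
    finally show ?thesis using True by (simp add: \<alpha>_def)
  next
    case False
    have "a 0 + a k = sum a {0, k}" using ak(2) by simp
    also have "\<dots> \<le> (\<Sum>m = - int N..int N. a m)"
      by (rule sum_mono2) (use k(1) a_nonneg in auto)
    also have "\<dots> \<le> 1" by (rule sum_a_le_1)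
    finally show ?thesis using False ak(1) by (simp add: \<alpha>_def)
  qed
qed

lemma eventually_ratio_le:
  assumes "\<tau> < t" shows "\<forall>\<^sub>F i in sequentially. \<pi> (Suc i) \<le> t * \<pi> i"
  using order_tendstoD(2)[OF ratio_lim assms]
proof eventually_elim
  case (elim i)
  then show ?case using pi_pos[of i] by (simp add: field_simps)
qed

lemma sqrt_pi_summable: "summable (\<lambda>i. sqrt (\<pi> i))"
proof -
  obtain t where t: "\<tau> < t" "t < 1" using dense[OF tau(2)] by blast
  obtain M where M: "\<And>i. M \<le> i \<Longrightarrow> \<pi> (Suc i) \<le> t * \<pi> i"
    using eventually_ratio_le[OF t(1)] unfolding eventually_sequentially by blast
  show ?thesis
  proof (rule summable_ratio_test[of "sqrt t" M])
    show "sqrt t < 1" using t by simp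
    show "norm (sqrt (\<pi> (Suc i))) \<le> sqrt t * norm (sqrt (\<pi> i))" if "M \<le> i" for i
      using M[OF that] pi_nonneg by (simp add: real_sqrt_mult[symmetric])
  qed
qed

text \<open>
  Half of the gap \<open>\<delta> - \<alpha>\<close> pays for the deviation of the scaled entries from their limits, the
  other half for the rank-one term of the deflation, which is small far out because
  \<open>\<Sum>\<surd>\<pi>\<close> converges.
\<close>

lemma eventually_contracting:
  assumes \<delta>: "\<alpha> < \<delta>" and V: "\<And>i. V i = 1 / sqrt (\<pi> i)"
  obtains n0 n1 where "contracting_kernel P \<pi> V n0 n1 \<delta>"
proof -
  define \<eta> where "\<eta> = (\<delta> - \<alpha>) / 2"
  \<comment> \<open>there are \<open>2 N + 1\<close> diagonals in the band\<close>
  define \<epsilon> where "\<epsilon> = \<eta> / real (2 * N + 1)"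
  have \<eta>: "0 < \<eta>" and \<epsilon>: "0 < \<epsilon>" using \<delta> by (simp_all add: \<eta>_def \<epsilon>_def)
  have Vpos: "0 < V i" for i by (simp add: V pi_pos)
  have sum_eps: "(\<Sum>m = - int N..int N. scaled_lim m + \<epsilon>) + \<eta> = \<delta>"
  proof -
    have card: "card {- int N..int N} = 2 * N + 1" by (simp add: nat_eq_iff)
    have "(\<Sum>m = - int N..int N. scaled_lim m + \<epsilon>) = \<alpha> + real (2 * N + 1) * \<epsilon>"
      unfolding sum.distrib alpha_eq sum_constant card ..
    also have "real (2 * N + 1) * \<epsilon> = \<eta>"
      by (simp add: \<epsilon>_def del: of_nat_add of_nat_mult of_nat_Suc)
    finally show ?thesis by (simp add: \<eta>_def field_simps)
  qed
  have E1: "\<forall>\<^sub>F i in sequentially. \<forall>m\<in>{- int N..int N}. scaled i m \<le> scaled_lim m + \<epsilon>"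
  proof (rule eventually_ball_finite)
    show "\<forall>m\<in>{- int N..int N}. \<forall>\<^sub>F i in sequentially. scaled i m \<le> scaled_lim m + \<epsilon>"
    proof
      fix m assume "m \<in> {- int N..int N}"
      then have "\<forall>\<^sub>F i in sequentially. scaled i m < scaled_lim m + \<epsilon>"
        by (intro order_tendstoD(2)[OF scaled_tendsto]) (use \<epsilon> in auto)
      then show "\<forall>\<^sub>F i in sequentially. scaled i m \<le> scaled_lim m + \<epsilon>"
        by (rule eventually_mono) simp
    qed
  qed simp
  have "0 < \<eta> / V 0" using \<eta> Vpos by simp
  from order_tendstoD(2)[OF summable_LIMSEQ_zero[OF sqrt_pi_summable] this]
  have E2: "\<forall>\<^sub>F i in sequentially. V 0 \<le> \<eta> * V i"
  proof eventually_elim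
    case (elim i)
    then have "V 0 * sqrt (\<pi> i) < \<eta>" using Vpos[of 0] by (simp add: field_simps)
    then show ?case using pi_pos[of i] by (simp add: V field_simps)
  qed
  have "0 < \<eta> * sqrt (\<pi> 0)" using \<eta> pi_pos[of 0] by simp
  then obtain n2 where n2: "\<And>m n. n2 \<le> m \<Longrightarrow> norm (\<Sum>i=m..<n. sqrt (\<pi> i)) < \<eta> * sqrt (\<pi> 0)"
    using sqrt_pi_summable unfolding summable_Cauchy by blast
  have "\<forall>\<^sub>F i in sequentially. (\<forall>m\<in>{- int N..int N}. scaled i m \<le> scaled_lim m + \<epsilon>) \<and> V 0 \<le> \<eta> * V i"
    by (rule eventually_conj[OF E1 E2])
  then obtain n3 where n3: "\<And>i m. n3 \<le> i \<Longrightarrow> m \<in> {- int N..int N} \<Longrightarrow> scaled i m \<le> scaled_lim m + \<epsilon>"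
    "\<And>i. n3 \<le> i \<Longrightarrow> V 0 \<le> \<eta> * V i"
    unfolding eventually_sequentially by blast
  define n0 where "n0 = max (max n2 n3) (max i\<^sub>0 N)"
  obtain n1 where n1: "\<And>i. n1 \<le> i \<Longrightarrow> \<pi> (Suc i) \<le> 1 * \<pi> i"
    using eventually_ratio_le[OF tau(2)] unfolding eventually_sequentially by blast
  have PV: "P i (nat (int i + m)) * V (nat (int i + m)) = scaled i m * V i" for i m
    using pi_pos[of i] by (simp add: scaled_def V real_sqrt_divide)
  have row: "(\<Sum>j. P i j * V j) + V 0 \<le> \<delta> * V i" if i: "n0 \<le> i" for i
  proof -
    have iN: "N \<le> i" "i\<^sub>0 \<le> i" "n3 \<le> i" using i by (auto simp: n0_def)
    let ?I = "(\<lambda>m. nat (int i + m)) ` {- int N..int N}"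
    have "(\<Sum>j. P i j * V j) = (\<Sum>j\<in>?I. P i j * V j)"
    proof (rule suminf_finite)
      fix j assume j: "j \<notin> ?I"
      have "int N < \<bar>int i - int j\<bar>"
      proof (rule ccontr)
        assume "\<not> int N < \<bar>int i - int j\<bar>"
        then have "int j - int i \<in> {- int N..int N}" "nat (int i + (int j - int i)) = j" by auto
        then have "j \<in> ?I" by (metis (no_types, lifting) image_eqI)
        with j show False by contradiction
      qed
      then show "P i j * V j = 0" using band[OF iN(2)] by simp
    qed simp
    also have "\<dots> = (\<Sum>m = - int N..int N. scaled i m * V i)"
      by (subst sum.reindex[OF inj_shift]) (use iN PV in auto)
    also have "\<dots> \<le> (\<Sum>m = - int N..int N. (scaled_lim m + \<epsilon>) * V i)"
      by (intro sum_mono mult_right_mono n3 iN less_imp_le[OF Vpos])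
    also have "\<dots> = (\<Sum>m = - int N..int N. scaled_lim m + \<epsilon>) * V i"
      by (rule sum_distrib_right[symmetric])
    finally have "(\<Sum>j. P i j * V j) + V 0 \<le> (\<Sum>m = - int N..int N. scaled_lim m + \<epsilon>) * V i + \<eta> * V i"
      using n3(2)[OF iN(3)] by simp
    also have "\<dots> = \<delta> * V i" unfolding distrib_right[symmetric] sum_eps ..
    finally show ?thesis .
  qed
  have col: "(\<Sum>i=n0..<n. sqrt (\<pi> i) * (P i j + (if j = 0 then 1 else 0))) \<le> \<delta> * sqrt (\<pi> j)" for j n
  proof -
    let ?S = "{i\<in>{n0..<n}. \<bar>int i - int j\<bar> \<le> int N}"
    have Ps: "sqrt (\<pi> i) * P i j = scaled i (int j - int i) * sqrt (\<pi> j)" for i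
      using pi_pos[of j] by (simp add: scaled_def real_sqrt_divide)
    have "(\<Sum>i=n0..<n. sqrt (\<pi> i) * P i j) = (\<Sum>i\<in>?S. sqrt (\<pi> i) * P i j)"
    proof (rule sum.mono_neutral_right)
      show "\<forall>i\<in>{n0..<n} - ?S. sqrt (\<pi> i) * P i j = 0"
      proof
        fix i assume "i \<in> {n0..<n} - ?S"
        then have "i\<^sub>0 \<le> i" "int N < \<bar>int i - int j\<bar>" by (auto simp: n0_def)
        then show "sqrt (\<pi> i) * P i j = 0" using band by simp
      qed
    qed auto
    also have "\<dots> \<le> (\<Sum>i\<in>?S. (scaled_lim (int j - int i) + \<epsilon>) * sqrt (\<pi> j))"
      unfolding Ps by (intro sum_mono mult_right_mono n3) (auto simp: n0_def pi_nonneg)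
    also have "\<dots> = (\<Sum>i\<in>?S. scaled_lim (int j - int i) + \<epsilon>) * sqrt (\<pi> j)"
      by (rule sum_distrib_right[symmetric])
    also have "(\<Sum>i\<in>?S. scaled_lim (int j - int i) + \<epsilon>) = (\<Sum>m\<in>(\<lambda>i. int j - int i) ` ?S. scaled_lim m + \<epsilon>)"
      by (subst sum.reindex) (auto simp: inj_on_def)
    also have "\<dots> \<le> (\<Sum>m = - int N..int N. scaled_lim m + \<epsilon>)"
      by (rule sum_mono2) (auto intro!: add_nonneg_nonneg scaled_lim_nonneg less_imp_le[OF \<epsilon>])
    finally have first: "(\<Sum>i=n0..<n. sqrt (\<pi> i) * P i j) \<le> (\<Sum>m = - int N..int N. scaled_lim m + \<epsilon>) * sqrt (\<pi> j)"
      by (simp add: mult_right_mono pi_nonneg)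
    have second: "(\<Sum>i=n0..<n. sqrt (\<pi> i) * (if j = 0 then 1 else 0)) \<le> \<eta> * sqrt (\<pi> j)"
    proof (cases "j = 0")
      case True
      have "(\<Sum>i=n0..<n. sqrt (\<pi> i)) \<le> \<eta> * sqrt (\<pi> 0)"
      proof -
        have "n2 \<le> n0" by (simp add: n0_def)
        from n2[OF this, of n] show ?thesis by simp
      qed
      then show ?thesis using True by simp
    qed (use \<eta> pi_nonneg in auto)
    have "(\<Sum>i=n0..<n. sqrt (\<pi> i) * (P i j + (if j = 0 then 1 else 0)))
        = (\<Sum>i=n0..<n. sqrt (\<pi> i) * P i j) + (\<Sum>i=n0..<n. sqrt (\<pi> i) * (if j = 0 then 1 else 0))"
      by (simp only: distrib_left sum.distrib)
    also have "\<dots> \<le> (\<Sum>m = - int N..int N. scaled_lim m + \<epsilon>) * sqrt (\<pi> j) + \<eta> * sqrt (\<pi> j)"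
      by (rule add_mono[OF first second])
    also have "\<dots> = \<delta> * sqrt (\<pi> j)" unfolding distrib_right[symmetric] sum_eps ..
    finally show ?thesis .
  qed
  have "contracting_kernel P \<pi> V n0 n1 \<delta>"
    by unfold_locales (use V sqrt_pi_summable row col n1 \<delta> alpha_nonneg in auto)
  then show ?thesis by (rule that)
qed

text \<open>
  Either some \<open>\<delta> > \<alpha>\<close> admits a zero, and all three quantities are determined by it, or every
  \<open>\<delta>\<close> is an upper bound for them.
\<close>

lemma dichotomy:
  assumes V: "\<And>i. V i = 1 / sqrt (\<pi> i)"
  shows "(rate2 P \<pi> \<le> \<alpha> \<and> rateV V P \<pi> \<le> \<alpha> \<and> limsup (\<lambda>k. ereal (rho_trunc P k)) \<le> ereal \<alpha>)
    \<or> (\<alpha> < rate2 P \<pi> \<and> rateV V P \<pi> = rate2 P \<pi> \<and> (\<lambda>k. rho_trunc P k) \<longlonglongrightarrow> rate2 P \<pi>)"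
proof (cases "\<exists>\<delta> n0 n1 z. \<alpha> < \<delta> \<and> contracting_kernel P \<pi> V n0 n1 \<delta> \<and>
     cmod z < 1 / \<delta> \<and> eval_fps (char_fps n0 (deflate P)) z = 0")
  case True
  then obtain \<delta> n0 n1 z where d: "\<alpha> < \<delta>" and c: "contracting_kernel P \<pi> V n0 n1 \<delta>"
    and z: "cmod z < 1 / \<delta>" "eval_fps (char_fps n0 (deflate P)) z = 0" by blast
  obtain R where "\<delta> < R" "rate2 P \<pi> = R" "rateV V P \<pi> = R" "(\<lambda>k. rho_trunc P k) \<longlonglongrightarrow> R"
    by (rule contracting_kernel.rates_of_zero[OF c z])
  then show ?thesis using d by simp
next
  case False
  have bounds: "rate2 P \<pi> \<le> \<delta> \<and> rateV V P \<pi> \<le> \<delta> \<and> (\<forall>s>\<delta>. \<forall>\<^sub>F k in sequentially. rho_trunc P k < s)"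
    if d: "\<alpha> < \<delta>" "\<delta> < 1" for \<delta>
  proof -
    obtain n0 n1 where c: "contracting_kernel P \<pi> V n0 n1 \<delta>"
      by (rule eventually_contracting[OF d(1) V])
    have "eval_fps (char_fps n0 (deflate P)) z \<noteq> 0" if "cmod z < 1 / \<delta>" for z
      using False d(1) c that by blast
    from contracting_kernel.rates_of_no_zero[OF c d(2) this] show ?thesis by blast
  qed
  have "rate2 P \<pi> \<le> \<alpha>" "rateV V P \<pi> \<le> \<alpha>"
    using bounds by (auto intro!: dense_ge_bounded[OF alpha_less_1])
  moreover have "limsup (\<lambda>k. ereal (rho_trunc P k)) \<le> ereal \<alpha>"
  proof (rule ereal_le_epsilon2)
    fix e :: real assume "0 < e"
    show "limsup (\<lambda>k. ereal (rho_trunc P k)) \<le> ereal \<alpha> + ereal e"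
    proof -
      obtain \<delta> where d: "\<alpha> < \<delta>" "\<delta> < min (\<alpha> + e) 1"
        using dense[of \<alpha> "min (\<alpha> + e) 1"] alpha_less_1 \<open>0 < e\<close> by auto
      then have "\<forall>\<^sub>F k in sequentially. rho_trunc P k < \<alpha> + e"
        by (intro bounds[THEN conjunct2, THEN conjunct2, rule_format, of \<delta>]) simp_all
      then have "\<forall>\<^sub>F k in sequentially. ereal (rho_trunc P k) \<le> ereal (\<alpha> + e)"
        by (rule eventually_mono) simp
      then show "limsup (\<lambda>k. ereal (rho_trunc P k)) \<le> ereal \<alpha> + ereal e"
        unfolding plus_ereal.simps by (rule Limsup_bounded)
    qed
  qed
  ultimately show ?thesis by blast
qed

end

theorem proposition2:
  fixes P :: "nat \<Rightarrow> nat \<Rightarrow> real" and \<pi> V :: "nat \<Rightarrow> real"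
    and N i\<^sub>0 :: nat and a :: "int \<Rightarrow> real" and \<tau> :: real
  assumes "markov_kernel P"
    and "irreducible_kernel P"
    and "aperiodic_kernel P"
    and "invariant_prob P \<pi>"
    and "\<And>q. invariant_prob P q \<Longrightarrow> q = \<pi>"
    and "N \<ge> 1"
    and "\<And>i j. i \<ge> i\<^sub>0 \<Longrightarrow> \<bar>int i - int j\<bar> > int N \<Longrightarrow> P i j = 0"
    and "\<And>m. m \<in> {- int N..int N} \<Longrightarrow> a m \<in> {0..1}"
    and "\<And>m. m \<in> {- int N..int N} \<Longrightarrow> (\<lambda>i. P i (nat (int i + m))) \<longlonglongrightarrow> a m"
    and "0 \<le> \<tau>" and "\<tau> < 1"
    and "(\<lambda>i. \<pi> (i + 1) / \<pi> i) \<longlonglongrightarrow> \<tau>"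
    and "(\<Sum>k = - int N..int N. of_int k * a k) < 0"
    and "\<And>n. V n = \<pi> n powr (- 1 / 2)"
  shows "alpha0 N P \<pi> =
           ereal (if \<tau> > 0 then \<Sum>m = - int N..int N. a m * \<tau> powr (- of_int m / 2) else a 0)
       \<and> ((ereal (rate2 P \<pi>) \<le> alpha0 N P \<pi> \<longleftrightarrow> ereal (rateV V P \<pi>) \<le> alpha0 N P \<pi>)
          \<and> (ereal (rate2 P \<pi>) \<le> alpha0 N P \<pi> \<longrightarrow>
               limsup (\<lambda>k. ereal (rho_trunc P k)) \<le> alpha0 N P \<pi>))
       \<and> ((ereal (rate2 P \<pi>) > alpha0 N P \<pi> \<longleftrightarrow> ereal (rateV V P \<pi>) > alpha0 N P \<pi>)
          \<and> (ereal (rate2 P \<pi>) > alpha0 N P \<pi> \<longrightarrow>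
               rate2 P \<pi> = rateV V P \<pi> \<and> (\<lambda>k. rho_trunc P k) \<longlonglongrightarrow> rate2 P \<pi>))"
proof -
  interpret band_kernel P \<pi> N i\<^sub>0 a \<tau>
    by unfold_locales (use assms(1-4,7-13) in auto)
  have V: "V i = 1 / sqrt (\<pi> i)" for i
    using assms(14)[of i] pi_pos[of i] by (simp add: powr_minus_divide powr_half_sqrt)
  show ?thesis
    using dichotomy[of V, OF V] unfolding alpha0_eq \<alpha>_def[symmetric] by auto
qed

end
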